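(* Let $E\subset\mathbb{R}^2$ be a closed, nondegenerate, convex quadrilateral and let $r\ge1$. Let $\mathcal{DS}_{r+1}(E)=\mathbb{P}_{r+1}(E)\oplus\mathbb{S}_{r+1}^{\mathcal{DS}}(E)$ be any of the direct serendipity spaces described in the context (fully direct or with mapped supplements), set $\mathbb{S}_r^{\mathbf{V}}(E)=\mathrm{curl}\,\mathbb{S}_{r+1}^{\mathcal{DS}}(E)$, and define the reduced and full direct mixed spaces $$\mathbf{V}_r^{\mathrm{red}}(E)=\mathbb{P}_r^2(E)\oplus\mathbb{S}_r^{\mathbf{V}}(E),\qquad \mathbf{V}_r^{\mathrm{full}}(E)=\mathbb{P}_r^2(E)\oplus\mathbf{x}\tilde{\mathbb{P}}_r(E)\oplus\mathbb{S}_r^{\mathbf{V}}(E).$$ Then the sequences $$\mathbb{R}\hookrightarrow\mathcal{DS}_{r+1}(E)\xrightarrow{\ \mathrm{curl}\ }\mathbf{V}_r^{\mathrm{full}}(E)\xrightarrow{\ \mathrm{div}\ }\mathbb{P}_{r}(E)\to0$$ and $$\mathbb{R}\hookrightarrow\mathcal{DS}_{r+1}(E)\xrightarrow{\ \mathrm{curl}\ }\mathbf{V}_r^{\mathrm{red}}(E)\xrightarrow{\ \mathrm{div}\ }\mathbb{P}_{r-1}(E)\to0$$ are (well defined and) exact, i.e. the image of each map equals the kernel of the next.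
   Context: $\mathbb{P}_k(E)$ is the space of polynomials of total degree at most $k$ restricted to $E$, $\mathbb{P}_k^2(E)$ the corresponding vector polynomials, $\tilde{\mathbb{P}}_k(E)$ the homogeneous polynomials of degree $k$; $\mathbf{x}=(x_1,x_2)$ is the position vector. For a scalar $\phi$, $\mathrm{curl}\,\phi=(\partial\phi/\partial x_2,-\partial\phi/\partial x_1)$. Derivatives (curl, div) are understood in the weak sense where necessary. $\mathbb{R}\hookrightarrow$ denotes inclusion of the constant functions. Quadrilateral. $E$ is nondegenerate if it does not degenerate to a triangle, segment or point. $\hat E=[-1,1]^2$, and $\mathbf{F}_E:\hat E\to E$ is the bilinear bijective map taking vertices to vertices (consecutive to consecutive). For $\hat\phi$ on $\hat E$, $F_E^0(\hat\phi)(\mathbf{x})=\hat\phi(\hat{\mathbf{x}})$ with $\mathbf{x}=\mathbf{F}_E(\hat{\mathbf{x}})$. The edges of $E$ are numbered so that $e_1,e_2$ (images of $\hat x_1=-1$, $\hat x_1=1$) and $e_3,e_4$ (images of $\hat x_2=-1$, $\hat x_2=1$) are the two pairs of opposite edges. $\nu_i$ is the unit outer normal to $e_i$, $\lambda_i(\mathbf{x})=-(\mathbf{x}-\mathbf{x}_i)\cdot\nu_i$ for any $\mathbf{x}_i\in e_i$, and $\mathcal{L}_i$ is the infinite line containing $e_i$. The direct serendipity spaces (of index $r+1\ge2$) are $\mathcal{DS}_{r+1}(E)=\mathbb{P}_{r+1}(E)\oplus\mathbb{S}_{r+1}^{\mathcal{DS}}(E)$, with one of the following choices of supplement space. (i)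 Fully direct: $\mathbb{S}_{r+1}^{\mathcal{DS}}(E)=\mathrm{span}\{\lambda_3\lambda_4\lambda_H^{r-1}R_V,\ \lambda_1\lambda_2\lambda_V^{r-1}R_H\}$, where: - $\lambda_H$ is a linear polynomial. If $e_1\parallel e_2$, its zero line intersects both $\mathcal{L}_1$ and $\mathcal{L}_2$; if $e_1\nparallel e_2$, $\lambda_H=\alpha_H\lambda_1+\beta_H\lambda_2+\gamma_H$ with $\alpha_H,\beta_H>0$, $\gamma_H\ne0$. - $\lambda_V$ is a linear polynomial. If $e_3\parallel e_4$, its zero line intersects both $\mathcal{L}_3$ and $\mathcal{L}_4$; if $e_3\nparallel e_4$, $\lambda_V=\alpha_V\lambda_3+\beta_V\lambda_4+\gamma_V$ with $\alpha_V,\beta_V>0$, $\gamma_V\ne0$. - $R_V,R_H$ are bounded functions on $E$, continuous and in $H^1(E)$, with $R_V=-\eta_V$ on $e_1$, $R_V=\xi_V$ on $e_2$, $R_H=-\eta_H$ on $e_3$, $R_H=\xi_H$ on $e_4$ for some positive constants $\eta_V,\xi_V,\eta_H,\xi_H$. (ii) Mapped supplements: $\mathbb{S}_{r+1}^{\mathcal{DS}}(E)=\mathrm{span}\{F_E^0((1-\hat x_2^2)\hat x_1\hat x_2^{r-1}),\ F_E^0((1-\hat x_1^2)\hat x_2\hat x_1^{r-1})\}$. *)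

theory Defs
  imports "HOL-Analysis.Analysis"
begin

section \<open>Weak derivatives\<close>

definition partial :: "2 \<Rightarrow> (real^2 \<Rightarrow> real) \<Rightarrow> real^2 \<Rightarrow> real" where
  "partial i f x = frechet_derivative f (at x) (axis i 1)"

primrec C_k :: "nat \<Rightarrow> (real^2 \<Rightarrow> real) \<Rightarrow> bool" where
  "C_k 0 f \<longleftrightarrow> continuous_on UNIV f"
| "C_k (Suc k) f \<longleftrightarrow> (\<forall>x. f differentiable (at x)) \<and> (\<forall>i. C_k k (partial i f))"

definition test_function :: "(real^2) set \<Rightarrow> (real^2 \<Rightarrow> real) \<Rightarrow> bool" where
  "test_function \<Omega> \<psi> \<longleftrightarrow>
     (\<forall>k. C_k k \<psi>) \<and> (\<exists>K. compact K \<and> K \<subseteq> \<Omega> \<and> (\<forall>x. x \<notin> K \<longrightarrow> \<psi> x = 0))"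

definition locally_integrable_on ::
    "(real^2) set \<Rightarrow> (real^2 \<Rightarrow> 'a::euclidean_space) \<Rightarrow> bool" where
  "locally_integrable_on \<Omega> f \<longleftrightarrow>
     (\<forall>K. compact K \<and> K \<subseteq> \<Omega> \<longrightarrow> f absolutely_integrable_on K)"

definition has_weak_partial ::
    "(real^2) set \<Rightarrow> 2 \<Rightarrow> (real^2 \<Rightarrow> real) \<Rightarrow> (real^2 \<Rightarrow> real) \<Rightarrow> bool" where
  "has_weak_partial \<Omega> i f g \<longleftrightarrow>
     locally_integrable_on \<Omega> f \<and> locally_integrable_on \<Omega> g \<and>
     (\<forall>\<psi>. test_function \<Omega> \<psi> \<longrightarrow>
        (LINT x:\<Omega>|lebesgue. f x * partial i \<psi> x) = - (LINT x:\<Omega>|lebesgue. g x * \<psi> x))"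

definition has_weak_curl ::
    "(real^2) set \<Rightarrow> (real^2 \<Rightarrow> real) \<Rightarrow> (real^2 \<Rightarrow> real^2) \<Rightarrow> bool" where
  "has_weak_curl \<Omega> \<phi> v \<longleftrightarrow>
     has_weak_partial \<Omega> 2 \<phi> (\<lambda>x. v x $ 1) \<and> has_weak_partial \<Omega> 1 \<phi> (\<lambda>x. - (v x $ 2))"

definition has_weak_div ::
    "(real^2) set \<Rightarrow> (real^2 \<Rightarrow> real^2) \<Rightarrow> (real^2 \<Rightarrow> real) \<Rightarrow> bool" where
  "has_weak_div \<Omega> v g \<longleftrightarrow>
     locally_integrable_on \<Omega> v \<and> locally_integrable_on \<Omega> g \<and>
     (\<forall>\<psi>. test_function \<Omega> \<psi> \<longrightarrow>
        (LINT x:\<Omega>|lebesgue. (\<Sum>i\<in>UNIV. v x $ i * partial i \<psi> x))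
          = - (LINT x:\<Omega>|lebesgue. g x * \<psi> x))"

definition L2_on :: "(real^2) set \<Rightarrow> (real^2 \<Rightarrow> real) set" where
  "L2_on \<Omega> = {f. f \<in> borel_measurable (lebesgue_on \<Omega>) \<and> integrable (lebesgue_on \<Omega>) (\<lambda>x. (f x)\<^sup>2)}"

definition H1_on :: "(real^2) set \<Rightarrow> (real^2 \<Rightarrow> real) set" where
  "H1_on \<Omega> = {f \<in> L2_on \<Omega>. \<forall>i. \<exists>g \<in> L2_on \<Omega>. has_weak_partial \<Omega> i f g}"


section \<open>Spaces of functions on E\<close>

text \<open>A function on \<open>E\<close> is represented by any total function that agrees with it almost
  everywhere on \<open>E\<close>: spaces are sets of representatives, equality is \<open>ae_eq\<close>, and
  \<open>restr\<close> turns a set of functions on the plane into the space of their restrictions to \<open>E\<close>.\<close>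

definition ae_eq :: "(real^2) set \<Rightarrow> (real^2 \<Rightarrow> 'a) \<Rightarrow> (real^2 \<Rightarrow> 'a) \<Rightarrow> bool" where
  "ae_eq E f g \<longleftrightarrow> (AE x in lebesgue_on E. f x = g x)"

definition restr :: "(real^2) set \<Rightarrow> (real^2 \<Rightarrow> 'a) set \<Rightarrow> (real^2 \<Rightarrow> 'a) set" where
  "restr E A = {f. \<exists>g\<in>A. ae_eq E f g}"

definition fun_sum ::
    "(real^2 \<Rightarrow> 'a::real_vector) set \<Rightarrow> (real^2 \<Rightarrow> 'a) set \<Rightarrow> (real^2 \<Rightarrow> 'a) set" where
  "fun_sum A B = {\<lambda>x. f x + g x | f g. f \<in> A \<and> g \<in> B}"

definition span2 :: "(real^2 \<Rightarrow> real) \<Rightarrow> (real^2 \<Rightarrow> real) \<Rightarrow> (real^2 \<Rightarrow> real) set" where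
  "span2 f g = {\<lambda>x. a * f x + b * g x | a b. True}"

definition direct_on ::
    "(real^2) set \<Rightarrow> (real^2 \<Rightarrow> 'a::real_vector) set \<Rightarrow> (real^2 \<Rightarrow> 'a) set \<Rightarrow> bool" where
  "direct_on E A B \<longleftrightarrow> (\<forall>f\<in>A. \<forall>g\<in>B. ae_eq E f g \<longrightarrow> ae_eq E f (\<lambda>_. 0))"

definition polys :: "nat \<Rightarrow> (real^2 \<Rightarrow> real) set" where
  "polys k = {\<lambda>x. \<Sum>i\<le>k. \<Sum>j\<le>k - i. c i j * (x $ 1) ^ i * (x $ 2) ^ j | c. True}"

definition hom_polys :: "nat \<Rightarrow> (real^2 \<Rightarrow> real) set" where
  "hom_polys k = {\<lambda>x. \<Sum>i\<le>k. c i * (x $ 1) ^ i * (x $ 2) ^ (k - i) | c. True}"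

definition vec_polys :: "nat \<Rightarrow> (real^2 \<Rightarrow> real^2) set" where
  "vec_polys k = {v. \<forall>i. (\<lambda>x. v x $ i) \<in> polys k}"

definition x_hom_polys :: "nat \<Rightarrow> (real^2 \<Rightarrow> real^2) set" where
  "x_hom_polys k = {\<lambda>x. h x *\<^sub>R x | h. h \<in> hom_polys k}"


section \<open>Convex quadrilaterals\<close>

text \<open>Four extreme points in the plane exclude triangles, segments and points.\<close>

definition convex_quadrilateral :: "(real^2) set \<Rightarrow> bool" where
  "convex_quadrilateral E \<longleftrightarrow> polytope E \<and> card {v. v extreme_point_of E} = 4"

definition ref_square :: "(real^2) set" where
  "ref_square = cbox (-1) 1"

definition bilinear_map :: "(real^2) set \<Rightarrow> (real^2 \<Rightarrow> real^2) \<Rightarrow> bool" where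
  "bilinear_map E F \<longleftrightarrow>
     (\<exists>a b c d. \<forall>x. F x = a + (x $ 1) *\<^sub>R b + (x $ 2) *\<^sub>R c + (x $ 1 * x $ 2) *\<^sub>R d) \<and>
     bij_betw F ref_square E \<and>
     F ` {v. v extreme_point_of ref_square} = {v. v extreme_point_of E} \<and>
     (\<forall>e. e edge_of ref_square \<longrightarrow> (F ` e) edge_of E)"

text \<open>\<open>side F i s\<close> is the image of the edge of the square on which the \<open>i\<close>-th coordinate is \<open>s\<close>.\<close>

definition side :: "(real^2 \<Rightarrow> real^2) \<Rightarrow> 2 \<Rightarrow> real \<Rightarrow> (real^2) set" where
  "side F i s = F ` {x \<in> ref_square. x $ i = s}"

definition outer_normal :: "(real^2) set \<Rightarrow> (real^2) set \<Rightarrow> real^2" where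
  "outer_normal E e = (THE \<nu>. norm \<nu> = 1 \<and> (\<forall>x\<in>e. \<forall>y\<in>e. (y - x) \<bullet> \<nu> = 0) \<and>
                             (\<forall>x\<in>e. \<forall>y\<in>E. (y - x) \<bullet> \<nu> \<le> 0))"

definition edge_dist :: "(real^2) set \<Rightarrow> (real^2) set \<Rightarrow> real^2 \<Rightarrow> real" where
  "edge_dist E e x = - ((x - (SOME y. y \<in> e)) \<bullet> outer_normal E e)"

definition pull :: "(real^2 \<Rightarrow> real^2) \<Rightarrow> (real^2 \<Rightarrow> real) \<Rightarrow> real^2 \<Rightarrow> real" where
  "pull F \<phi> x = \<phi> (inv_into ref_square F x)"


section \<open>Direct serendipity supplements\<close>

text \<open>In the next two definitions \<open>e\<close> and \<open>e'\<close> are opposite edges; they give the requirements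
  on \<open>\<lambda>\<^sub>H\<close>, \<open>R\<^sub>V\<close> (with \<open>e\<^sub>1\<close>, \<open>e\<^sub>2\<close>) and on \<open>\<lambda>\<^sub>V\<close>, \<open>R\<^sub>H\<close> (with \<open>e\<^sub>3\<close>, \<open>e\<^sub>4\<close>).
  The condition \<open>b \<noteq> 0\<close> makes the zero set a line.\<close>

definition admissible_linear ::
    "(real^2) set \<Rightarrow> (real^2) set \<Rightarrow> (real^2) set \<Rightarrow> (real^2 \<Rightarrow> real) \<Rightarrow> bool" where
  "admissible_linear E e e' l \<longleftrightarrow>
     (if affine_parallel (affine hull e) (affine hull e')
      then (\<exists>b c. b \<noteq> 0 \<and> l = (\<lambda>x. b \<bullet> x + c)) \<and>
           (\<exists>x \<in> affine hull e. l x = 0) \<and> (\<exists>x \<in> affine hull e'. l x = 0)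
      else (\<exists>\<alpha> \<beta> \<gamma>. \<alpha> > 0 \<and> \<beta> > 0 \<and> \<gamma> \<noteq> 0 \<and>
              l = (\<lambda>x. \<alpha> * edge_dist E e x + \<beta> * edge_dist E e' x + \<gamma>)))"

definition admissible_R ::
    "(real^2) set \<Rightarrow> (real^2) set \<Rightarrow> (real^2) set \<Rightarrow> (real^2 \<Rightarrow> real) \<Rightarrow> bool" where
  "admissible_R E e e' R \<longleftrightarrow>
     bounded (R ` E) \<and> continuous_on E R \<and> R \<in> H1_on (interior E) \<and>
     (\<exists>\<eta> \<xi>. \<eta> > 0 \<and> \<xi> > 0 \<and> (\<forall>x\<in>e. R x = - \<eta>) \<and> (\<forall>x\<in>e'. R x = \<xi>))"

definition fully_direct_supplement ::
    "(real^2) set \<Rightarrow> (real^2 \<Rightarrow> real^2) \<Rightarrow> nat \<Rightarrow> (real^2 \<Rightarrow> real) set \<Rightarrow> bool" where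
  "fully_direct_supplement E F r S \<longleftrightarrow>
     (let e1 = side F 1 (-1); e2 = side F 1 1; e3 = side F 2 (-1); e4 = side F 2 1 in
      \<exists>lH lV RV RH.
        admissible_linear E e1 e2 lH \<and> admissible_linear E e3 e4 lV \<and>
        admissible_R E e1 e2 RV \<and> admissible_R E e3 e4 RH \<and>
        S = span2 (\<lambda>x. edge_dist E e3 x * edge_dist E e4 x * lH x ^ (r - 1) * RV x)
                  (\<lambda>x. edge_dist E e1 x * edge_dist E e2 x * lV x ^ (r - 1) * RH x))"

definition mapped_supplement :: "(real^2 \<Rightarrow> real^2) \<Rightarrow> nat \<Rightarrow> (real^2 \<Rightarrow> real) set" where
  "mapped_supplement F r =
     span2 (pull F (\<lambda>y. (1 - (y $ 2)\<^sup>2) * y $ 1 * (y $ 2) ^ (r - 1)))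
           (pull F (\<lambda>y. (1 - (y $ 1)\<^sup>2) * y $ 2 * (y $ 1) ^ (r - 1)))"

text \<open>\<open>r\<close> is the index of the mixed space, so \<open>S\<close> supplements \<open>polys (r + 1)\<close>.\<close>

definition DS_supplement ::
    "(real^2) set \<Rightarrow> (real^2 \<Rightarrow> real^2) \<Rightarrow> nat \<Rightarrow> (real^2 \<Rightarrow> real) set \<Rightarrow> bool" where
  "DS_supplement E F r S \<longleftrightarrow> fully_direct_supplement E F r S \<or> S = mapped_supplement F r"

definition DS_space :: "(real^2) set \<Rightarrow> nat \<Rightarrow> (real^2 \<Rightarrow> real) set \<Rightarrow> (real^2 \<Rightarrow> real) set" where
  "DS_space E r S = restr E (fun_sum (polys (r + 1)) S)"

definition curl_space :: "(real^2) set \<Rightarrow> (real^2 \<Rightarrow> real) set \<Rightarrow> (real^2 \<Rightarrow> real^2) set" where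
  "curl_space E S = {v. \<exists>s\<in>S. has_weak_curl (interior E) s v}"

definition V_red :: "(real^2) set \<Rightarrow> nat \<Rightarrow> (real^2 \<Rightarrow> real) set \<Rightarrow> (real^2 \<Rightarrow> real^2) set" where
  "V_red E r S = restr E (fun_sum (vec_polys r) (curl_space E S))"

definition V_full :: "(real^2) set \<Rightarrow> nat \<Rightarrow> (real^2 \<Rightarrow> real) set \<Rightarrow> (real^2 \<Rightarrow> real^2) set" where
  "V_full E r S = restr E (fun_sum (fun_sum (vec_polys r) (x_hom_polys r)) (curl_space E S))"


section \<open>Exactness\<close>

text \<open>The weak operators are relations between representatives; \<open>ae_map E T A B\<close> says that
  \<open>T\<close> is a well-defined map from \<open>A\<close> to \<open>B\<close> modulo equality almost everywhere.\<close>

definition ae_map ::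
    "(real^2) set \<Rightarrow> ((real^2 \<Rightarrow> 'a) \<Rightarrow> (real^2 \<Rightarrow> 'b) \<Rightarrow> bool) \<Rightarrow>
     (real^2 \<Rightarrow> 'a) set \<Rightarrow> (real^2 \<Rightarrow> 'b) set \<Rightarrow> bool" where
  "ae_map E T A B \<longleftrightarrow>
     (\<forall>f\<in>A. \<exists>g\<in>B. \<forall>f' h. ae_eq E f' f \<longrightarrow> (T f' h \<longleftrightarrow> ae_eq E h g))"

definition curl_div_exact ::
    "(real^2) set \<Rightarrow> (real^2 \<Rightarrow> real) set \<Rightarrow> (real^2 \<Rightarrow> real^2) set \<Rightarrow> (real^2 \<Rightarrow> real) set \<Rightarrow> bool" where
  "curl_div_exact E D V Q \<longleftrightarrow>
     (\<forall>c. (\<lambda>_. c) \<in> D) \<and>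
     (\<forall>c::real. ae_eq E (\<lambda>_. c) (\<lambda>_. 0) \<longrightarrow> c = 0) \<and>
     ae_map E (has_weak_curl (interior E)) D V \<and>
     ae_map E (has_weak_div (interior E)) V Q \<and>
     restr E {\<lambda>_. c | c. True} = {\<phi> \<in> D. has_weak_curl (interior E) \<phi> (\<lambda>_. 0)} \<and>
     {v. \<exists>\<phi>\<in>D. has_weak_curl (interior E) \<phi> v} = {v \<in> V. has_weak_div (interior E) v (\<lambda>_. 0)} \<and>
     {q. \<exists>v\<in>V. has_weak_div (interior E) v q} = Q"

end

theory Submission
  imports Defs "HOL-Real_Asymp.Real_Asymp"
begin

text \<open>
  The polynomial sequences are exact, and the supplement enlarges only the middle of them: the
  space of potentials by its functions, and the space of fields by their curls, which have
  divergence zero. Two things remain to be shown: that the sums are direct, for which no nonzero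
  supplement function may be a polynomial on \<open>E\<close>, and that the polynomial identities carry over to
  weak derivatives of functions modulo null sets.

  That a supplement function \<open>s = A f + B g\<close> is not a polynomial is seen on two opposite sides of
  \<open>E\<close>. One of the two basis functions vanishes on both; the other is, with the affine
  parameters \<open>t\<close> of the sides, a multiple of \<open>1 - t\<^sup>2\<close> times a power of an affine function of \<open>t\<close>,
  with opposite signs in front (\<open>odd_profile\<close>). A polynomial that agrees with it on the two sides
  agrees with it on their lines. If the lines meet, the two values at the point of intersection have
  opposite signs; if they are parallel, this holds for the leading coefficients along the common
  direction. So \<open>A = 0\<close>, and in the same way \<open>B = 0\<close> (\<open>odd_profile_not_polynomial\<close>,
  \<open>supplement_not_polynomial\<close>).

  On polynomial fields, a divergence \<open>0\<close> makes the part \<open>x h\<close> with \<open>h\<close> homogeneous of degree \<open>r\<close>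
  vanish, because \<open>div (x h) = (r + 2) h\<close> has the degree \<open>r\<close> that the remaining divergence cannot
  reach; what is left has a polynomial potential (\<open>poly_field_div_zero\<close>). Hence a polynomial field
  that is the curl of a supplement function \<open>s\<close> is also the curl of a polynomial \<open>p\<close>; since functions
  with vanishing weak gradient are constant, \<open>s\<close> is a polynomial, so it is \<open>0\<close>
  (\<open>direct_fields_curl_space\<close>). The kernel of the divergence consists of curls for the same reason,
  and the divergence is onto by integrating in one variable and by Euler's identity
  (\<open>curl_div_exact_of_fields\<close>).

  The weak calculus rests on test functions \<open>\<phi>(x\<^sub>1) \<omega>(x\<^sub>2)\<close> built from \<open>exp (-1/t)\<close>. They determine a
  locally integrable function up to null sets (\<open>negligible_of_pairings_zero\<close>), and by subtracting
  from \<open>\<phi>\<close> and \<open>\<omega>\<close> multiples of fixed bumps they show that a vanishing weak gradient forces a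
  constant (\<open>weak_gradient_zero_imp_constant\<close>). Supplement functions have weak derivatives: in the
  direct case they are polynomials times a function in \<open>H\<^sup>1\<close>, in the mapped case they are
  continuously differentiable because the bilinear map has a nonvanishing Jacobian (\<open>jacobian\<close>).
\<close>

section \<open>The classes of continuously differentiable functions\<close>

lemma partial_eqI:
  assumes "(f has_derivative f') (at x)"
  shows "partial i f x = f' (axis i 1)"
  using frechet_derivative_at[OF assms] by (simp add: partial_def)

lemma C_k_SucI:
  assumes "\<And>x. (f has_derivative f' x) (at x)" "\<And>i. C_k k (\<lambda>x. f' x (axis i 1))"
  shows "C_k (Suc k) f"
proof -
  have "partial i f = (\<lambda>x. f' x (axis i 1))" for i
    using partial_eqI[OF assms(1)] by auto
  then show ?thesis
    using assms by (auto simp: differentiable_def)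
qed

lemma C_k_Suc_has_derivative:
  assumes "C_k (Suc k) f"
  shows "(f has_derivative frechet_derivative f (at x)) (at x)"
  using assms frechet_derivative_works by auto

lemma C_k_continuous: "C_k k f \<Longrightarrow> continuous_on UNIV f"
proof (cases k)
  case (Suc m)
  assume "C_k k f"
  then show ?thesis
    using Suc by (auto intro!: differentiable_imp_continuous_on simp: differentiable_on_def
        intro: differentiable_at_withinI)
qed auto

lemma C_k_SucD: "C_k (Suc k) f \<Longrightarrow> C_k k f"
proof (induction k arbitrary: f)
  case 0
  then show ?case using C_k_continuous[OF 0] by simp
next
  case (Suc k)
  then show ?case by (metis C_k.simps(2))
qed

lemma C_k_const: "C_k k (\<lambda>x. c)"
proof (induction k arbitrary: c)
  case (Suc k)
  then show ?case
    by (intro C_k_SucI[where f' = "\<lambda>x h. 0"]) auto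
qed auto

lemma C_k_add: "C_k k f \<Longrightarrow> C_k k g \<Longrightarrow> C_k k (\<lambda>x. f x + g x)"
proof (induction k arbitrary: f g)
  case 0
  then show ?case by (auto intro: continuous_intros)
next
  case (Suc k)
  show ?case
  proof (rule C_k_SucI)
    show "((\<lambda>x. f x + g x) has_derivative
      (\<lambda>h. frechet_derivative f (at x) h + frechet_derivative g (at x) h)) (at x)" for x
      using Suc.prems by (intro has_derivative_add C_k_Suc_has_derivative)
    show "C_k k (\<lambda>x. frechet_derivative f (at x) (axis i 1) + frechet_derivative g (at x) (axis i 1))" for i
      using Suc.prems by (intro Suc.IH) (simp_all add: partial_def[abs_def])
  qed
qed

lemma C_k_mult: "C_k k f \<Longrightarrow> C_k k g \<Longrightarrow> C_k k (\<lambda>x. f x * g x)"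
proof (induction k arbitrary: f g)
  case 0
  then show ?case by (auto intro: continuous_intros)
next
  case (Suc k)
  show ?case
  proof (rule C_k_SucI)
    show "((\<lambda>x. f x * g x) has_derivative
      (\<lambda>h. f x * frechet_derivative g (at x) h + frechet_derivative f (at x) h * g x)) (at x)" for x
      using Suc.prems by (intro has_derivative_mult C_k_Suc_has_derivative)
    show "C_k k (\<lambda>x. f x * frechet_derivative g (at x) (axis i 1)
        + frechet_derivative f (at x) (axis i 1) * g x)" for i
      using Suc.prems C_k_SucD[OF Suc.prems(1)] C_k_SucD[OF Suc.prems(2)]
      by (intro Suc.IH C_k_add) (simp_all add: partial_def[abs_def])
  qed
qed

lemma C_k_diff: "C_k k f \<Longrightarrow> C_k k g \<Longrightarrow> C_k k (\<lambda>x. f x - g x)"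
  using C_k_add[of k f "\<lambda>x. (- 1) * g x"] C_k_mult[OF C_k_const[of k "- 1"], of g] by simp

lemma C_k_power: "C_k k f \<Longrightarrow> C_k k (\<lambda>x. f x ^ n)"
  by (induction n) (auto intro: C_k_const C_k_mult)

lemma C_k_component: "C_k k (\<lambda>x. x $ i)"
proof (cases k)
  case (Suc k)
  have "C_k (Suc k) (\<lambda>x. x $ i)"
  proof (rule C_k_SucI)
    show "((\<lambda>x. x $ i) has_derivative (\<lambda>h. h $ i)) (at x)" for x :: "real^2"
      by (intro bounded_linear_imp_has_derivative bounded_linear_vec_nth)
    show "C_k k (\<lambda>x. (axis j 1 :: real^2) $ i)" for j by (rule C_k_const)
  qed
  then show ?thesis using Suc by simp
qed (auto intro: continuous_intros)

lemma C_k_affine: "C_k k (\<lambda>x. \<nu> \<bullet> x + \<beta>)"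
  unfolding inner_vec_def sum_2 by (simp, intro C_k_add C_k_mult C_k_const C_k_component)

lemma C_k_has_partial_line:
  assumes "C_k (Suc k) f"
  shows "((\<lambda>t. f (x + t *\<^sub>R axis i 1)) has_real_derivative partial i f (x + t *\<^sub>R axis i 1)) (at t)"
proof -
  have "((\<lambda>t. f (x + t *\<^sub>R axis i 1)) has_derivative
     (\<lambda>h. frechet_derivative f (at (x + t *\<^sub>R axis i 1)) (h *\<^sub>R axis i 1))) (at t)"
    by (rule has_derivative_compose[where g = f, OF _ C_k_Suc_has_derivative[OF assms]])
       (auto intro!: derivative_eq_intros)
  moreover have "linear (frechet_derivative f (at (x + t *\<^sub>R axis i 1)))"
    using C_k_Suc_has_derivative[OF assms] has_derivative_linear by blast
  ultimately show ?thesis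
    by (simp add: has_field_derivative_def partial_def linear_cmul mult.commute[of _ "frechet_derivative _ _ _"])
qed

lemma second_difference_mvt:
  assumes f: "C_k (Suc (Suc k)) f" and h: "h > 0"
  shows "\<exists>s u. 0 < s \<and> s < h \<and> 0 < u \<and> u < h \<and>
    f (x + h *\<^sub>R axis i 1 + h *\<^sub>R axis j 1) - f (x + h *\<^sub>R axis i 1) - f (x + h *\<^sub>R axis j 1) + f x
     = h * h * partial j (partial i f) (x + s *\<^sub>R axis i 1 + u *\<^sub>R axis j 1)"
proof -
  let ?a = "axis i 1 :: real^2" and ?b = "axis j 1 :: real^2"
  define G where "G = (\<lambda>t. f ((x + h *\<^sub>R ?b) + t *\<^sub>R ?a) - f (x + t *\<^sub>R ?a))"
  have "(G has_real_derivative partial i f ((x + h *\<^sub>R ?b) + t *\<^sub>R ?a) - partial i f (x + t *\<^sub>R ?a)) (at t)" for t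
    unfolding G_def by (intro DERIV_diff C_k_has_partial_line[OF f])
  from MVT2[OF h this] obtain s where s: "0 < s" "s < h" 
    "G h - G 0 = h * (partial i f ((x + h *\<^sub>R ?b) + s *\<^sub>R ?a) - partial i f (x + s *\<^sub>R ?a))" by auto
  have pf: "C_k (Suc k) (partial i f)" using f by simp
  have "((\<lambda>t. partial i f ((x + s *\<^sub>R ?a) + t *\<^sub>R ?b)) has_real_derivative
      partial j (partial i f) ((x + s *\<^sub>R ?a) + t *\<^sub>R ?b)) (at t)" for t
    by (rule C_k_has_partial_line[OF pf])
  from MVT2[OF h this] obtain u where u: "0 < u" "u < h"
    "partial i f ((x + s *\<^sub>R ?a) + h *\<^sub>R ?b) - partial i f (x + s *\<^sub>R ?a)
      = h * partial j (partial i f) ((x + s *\<^sub>R ?a) + u *\<^sub>R ?b)" by auto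
  show ?thesis
    using s u by (intro exI[of _ s] exI[of _ u]) (simp add: G_def algebra_simps)
qed

text \<open>Both mixed derivatives are limits of the same second difference quotient.\<close>

lemma partial_commute:
  assumes f: "C_k (Suc (Suc k)) f"
  shows "partial j (partial i f) x = partial i (partial j f) x"
proof -
  let ?a = "axis i 1 :: real^2" and ?b = "axis j 1 :: real^2"
  define h :: "nat \<Rightarrow> real" where "h n = inverse (real (Suc n))" for n
  have h: "h n > 0" for n by (simp add: h_def)
  have h0: "h \<longlonglongrightarrow> 0" unfolding h_def by (rule LIMSEQ_inverse_real_of_nat)
  have "\<exists>s u s' u'. 0 < s \<and> s < h n \<and> 0 < u \<and> u < h n \<and> 0 < s' \<and> s' < h n \<and> 0 < u' \<and> u' < h n \<and>
     partial j (partial i f) (x + s *\<^sub>R ?a + u *\<^sub>R ?b) = partial i (partial j f) (x + s' *\<^sub>R ?b + u' *\<^sub>R ?a)" for n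
  proof -
    obtain s u where 1: "0 < s" "s < h n" "0 < u" "u < h n"
      "f (x + h n *\<^sub>R ?a + h n *\<^sub>R ?b) - f (x + h n *\<^sub>R ?a) - f (x + h n *\<^sub>R ?b) + f x
        = h n * h n * partial j (partial i f) (x + s *\<^sub>R ?a + u *\<^sub>R ?b)"
      using second_difference_mvt[OF f h, of n x i j] by auto
    obtain s' u' where 2: "0 < s'" "s' < h n" "0 < u'" "u' < h n"
      "f (x + h n *\<^sub>R ?b + h n *\<^sub>R ?a) - f (x + h n *\<^sub>R ?b) - f (x + h n *\<^sub>R ?a) + f x
        = h n * h n * partial i (partial j f) (x + s' *\<^sub>R ?b + u' *\<^sub>R ?a)"
      using second_difference_mvt[OF f h, of n x j i] by auto
    have "h n * h n * partial j (partial i f) (x + s *\<^sub>R ?a + u *\<^sub>R ?b)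
       = h n * h n * partial i (partial j f) (x + s' *\<^sub>R ?b + u' *\<^sub>R ?a)"
      unfolding 1(5)[symmetric] 2(5)[symmetric] by (simp add: add_ac)
    with h[of n] 1 2 show ?thesis by auto
  qed
  then obtain s u s' u' where *: "\<And>n. 0 < s n \<and> s n < h n \<and> 0 < u n \<and> u n < h n \<and>
      0 < s' n \<and> s' n < h n \<and> 0 < u' n \<and> u' n < h n \<and>
     partial j (partial i f) (x + s n *\<^sub>R ?a + u n *\<^sub>R ?b) = partial i (partial j f) (x + s' n *\<^sub>R ?b + u' n *\<^sub>R ?a)"
    by metis
  have lim0: "v \<longlonglongrightarrow> 0" if "\<And>n. 0 < v n \<and> v n < h n" for v
    by (rule tendsto_sandwich[OF _ _ tendsto_const h0]) (use that in \<open>auto intro!: always_eventually less_imp_le\<close>)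
  have sq: "s \<longlonglongrightarrow> 0" "u \<longlonglongrightarrow> 0" "s' \<longlonglongrightarrow> 0" "u' \<longlonglongrightarrow> 0"
    using * by (auto intro!: lim0)
  have c: "isCont (partial j (partial i f)) x" "isCont (partial i (partial j f)) x"
    using f C_k_continuous[of k] by (auto simp: continuous_on_eq_continuous_at)
  have "(\<lambda>n. x + s n *\<^sub>R ?a + u n *\<^sub>R ?b) \<longlonglongrightarrow> x + 0 *\<^sub>R ?a + 0 *\<^sub>R ?b"
    by (intro tendsto_intros sq)
  then have 1: "(\<lambda>n. partial j (partial i f) (x + s n *\<^sub>R ?a + u n *\<^sub>R ?b)) \<longlonglongrightarrow> partial j (partial i f) x"
    using c(1) by (intro isCont_tendsto_compose[OF c(1)]) simp
  have "(\<lambda>n. x + s' n *\<^sub>R ?b + u' n *\<^sub>R ?a) \<longlonglongrightarrow> x + 0 *\<^sub>R ?b + 0 *\<^sub>R ?a"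
    by (intro tendsto_intros sq)
  then have 2: "(\<lambda>n. partial i (partial j f) (x + s' n *\<^sub>R ?b + u' n *\<^sub>R ?a)) \<longlonglongrightarrow> partial i (partial j f) x"
    by (intro isCont_tendsto_compose[OF c(2)]) simp
  show ?thesis
    using LIMSEQ_unique[OF 1] 2 * by simp
qed

section \<open>Smooth functions of one variable and product test functions\<close>

text \<open>An existential form of the derivative keeps the inductions on the order free of
  \<open>deriv\<close> and its side conditions.\<close>

primrec smooth_upto :: "nat \<Rightarrow> (real \<Rightarrow> real) \<Rightarrow> bool" where
  "smooth_upto 0 f \<longleftrightarrow> continuous_on UNIV f"
| "smooth_upto (Suc k) f \<longleftrightarrow> (\<exists>g. (\<forall>t. (f has_real_derivative g t) (at t)) \<and> smooth_upto k g)"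

lemma smooth_upto_SucI:
  "(\<And>t. (f has_real_derivative g t) (at t)) \<Longrightarrow> smooth_upto k g \<Longrightarrow> smooth_upto (Suc k) f"
  unfolding smooth_upto.simps(2) by blast

declare smooth_upto.simps(2) [simp del]

definition smooth :: "(real \<Rightarrow> real) \<Rightarrow> bool" where
  "smooth f \<longleftrightarrow> (\<forall>k. smooth_upto k f)"

lemma smooth_upto_continuous: "smooth_upto k f \<Longrightarrow> continuous_on UNIV f"
proof (cases k)
  case (Suc m)
  assume "smooth_upto k f"
  then obtain g where "\<forall>t. (f has_real_derivative g t) (at t)"
    unfolding Suc smooth_upto.simps(2) by blast
  then show ?thesis
    by (intro DERIV_continuous_on[of UNIV f g]) (simp add: has_field_derivative_at_within)
qed simp

lemma smooth_upto_SucD: "smooth_upto (Suc k) f \<Longrightarrow> smooth_upto k f"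
proof (induction k arbitrary: f)
  case 0
  then show ?case using smooth_upto_continuous[OF 0] by simp
next
  case (Suc k)
  from Suc.prems obtain g where g: "\<And>t. (f has_real_derivative g t) (at t)" "smooth_upto (Suc k) g"
    using smooth_upto.simps(2)[of "Suc k" f] by blast
  show ?case by (rule smooth_upto_SucI[OF g(1) Suc.IH[OF g(2)]])
qed

lemma smooth_upto_const: "smooth_upto k (\<lambda>t. c)"
proof (induction k arbitrary: c)
  case (Suc k)
  show ?case by (rule smooth_upto_SucI[of _ "\<lambda>t. 0"]) (auto intro: Suc)
qed auto

lemma smooth_upto_add: "smooth_upto k f \<Longrightarrow> smooth_upto k g \<Longrightarrow> smooth_upto k (\<lambda>t. f t + g t)"
proof (induction k arbitrary: f g)
  case 0
  then show ?case by (auto intro: continuous_intros)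
next
  case (Suc k)
  from Suc.prems obtain f' g' where
    d: "\<And>t. (f has_real_derivative f' t) (at t)" "\<And>t. (g has_real_derivative g' t) (at t)"
    and s: "smooth_upto k f'" "smooth_upto k g'" unfolding smooth_upto.simps(2) by blast
  show ?case
    by (rule smooth_upto_SucI[of _ "\<lambda>t. f' t + g' t"]) (intro derivative_intros d, intro Suc.IH s)
qed

lemma smooth_upto_mult: "smooth_upto k f \<Longrightarrow> smooth_upto k g \<Longrightarrow> smooth_upto k (\<lambda>t. f t * g t)"
proof (induction k arbitrary: f g)
  case 0
  then show ?case by (auto intro: continuous_intros)
next
  case (Suc k)
  from Suc.prems obtain f' g' where
    d: "\<And>t. (f has_real_derivative f' t) (at t)" "\<And>t. (g has_real_derivative g' t) (at t)"
    and s: "smooth_upto k f'" "smooth_upto k g'" unfolding smooth_upto.simps(2) by blast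
  show ?case
    by (rule smooth_upto_SucI[of _ "\<lambda>t. f' t * g t + g' t * f t"])
       (intro DERIV_mult d, intro smooth_upto_add Suc.IH s Suc.prems[THEN smooth_upto_SucD])
qed

lemma smooth_upto_affine: "smooth_upto k f \<Longrightarrow> smooth_upto k (\<lambda>t. f (a * t + b))"
proof (induction k arbitrary: f)
  case 0
  then show ?case by (auto intro!: continuous_intros continuous_on_compose2[of UNIV f])
next
  case (Suc k)
  from Suc.prems obtain f' where
    d: "\<And>t. (f has_real_derivative f' t) (at t)" and s: "smooth_upto k f'" unfolding smooth_upto.simps(2) by blast
  have "((\<lambda>t. f (a * t + b)) has_real_derivative f' (a * t + b) * a) (at t)" for t
    by (rule DERIV_chain2[OF d]) (auto intro!: derivative_eq_intros)
  moreover have "smooth_upto k (\<lambda>t. f' (a * t + b) * a)"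
    by (intro smooth_upto_mult smooth_upto_const Suc.IH s)
  ultimately show ?case by (rule smooth_upto_SucI)
qed

lemma has_derivative_of_component:
  assumes "(\<phi> has_real_derivative d) (at (x $ i))"
  shows "((\<lambda>x. \<phi> (x $ i)) has_derivative (\<lambda>h. d * h $ i)) (at (x :: real^2))"
  using assms unfolding has_field_derivative_def
  by (rule has_derivative_compose[rotated])
     (intro bounded_linear_imp_has_derivative bounded_linear_vec_nth)

lemma C_k_of_component: "smooth_upto k \<phi> \<Longrightarrow> C_k k (\<lambda>x. \<phi> (x $ i))"
proof (induction k arbitrary: \<phi>)
  case 0
  then show ?case by (auto intro!: continuous_intros continuous_on_compose2[of UNIV \<phi>])
next
  case (Suc k)
  from Suc.prems obtain g where
    d: "\<And>t. (\<phi> has_real_derivative g t) (at t)" and s: "smooth_upto k g" unfolding smooth_upto.simps(2) by blast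
  show ?case
  proof (rule C_k_SucI)
    show "((\<lambda>x. \<phi> (x $ i)) has_derivative (\<lambda>h. g (x $ i) * h $ i)) (at x)" for x :: "real^2"
      by (rule has_derivative_of_component[OF d])
    show "C_k k (\<lambda>x. g (x $ i) * (axis j 1 :: real^2) $ i)" for j
      by (intro C_k_mult C_k_const Suc.IH s)
  qed
qed

text \<open>The flat functions \<open>exp (-1/t) / t\<^sup>n\<close> are needed for all \<open>n\<close> at once, because the
  derivative of one of them is a combination of two others.\<close>

definition flat :: "nat \<Rightarrow> real \<Rightarrow> real" where
  "flat n t = (if t > 0 then exp (- 1 / t) / t ^ n else 0)"

lemma flat_has_derivative:
  "(flat n has_real_derivative flat (n + 2) t - real n * flat (n + 1) t) (at t)"
proof -
  consider "t > 0" | "t < 0" | "t = 0" by linarith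
  then show ?thesis
  proof cases
    case 1
    have "((\<lambda>t. exp (- 1 / t) / t ^ n) has_real_derivative flat (n + 2) t - real n * flat (n + 1) t) (at t)"
    proof -
      have "((\<lambda>t. exp (- 1 / t) / t ^ n) has_real_derivative
         (exp (- 1 / t) * (1 / t\<^sup>2) * t ^ n - exp (- 1 / t) * (real n * t ^ (n - 1))) / (t ^ n * t ^ n)) (at t)"
        using 1 by (auto intro!: derivative_eq_intros simp: power2_eq_square)
      moreover have "(exp (- 1 / t) * (1 / t\<^sup>2) * t ^ n - exp (- 1 / t) * (real n * t ^ (n - 1))) / (t ^ n * t ^ n)
          = flat (n + 2) t - real n * flat (n + 1) t"
        using 1 by (cases n) (simp_all add: flat_def field_simps power2_eq_square)
      ultimately show ?thesis by simp
    qed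
    then show ?thesis
      by (rule has_field_derivative_transform_within_open[of _ _ _ "{0<..}"]) (use 1 in \<open>auto simp: flat_def\<close>)
  next
    case 2
    have "((\<lambda>t. 0) has_real_derivative flat (n + 2) t - real n * flat (n + 1) t) (at t)"
      using 2 by (auto simp: flat_def)
    then show ?thesis
      by (rule has_field_derivative_transform_within_open[of _ _ _ "{..<0}"]) (use 2 in \<open>auto simp: flat_def\<close>)
  next
    case 3
    have r: "((\<lambda>h. exp (- 1 / h) / h ^ Suc n) \<longlongrightarrow> 0) (at_right (0::real))"
      by real_asymp
    have r: "((\<lambda>h. flat n h / h) \<longlongrightarrow> 0) (at_right 0)"
      by (rule Lim_transform_eventually[OF r])
         (auto simp: flat_def field_simps eventually_at_right_field intro!: exI[of _ 1])
    have l: "((\<lambda>h. flat n h / h) \<longlongrightarrow> 0) (at_left 0)"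
      by (rule Lim_transform_eventually[OF tendsto_const])
         (auto simp: flat_def eventually_at_left_field intro!: exI[of _ "-1"])
    have "((\<lambda>h. flat n h / h) \<longlongrightarrow> 0) (at 0)"
      using l r by (rule filterlim_split_at_real)
    then show ?thesis
      using 3 by (simp add: DERIV_def flat_def)
  qed
qed

lemma smooth_flat: "smooth (flat n)"
proof -
  have "smooth_upto k (flat n)" for k n
  proof (induction k arbitrary: n)
    case 0
    show ?case unfolding smooth_upto.simps(1)
      by (rule DERIV_continuous_on, rule has_field_derivative_at_within, rule flat_has_derivative)
  next
    case (Suc k)
    have "smooth_upto k (\<lambda>t. flat (n + 2) t + (- real n) * flat (n + 1) t)"
      by (intro smooth_upto_add smooth_upto_mult smooth_upto_const Suc)
    with flat_has_derivative[of n] show ?case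
      by (intro smooth_upto_SucI[of _ "\<lambda>t. flat (n + 2) t + (- real n) * flat (n + 1) t"]) auto
  qed
  then show ?thesis by (simp add: smooth_def)
qed

text \<open>As \<open>n\<close> grows, these increase to the indicator of the open interval, so limits of integrals
  against them are integrals over boxes; no normalisation is needed.\<close>

definition bump :: "nat \<Rightarrow> real \<Rightarrow> real \<Rightarrow> real \<Rightarrow> real" where
  "bump n a b t = flat 0 (real (Suc n) * (t - a)) * flat 0 (real (Suc n) * (b - t))"

lemma smooth_bump: "smooth (bump n a b)"
proof -
  have "smooth_upto k (\<lambda>t. flat 0 (real (Suc n) * t + - (real (Suc n) * a)) *
      flat 0 (- real (Suc n) * t + real (Suc n) * b))" for k
    using smooth_flat by (intro smooth_upto_mult smooth_upto_affine) (auto simp: smooth_def)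
  then show ?thesis
    by (simp add: smooth_def bump_def[abs_def] algebra_simps)
qed

lemma flat0_range: "0 \<le> flat 0 t" "flat 0 t \<le> 1" "t \<le> 0 \<Longrightarrow> flat 0 t = 0" "t > 0 \<Longrightarrow> flat 0 t > 0"
  by (auto simp: flat_def)

lemma bump_range: "0 \<le> bump n a b t" "bump n a b t \<le> 1"
  using flat0_range by (auto simp: bump_def mult_le_one)

lemma bump_outside: "t \<notin> {a<..<b} \<Longrightarrow> bump n a b t = 0"
  by (auto simp: bump_def flat_def not_less zero_less_mult_iff)

lemma bump_pos: "t \<in> {a<..<b} \<Longrightarrow> bump n a b t > 0"
  by (auto simp: bump_def intro!: mult_pos_pos flat0_range)

lemma flat_scaled_tendsto: "s > 0 \<Longrightarrow> (\<lambda>n. flat 0 (real (Suc n) * s)) \<longlonglongrightarrow> 1"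
proof -
  assume s: "s > 0"
  have "(\<lambda>n. exp (- 1 / (real (Suc n) * s))) \<longlonglongrightarrow> 1"
    using s by real_asymp
  then show ?thesis using s by (simp add: flat_def)
qed

lemma bump_tendsto: "(\<lambda>n. bump n a b t) \<longlonglongrightarrow> indicator {a<..<b} t"
proof (cases "t \<in> {a<..<b}")
  case True
  then have "(\<lambda>n. flat 0 (real (Suc n) * (t - a)) * flat 0 (real (Suc n) * (b - t))) \<longlonglongrightarrow> 1 * 1"
    by (intro tendsto_mult flat_scaled_tendsto) auto
  then show ?thesis using True by (simp add: bump_def)
qed (simp add: bump_outside)

lemma test_function_C_k: "test_function \<Omega> \<psi> \<Longrightarrow> C_k k \<psi>"
  by (simp add: test_function_def)

lemma test_function_supportE:
  assumes "test_function \<Omega> \<psi>"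
  obtains K where "compact K" "K \<subseteq> \<Omega>" "\<And>x. x \<notin> K \<Longrightarrow> \<psi> x = 0"
  using assms by (auto simp: test_function_def)

lemma partial_outside:
  assumes "compact K" "\<And>x. x \<notin> K \<Longrightarrow> \<psi> x = (0::real)" "x \<notin> K"
  shows "partial i \<psi> x = 0"
proof -
  have "((\<lambda>x. 0::real) has_derivative (\<lambda>h. 0)) (at x)" by simp
  then have "(\<psi> has_derivative (\<lambda>h. 0)) (at x)"
    by (rule has_derivative_transform_within_open[of _ _ x UNIV "- K"])
       (use assms in \<open>auto simp: compact_imp_closed\<close>)
  from partial_eqI[OF this] show ?thesis .
qed

lemma test_function_partial: "test_function \<Omega> \<psi> \<Longrightarrow> test_function \<Omega> (partial i \<psi>)"
  unfolding test_function_def using partial_outside by (metis C_k.simps(2))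

lemma test_function_mult:
  assumes "test_function \<Omega> \<psi>" "\<And>k. C_k k p"
  shows "test_function \<Omega> (\<lambda>x. p x * \<psi> x)"
  using assms unfolding test_function_def by (auto intro!: C_k_mult) 

lemma test_function_product:
  assumes "smooth \<phi>" "smooth \<omega>" "\<And>t. t \<notin> {a $ 1..b $ 1} \<Longrightarrow> \<phi> t = 0"
    "\<And>t. t \<notin> {a $ 2..b $ 2} \<Longrightarrow> \<omega> t = 0" "cbox a b \<subseteq> \<Omega>"
  shows "test_function \<Omega> (\<lambda>x. \<phi> (x $ 1) * \<omega> (x $ 2))"
  unfolding test_function_def
proof (intro conjI exI[of _ "cbox a b"] allI impI)
  show "C_k k (\<lambda>x. \<phi> (x $ 1) * \<omega> (x $ 2))" for k
    using assms by (intro C_k_mult C_k_of_component) (auto simp: smooth_def)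
  show "\<phi> (x $ 1) * \<omega> (x $ 2) = 0" if "x \<notin> cbox a b" for x
    using that assms(3)[of "x $ 1"] assms(4)[of "x $ 2"] by (auto simp: mem_box_cart forall_2)
qed (use assms in auto)

lemma partial_product:
  assumes "\<And>t. (\<phi> has_real_derivative \<phi>' t) (at t)" "\<And>t. (\<omega> has_real_derivative \<omega>' t) (at t)"
  shows "partial 1 (\<lambda>x. \<phi> (x $ 1) * \<omega> (x $ 2)) x = \<phi>' (x $ 1) * \<omega> (x $ 2)"
    "partial 2 (\<lambda>x. \<phi> (x $ 1) * \<omega> (x $ 2)) x = \<phi> (x $ 1) * \<omega>' (x $ 2)"
proof -
  have "((\<lambda>x. \<phi> (x $ 1) * \<omega> (x $ 2)) has_derivative
    (\<lambda>h. \<phi> (x $ 1) * (\<omega>' (x $ 2) * h $ 2) + \<phi>' (x $ 1) * h $ 1 * \<omega> (x $ 2))) (at x)"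
    by (intro has_derivative_mult has_derivative_of_component assms)
  from partial_eqI[OF this] show 
    "partial 1 (\<lambda>x. \<phi> (x $ 1) * \<omega> (x $ 2)) x = \<phi>' (x $ 1) * \<omega> (x $ 2)"
    "partial 2 (\<lambda>x. \<phi> (x $ 1) * \<omega> (x $ 2)) x = \<phi> (x $ 1) * \<omega>' (x $ 2)"
    by (auto simp: axis_def)
qed

text \<open>A smooth function with vanishing mean is the derivative of a smooth function with the
  same support; this is what makes one-dimensional weak derivatives determine the function.\<close>

lemma smooth_primitive:
  assumes "smooth \<theta>" "\<And>t. t \<notin> {a..b} \<Longrightarrow> \<theta> t = 0" "integral {a..b} \<theta> = 0" "a \<le> b"
  shows "\<exists>\<eta>. smooth \<eta> \<and> (\<forall>t. (\<eta> has_real_derivative \<theta> t) (at t)) \<and> (\<forall>t. t \<notin> {a..b} \<longrightarrow> \<eta> t = 0)"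
proof -
  have c: "continuous_on UNIV \<theta>"
    using assms(1) smooth_upto_continuous by (auto simp: smooth_def)
  obtain G where G: "\<And>t. (G has_vector_derivative \<theta> t) (at t)"
    using einterval_antiderivative[of "-\<infinity>" "\<infinity>" \<theta>] c by (auto simp: continuous_on_eq_continuous_at)
  define \<eta> where "\<eta> t = G t - G a" for t
  have d: "(\<eta> has_real_derivative \<theta> t) (at t)" for t
    using has_vector_derivative_diff[OF G[of t] has_vector_derivative_const[of "G a"]]
    by (simp add: \<eta>_def[abs_def] has_real_derivative_iff_has_vector_derivative)
  have "smooth_upto k \<eta>" for k
    using smooth_upto_SucI[OF d, of k] assms(1) by (auto simp: smooth_def intro: smooth_upto_SucD)
  then have sm: "smooth \<eta>" by (simp add: smooth_def)
  have b0: "\<eta> b = 0"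
    using fundamental_theorem_of_calculus[OF assms(4), of G \<theta>] G assms(3)
    by (auto simp: \<eta>_def has_vector_derivative_at_within dest: integral_unique)
  have dw: "(\<eta> has_vector_derivative \<theta> t) (at t within T)" for t T
    using d[of t] by (simp add: has_real_derivative_iff_has_vector_derivative has_vector_derivative_at_within)
  have i: "(\<theta> has_integral \<eta> v - \<eta> u) {u..v}" if "u \<le> v" for u v
    by (rule fundamental_theorem_of_calculus[OF that dw])
  have "\<eta> t = 0" if "t < a" for t
  proof -
    have "(\<theta> has_integral 0) {t..a}"
      by (rule has_integral_spike_finite[of "{a}" _ _ "\<lambda>t. 0"]) (auto simp: assms(2))
    with i[of t a] that have "\<eta> a - \<eta> t = 0" by (meson has_integral_unique less_imp_le)
    then show ?thesis by (simp add: \<eta>_def)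
  qed
  moreover have "\<eta> t = 0" if "t > b" for t
  proof -
    have "(\<theta> has_integral 0) {b..t}"
      by (rule has_integral_spike_finite[of "{b}" _ _ "\<lambda>t. 0"]) (auto simp: assms(2))
    with i[of b t] that have "\<eta> t - \<eta> b = 0" by (meson has_integral_unique less_imp_le)
    then show ?thesis using b0 by simp
  qed
  ultimately have "\<forall>t. t \<notin> {a..b} \<longrightarrow> \<eta> t = 0" by auto
  with sm d show ?thesis by blast
qed

section \<open>Integration against test functions\<close>

lemma AE_lebesgue_iff_negligible: "(AE x in lebesgue. P x) \<longleftrightarrow> negligible {x. \<not> P x}"
proof
  assume "AE x in lebesgue. P x"
  then obtain N where "N \<in> null_sets lebesgue" "{x. \<not> P x} \<subseteq> N"
    by (auto simp: eventually_ae_filter)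
  then show "negligible {x. \<not> P x}"
    using negligible_iff_null_sets negligible_subset by blast
next
  assume "negligible {x. \<not> P x}"
  then show "AE x in lebesgue. P x"
    by (auto simp: eventually_ae_filter negligible_iff_null_sets)
qed

lemma ae_eq_iff_negligible:
  assumes "E \<in> sets lebesgue"
  shows "ae_eq E f g \<longleftrightarrow> negligible {x \<in> E. f x \<noteq> g x}"
proof -
  have "{x. \<not> (x \<in> E \<longrightarrow> f x = g x)} = {x \<in> E. f x \<noteq> g x}" by auto
  then show ?thesis
    using assms by (simp add: ae_eq_def AE_restrict_space_iff AE_lebesgue_iff_negligible)
qed

lemma ae_eq_refl: "ae_eq E f f"
  by (simp add: ae_eq_def)

lemma ae_eq_sym: "ae_eq E f g \<Longrightarrow> ae_eq E g f"
  unfolding ae_eq_def by (rule AE_mp) (auto intro!: AE_I2)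

lemma ae_eq_trans: "ae_eq E f g \<Longrightarrow> ae_eq E g h \<Longrightarrow> ae_eq E f h"
  unfolding ae_eq_def by (auto elim: eventually_elim2)

lemma ae_eq_add:
  fixes f :: "real^2 \<Rightarrow> 'a::real_vector"
  shows "ae_eq E f g \<Longrightarrow> ae_eq E f' g' \<Longrightarrow> ae_eq E (\<lambda>x. f x + f' x) (\<lambda>x. g x + g' x)"
  unfolding ae_eq_def by (auto elim: eventually_elim2)

lemma locally_integrable_cong_ae:
  assumes "locally_integrable_on \<Omega> f" "ae_eq \<Omega> f g" "open \<Omega>"
  shows "locally_integrable_on \<Omega> g"
  unfolding locally_integrable_on_def
proof (intro allI impI)
  fix K assume K: "compact K \<and> K \<subseteq> \<Omega>"
  have n: "negligible {x \<in> \<Omega>. f x \<noteq> g x}"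
    using assms by (simp add: ae_eq_iff_negligible)
  show "g absolutely_integrable_on K"
    by (rule absolutely_integrable_spike[where f = f, OF _ n]) (use assms K in \<open>auto simp: locally_integrable_on_def\<close>)
qed

lemma locally_integrable_add:
  "locally_integrable_on \<Omega> f \<Longrightarrow> locally_integrable_on \<Omega> g \<Longrightarrow> locally_integrable_on \<Omega> (\<lambda>x. f x + g x)"
  by (auto simp: locally_integrable_on_def intro: set_integral_add(1))

text \<open>On a compact set a continuous factor is bounded.\<close>

lemma locally_integrable_mult_continuous:
  fixes f p :: "real^2 \<Rightarrow> real"
  assumes "locally_integrable_on \<Omega> f" "continuous_on \<Omega> p"
  shows "locally_integrable_on \<Omega> (\<lambda>x. p x * f x)"
  unfolding locally_integrable_on_def
proof (intro allI impI)
  fix K assume K: "compact K \<and> K \<subseteq> \<Omega>"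
  then have p: "continuous_on K p" using assms(2) continuous_on_subset by blast
  show "(\<lambda>x. p x * f x) absolutely_integrable_on K"
  proof (rule absolutely_integrable_bounded_measurable_product[OF bilinear_times])
    show K': "K \<in> sets lebesgue" using K by (simp add: fmeasurableD lmeasurable_compact)
    show "p \<in> borel_measurable (lebesgue_on K)"
      by (rule continuous_imp_measurable_on_sets_lebesgue[OF p K'])
    show "bounded (p ` K)" using K p compact_continuous_image compact_imp_bounded by blast
  qed (use assms K in \<open>auto simp: locally_integrable_on_def\<close>)
qed

lemma locally_integrable_continuous:
  fixes f :: "real^2 \<Rightarrow> real"
  assumes "continuous_on \<Omega> f"
  shows "locally_integrable_on \<Omega> f"
proof -
  have "locally_integrable_on \<Omega> (\<lambda>x. 1::real)"
    by (auto simp: locally_integrable_on_def intro!: absolutely_integrable_on_const lmeasurable_compact)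
  from locally_integrable_mult_continuous[OF this assms] show ?thesis by simp
qed

lemma locally_integrable_cmult:
  fixes f :: "real^2 \<Rightarrow> real"
  shows "locally_integrable_on \<Omega> f \<Longrightarrow> locally_integrable_on \<Omega> (\<lambda>x. c * f x)"
  by (rule locally_integrable_mult_continuous) auto

lemma set_integrable_pairing:
  fixes u \<theta> :: "real^2 \<Rightarrow> real"
  assumes u: "locally_integrable_on \<Omega> u" and \<theta>: "continuous_on UNIV \<theta>"
    and K: "compact K" "K \<subseteq> \<Omega>" "\<And>x. x \<notin> K \<Longrightarrow> \<theta> x = 0"
  shows "set_integrable lebesgue \<Omega> (\<lambda>x. u x * \<theta> x)"
proof -
  have "locally_integrable_on \<Omega> (\<lambda>x. \<theta> x * u x)"
    using u \<theta> by (intro locally_integrable_mult_continuous) (auto intro: continuous_on_subset)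
  then have "set_integrable lebesgue K (\<lambda>x. \<theta> x * u x)"
    using K by (auto simp: locally_integrable_on_def)
  moreover have "(\<lambda>x. indicator K x *\<^sub>R (\<theta> x * u x)) = (\<lambda>x. indicator \<Omega> x *\<^sub>R (u x * \<theta> x))"
    using K by (auto simp: indicator_def fun_eq_iff)
  ultimately show ?thesis unfolding set_integrable_def by simp
qed

lemma set_integrable_pairing_test:
  assumes "locally_integrable_on \<Omega> u" "test_function \<Omega> \<psi>"
  shows "set_integrable lebesgue \<Omega> (\<lambda>x. u x * \<psi> x)"
proof -
  obtain K where "compact K" "K \<subseteq> \<Omega>" "\<And>x. x \<notin> K \<Longrightarrow> \<psi> x = 0"
    using assms(2) by (rule test_function_supportE) blast
  then show ?thesis
    using assms C_k_continuous[OF test_function_C_k[of \<Omega> \<psi> 0]] by (intro set_integrable_pairing)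
qed

text \<open>The number by which \<open>u\<close> acts on the test function \<open>\<psi>\<close> as a distribution.\<close>

abbreviation pairing :: "(real^2) set \<Rightarrow> (real^2 \<Rightarrow> real) \<Rightarrow> (real^2 \<Rightarrow> real) \<Rightarrow> real" where
  "pairing \<Omega> u \<psi> \<equiv> LINT x:\<Omega>|lebesgue. u x * \<psi> x"

text \<open>Equality of the Bochner integrals needs \<open>w \<theta>\<close> to be measurable, which follows from
  completeness of the Lebesgue measure.\<close>

lemma pairing_cong_ae:
  fixes u w \<theta> :: "real^2 \<Rightarrow> real"
  assumes "set_integrable lebesgue \<Omega> (\<lambda>x. u x * \<theta> x)" "ae_eq \<Omega> u w" "open \<Omega>"
  shows "pairing \<Omega> u \<theta> = pairing \<Omega> w \<theta>"
proof -
  have n: "negligible {x \<in> \<Omega>. u x \<noteq> w x}"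
    using assms by (simp add: ae_eq_iff_negligible)
  have "(\<lambda>x. w x * \<theta> x) absolutely_integrable_on \<Omega>"
    by (rule absolutely_integrable_spike[OF assms(1) n]) auto
  then have m: "(\<lambda>x. indicator \<Omega> x *\<^sub>R (w x * \<theta> x)) \<in> borel_measurable lebesgue"
     "(\<lambda>x. indicator \<Omega> x *\<^sub>R (u x * \<theta> x)) \<in> borel_measurable lebesgue"
    using assms(1) unfolding set_integrable_def by auto
  show ?thesis unfolding set_lebesgue_integral_def
  proof (rule integral_cong_AE[OF m(2,1)])
    show "AE x in lebesgue. indicator \<Omega> x *\<^sub>R (u x * \<theta> x) = indicator \<Omega> x *\<^sub>R (w x * \<theta> x)"
      unfolding AE_lebesgue_iff_negligible
      by (rule negligible_subset[OF n]) (auto simp: indicator_def)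
  qed
qed

text \<open>The integral of a directional derivative with compact support vanishes because the
  integrals of all difference quotients vanish, by translation invariance.\<close>

lemma integral_directional_derivative:
  fixes g g' :: "real^2 \<Rightarrow> real"
  assumes d: "\<And>x t. ((\<lambda>t. g (x + t *\<^sub>R e)) has_real_derivative g' (x + t *\<^sub>R e)) (at t)"
    and c: "continuous_on UNIV g" "continuous_on UNIV g'"
    and K: "compact K" "\<And>x. x \<notin> K \<Longrightarrow> g x = 0" "\<And>x. x \<notin> K \<Longrightarrow> g' x = 0"
  shows "integral\<^sup>L lborel g' = 0"
proof -
  define h :: "nat \<Rightarrow> real" where "h n = inverse (real (Suc n))" for n
  have h: "0 < h n" "h n \<le> 1" for n by (auto simp: h_def field_simps)
  have h0: "h \<longlonglongrightarrow> 0" unfolding h_def by (rule LIMSEQ_inverse_real_of_nat)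
  obtain R where R: "\<And>x. x \<in> K \<Longrightarrow> norm x \<le> R"
    using compact_imp_bounded[OF K(1)] unfolding bounded_iff by blast
  define B where "B = cball (0::real^2) (R + norm e)"
  have "bounded (g' ` K)"
    by (intro compact_imp_bounded compact_continuous_image continuous_on_subset[OF c(2)] K(1)) simp
  then obtain M where "M > 0" "\<forall>y\<in>g' ` K. norm y \<le> M"
    unfolding bounded_pos by blast
  then have M: "\<And>x. x \<in> K \<Longrightarrow> \<bar>g' x\<bar> \<le> M" "M > 0" by auto
  then have M': "\<bar>g' x\<bar> \<le> M" for x by (cases "x \<in> K") (auto simp: K)
  \<comment> \<open>the difference quotients with steps \<open>1 / (n + 1)\<close>, dominated by a multiple of the indicator of a ball\<close>
  define q where "q n x = (g (x + h n *\<^sub>R e) - g x) / h n" for n x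
  have int_g: "integrable lborel g"
  proof -
    have "(\<lambda>x. indicator K x *\<^sub>R g x) = g" using K(2) by (auto simp: indicator_def fun_eq_iff)
    moreover have "integrable lborel (\<lambda>x. indicator K x *\<^sub>R g x)"
      by (rule borel_integrable_compact[OF K(1) continuous_on_subset[OF c(1)]]) simp
    ultimately show ?thesis by simp
  qed
  have mg: "g \<in> borel_measurable borel" and mg': "g' \<in> borel_measurable borel"
    using c by (auto intro: borel_measurable_continuous_onI)
  have shift: "integrable lborel (\<lambda>x. g (x + v))" "integral\<^sup>L lborel (\<lambda>x. g (x + v)) = integral\<^sup>L lborel g" for v
  proof -
    have "integrable (distr lborel borel ((+) v)) g" by (simp add: lborel_distr_plus int_g)
    then show "integrable lborel (\<lambda>x. g (x + v))"
      using integrable_distr_eq[of "(+) v" lborel borel g] mg by (simp add: add.commute)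
    have "integral\<^sup>L (distr lborel borel ((+) v)) g = integral\<^sup>L lborel (\<lambda>x. g (v + x))"
      using mg by (intro integral_distr) auto
    then show "integral\<^sup>L lborel (\<lambda>x. g (x + v)) = integral\<^sup>L lborel g" 
      by (simp add: lborel_distr_plus add.commute)
  qed
  have q0: "integral\<^sup>L lborel (q n) = 0" for n
    unfolding q_def using int_g shift by simp
  have "(\<lambda>n. integral\<^sup>L lborel (q n)) \<longlonglongrightarrow> integral\<^sup>L lborel g'"
  proof (rule integral_dominated_convergence[where w = "\<lambda>x. M * indicator B x"])
    show "q n \<in> borel_measurable lborel" for n
    proof -
      have "continuous_on UNIV (\<lambda>x. g (x + h n *\<^sub>R e))"
        by (rule continuous_on_compose2[OF c(1)]) (auto intro: continuous_intros)
      then have "continuous_on UNIV (q n)"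
        unfolding q_def[abs_def] using h(1)[of n] c(1) by (intro continuous_on_divide continuous_on_diff continuous_on_const) auto
      then show ?thesis by (simp add: borel_measurable_continuous_onI)
    qed
    show "integrable lborel (\<lambda>x. M * indicator B x)"
      unfolding B_def using emeasure_lborel_cball_finite[of "0::real^2" "R + norm e"]
      by (intro integrable_mult_right integrable_real_indicator) (auto simp: less_top)
    show "AE x in lborel. (\<lambda>n. q n x) \<longlonglongrightarrow> g' x"
    proof (rule AE_I2)
      fix x
      have "(\<lambda>s. (g (x + s *\<^sub>R e) - g x) / s) \<midarrow>0\<rightarrow> g' x"
        using d[of x 0] by (simp add: DERIV_def)
      moreover have "filterlim h (at 0) sequentially"
        using h0 h(1) by (auto simp: filterlim_at less_imp_neq[symmetric] intro!: always_eventually)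
      ultimately show "(\<lambda>n. q n x) \<longlonglongrightarrow> g' x"
        unfolding q_def by (rule filterlim_compose)
    qed
    show "AE x in lborel. norm (q n x) \<le> M * indicator B x" for n
    proof (rule AE_I2)
      fix x
      show "norm (q n x) \<le> M * indicator B x"
      proof (cases "x \<in> B")
        case True
        obtain s where "g (x + h n *\<^sub>R e) - g (x + 0 *\<^sub>R e) = (h n - 0) * g' (x + s *\<^sub>R e)"
          using MVT2[OF h(1)[of n] d[of x]] by blast
        then have "q n x = g' (x + s *\<^sub>R e)" using h[of n] by (simp add: q_def)
        then show ?thesis using True M' by simp
      next
        case False
        have "x \<notin> K" using False R[of x] norm_ge_zero[of e] by (auto simp: B_def)
        moreover have "x + h n *\<^sub>R e \<notin> K"
        proof
          assume "x + h n *\<^sub>R e \<in> K"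
          then have "norm (x + h n *\<^sub>R e) \<le> R" by (rule R)
          moreover have "norm (h n *\<^sub>R e) \<le> norm e" using h[of n] by (simp add: mult_left_le_one_le)
          moreover have "norm x \<le> norm (x + h n *\<^sub>R e) + norm (h n *\<^sub>R e)"
            by (metis add_diff_cancel_right' norm_triangle_ineq4)
          ultimately show False using False by (auto simp: B_def)
        qed
        ultimately show ?thesis using False by (simp add: q_def K)
      qed
    qed
  qed (use mg' in auto)
  then show ?thesis by (simp add: q0 LIMSEQ_const_iff)
qed

lemma continuous_on_extend_zero:
  fixes h :: "real^2 \<Rightarrow> real"
  assumes "open \<Omega>" "compact K" "K \<subseteq> \<Omega>" "continuous_on \<Omega> h" "\<And>x. x \<notin> K \<Longrightarrow> h x = 0"
  shows "continuous_on UNIV h"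
proof -
  have "continuous_on (- K) h"
    by (rule continuous_on_eq[of _ "\<lambda>x. 0"]) (use assms in auto)
  then have "continuous_on (\<Omega> \<union> - K) h"
    using assms by (intro continuous_on_open_Un) (auto simp: compact_imp_closed)
  moreover have "\<Omega> \<union> - K = UNIV" using assms by auto
  ultimately show ?thesis by simp
qed

text \<open>The product of \<open>f\<close> with a test function, extended by zero, is continuously differentiable on the
  whole plane, so its derivative integrates to zero; this is integration by parts.\<close>

lemma has_weak_partial_classical:
  assumes \<Omega>: "open \<Omega>" and d: "\<And>x. x \<in> \<Omega> \<Longrightarrow> (f has_derivative f' x) (at x)"
    and c: "continuous_on \<Omega> (\<lambda>x. f' x (axis i 1))"
  shows "has_weak_partial \<Omega> i f (\<lambda>x. f' x (axis i 1))"
  unfolding has_weak_partial_def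
proof (intro conjI allI impI)
  let ?e = "axis i 1 :: real^2"
  have cf: "continuous_on \<Omega> f"
    using d \<Omega> by (meson continuous_at_imp_continuous_on has_derivative_continuous)
  show lf: "locally_integrable_on \<Omega> f" using cf by (rule locally_integrable_continuous)
  show lf': "locally_integrable_on \<Omega> (\<lambda>x. f' x ?e)" using c by (rule locally_integrable_continuous)
  fix \<psi> assume t: "test_function \<Omega> \<psi>"
  then obtain K where K: "compact K" "K \<subseteq> \<Omega>" "\<And>x. x \<notin> K \<Longrightarrow> \<psi> x = 0"
    by (rule test_function_supportE) blast
  have K': "\<And>x. x \<notin> K \<Longrightarrow> partial i \<psi> x = 0" using partial_outside[of K \<psi> _ i] K(1,3) by blast
  have c\<psi>: "continuous_on UNIV \<psi>" "continuous_on UNIV (partial i \<psi>)"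
    using C_k_continuous[of 0] test_function_C_k[OF t] test_function_C_k[OF test_function_partial[OF t]] by blast+
  define g where "g x = f x * \<psi> x" for x
  define g' where "g' x = f x * partial i \<psi> x + f' x ?e * \<psi> x" for x
  have cg: "continuous_on UNIV g"
  proof (rule continuous_on_extend_zero[OF \<Omega> K(1,2)])
    show "continuous_on \<Omega> g" unfolding g_def
      by (intro continuous_on_mult cf continuous_on_subset[OF c\<psi>(1)]) simp
  qed (simp add: g_def K(3))
  have cg': "continuous_on UNIV g'"
  proof (rule continuous_on_extend_zero[OF \<Omega> K(1,2)])
    show "continuous_on \<Omega> g'" unfolding g'_def
      by (intro continuous_on_add continuous_on_mult cf c continuous_on_subset[OF c\<psi>(1)]
        continuous_on_subset[OF c\<psi>(2)]) simp_all
  qed (simp add: g'_def K(3) K')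
  have "integral\<^sup>L lborel g' = 0"
  proof (rule integral_directional_derivative[OF _ _ _ K(1)])
    show "g x = 0" "g' x = 0" if "x \<notin> K" for x using that K K' by (auto simp: g_def g'_def)
    show "continuous_on UNIV g" "continuous_on UNIV g'"
      using cg cg' by auto
    show "((\<lambda>t. g (x + t *\<^sub>R ?e)) has_real_derivative g' (x + t *\<^sub>R ?e)) (at t)" for x t
    proof (cases "x + t *\<^sub>R ?e \<in> \<Omega>")
      case True
      let ?y = "x + t *\<^sub>R ?e"
      have l: "((\<lambda>t. x + t *\<^sub>R ?e) has_derivative (\<lambda>s. s *\<^sub>R ?e)) (at t)"
        by (auto intro!: derivative_eq_intros)
      have "((\<lambda>t. f (x + t *\<^sub>R ?e)) has_derivative (\<lambda>s. f' ?y (s *\<^sub>R ?e))) (at t)"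
        by (rule has_derivative_compose[OF l d[OF True]])
      moreover have "linear (f' ?y)" using d[OF True] has_derivative_linear by blast
      ultimately have "((\<lambda>t. f (x + t *\<^sub>R ?e)) has_real_derivative f' ?y ?e) (at t)"
        by (simp add: has_field_derivative_def linear_cmul mult.commute[of _ "f' _ _"])
      from DERIV_mult[OF this C_k_has_partial_line[OF test_function_C_k[OF t], of x i]]
      show ?thesis by (simp add: g_def g'_def algebra_simps)
    next
      case False
      then have "x + t *\<^sub>R ?e \<in> - K" using K by auto
      moreover have "continuous_on UNIV (\<lambda>t. x + t *\<^sub>R ?e)" by (intro continuous_intros)
      ultimately have o: "open ((\<lambda>t. x + t *\<^sub>R ?e) -` (- K))" "t \<in> (\<lambda>t. x + t *\<^sub>R ?e) -` (- K)"
        using K(1) by (auto intro!: open_vimage simp: compact_imp_closed)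
      have "((\<lambda>t. g (x + t *\<^sub>R ?e)) has_real_derivative 0) (at t)"
        by (rule has_field_derivative_transform_within_open[OF DERIV_const[of 0] o]) (auto simp: g_def K)
      moreover have "g' (x + t *\<^sub>R ?e) = 0" using \<open>x + t *\<^sub>R ?e \<in> - K\<close> K(3) K' by (simp add: g'_def)
      ultimately show ?thesis by simp
    qed
  qed
  moreover have "integral\<^sup>L lborel g' = integral\<^sup>L lebesgue g'"
  proof (rule integral_completion[symmetric])
    show "g' \<in> borel_measurable lborel" using cg' by (simp add: borel_measurable_continuous_onI)
  qed
  moreover have "integral\<^sup>L lebesgue g' = (LINT x:\<Omega>|lebesgue. f x * partial i \<psi> x + f' x ?e * \<psi> x)"
  proof -
    have "x \<notin> \<Omega> \<Longrightarrow> g' x = 0" for x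
      using subsetD[OF K(2), of x] K(3)[of x] K'[of x] by (cases "x \<in> K") (auto simp: g'_def)
    then have "g' = (\<lambda>x. indicator \<Omega> x *\<^sub>R (f x * partial i \<psi> x + f' x ?e * \<psi> x))"
      by (auto simp: g'_def indicator_def fun_eq_iff)
    then show ?thesis unfolding set_lebesgue_integral_def by simp
  qed
  moreover have "\<dots> = pairing \<Omega> f (partial i \<psi>) + (LINT x:\<Omega>|lebesgue. f' x ?e * \<psi> x)"
    by (intro set_integral_add set_integrable_pairing_test lf lf' t test_function_partial)
  ultimately show "pairing \<Omega> f (partial i \<psi>) = - (LINT x:\<Omega>|lebesgue. f' x ?e * \<psi> x)"
    by simp
qed

lemma has_weak_partial_integrable:
  assumes "has_weak_partial \<Omega> i f g"
  shows "locally_integrable_on \<Omega> f" "locally_integrable_on \<Omega> g"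
  using assms by (auto simp: has_weak_partial_def)

lemma has_weak_partialD:
  assumes "has_weak_partial \<Omega> i f g" "test_function \<Omega> \<psi>"
  shows "pairing \<Omega> f (partial i \<psi>) = - pairing \<Omega> g \<psi>"
  using assms by (auto simp: has_weak_partial_def)

lemma has_weak_partial_cong_ae:
  assumes "has_weak_partial \<Omega> i f g" "ae_eq \<Omega> f f'" "ae_eq \<Omega> g g'" "open \<Omega>"
  shows "has_weak_partial \<Omega> i f' g'"
  unfolding has_weak_partial_def
proof (intro conjI allI impI)
  note l = has_weak_partial_integrable[OF assms(1)]
  show "locally_integrable_on \<Omega> f'" "locally_integrable_on \<Omega> g'"
    using l assms locally_integrable_cong_ae by blast+
  fix \<psi> assume t: "test_function \<Omega> \<psi>"
  have "pairing \<Omega> f (partial i \<psi>) = pairing \<Omega> f' (partial i \<psi>)"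
    by (intro pairing_cong_ae set_integrable_pairing_test l test_function_partial t assms)
  moreover have "pairing \<Omega> g \<psi> = pairing \<Omega> g' \<psi>"
    by (intro pairing_cong_ae set_integrable_pairing_test l t assms)
  ultimately show "pairing \<Omega> f' (partial i \<psi>) = - pairing \<Omega> g' \<psi>"
    using has_weak_partialD[OF assms(1) t] by simp
qed

lemma has_weak_partial_add:
  assumes "has_weak_partial \<Omega> i f g" "has_weak_partial \<Omega> i f' g'"
  shows "has_weak_partial \<Omega> i (\<lambda>x. f x + f' x) (\<lambda>x. g x + g' x)"
  unfolding has_weak_partial_def
proof (intro conjI allI impI)
  note l = has_weak_partial_integrable[OF assms(1)] has_weak_partial_integrable[OF assms(2)]
  show "locally_integrable_on \<Omega> (\<lambda>x. f x + f' x)" "locally_integrable_on \<Omega> (\<lambda>x. g x + g' x)"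
    using l by (auto intro: locally_integrable_add)
  fix \<psi> assume t: "test_function \<Omega> \<psi>"
  have split: "(LINT x:\<Omega>|lebesgue. (u x + w x) * \<theta> x) =
      pairing \<Omega> u \<theta> + pairing \<Omega> w \<theta>"
    if "locally_integrable_on \<Omega> u" "locally_integrable_on \<Omega> w" "test_function \<Omega> \<theta>" for u w \<theta> :: "real^2 \<Rightarrow> real"
    unfolding distrib_right using that by (intro set_integral_add set_integrable_pairing_test)
  show "(LINT x:\<Omega>|lebesgue. (f x + f' x) * partial i \<psi> x) = - (LINT x:\<Omega>|lebesgue. (g x + g' x) * \<psi> x)"
    using has_weak_partialD[OF assms(1) t] has_weak_partialD[OF assms(2) t]
    by (simp add: split l t test_function_partial)
qed

lemma has_weak_partial_cmult:
  assumes "has_weak_partial \<Omega> i f g"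
  shows "has_weak_partial \<Omega> i (\<lambda>x. c * f x) (\<lambda>x. c * g x)"
  unfolding has_weak_partial_def
proof (intro conjI allI impI)
  note l = has_weak_partial_integrable[OF assms]
  show "locally_integrable_on \<Omega> (\<lambda>x. c * f x)" "locally_integrable_on \<Omega> (\<lambda>x. c * g x)"
    using l by (auto intro: locally_integrable_cmult)
  fix \<psi> assume t: "test_function \<Omega> \<psi>"
  show "(LINT x:\<Omega>|lebesgue. c * f x * partial i \<psi> x) = - (LINT x:\<Omega>|lebesgue. c * g x * \<psi> x)"
    using has_weak_partialD[OF assms t] by (simp add: mult.assoc)
qed

text \<open>A smooth factor can be moved onto the test function, since the product of a test function
  and a smooth function is again a test function.\<close>

lemma has_weak_partial_mult_smooth:
  assumes w: "has_weak_partial \<Omega> i f g" and p: "\<And>k. C_k k p"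
  shows "has_weak_partial \<Omega> i (\<lambda>x. p x * f x) (\<lambda>x. partial i p x * f x + p x * g x)"
  unfolding has_weak_partial_def
proof (intro conjI allI impI)
  note l = has_weak_partial_integrable[OF w]
  have p': "C_k k (partial i p)" for k using p[of "Suc k"] by simp
  have cp: "continuous_on \<Omega> p" "continuous_on \<Omega> (partial i p)"
    using C_k_continuous[OF p[of 0]] C_k_continuous[OF p'[of 0]] by (auto intro: continuous_on_subset)
  show "locally_integrable_on \<Omega> (\<lambda>x. p x * f x)"
    "locally_integrable_on \<Omega> (\<lambda>x. partial i p x * f x + p x * g x)"
    using l cp by (auto intro!: locally_integrable_add locally_integrable_mult_continuous)
  fix \<psi> assume t: "test_function \<Omega> \<psi>"
  have t1: "test_function \<Omega> (\<lambda>x. p x * \<psi> x)" and t2: "test_function \<Omega> (\<lambda>x. partial i p x * \<psi> x)"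
    and t3: "test_function \<Omega> (\<lambda>x. p x * partial i \<psi> x)"
    using t p p' by (auto intro: test_function_mult test_function_partial)
  have "partial i (\<lambda>x. p x * \<psi> x) x = p x * partial i \<psi> x + partial i p x * \<psi> x" for x
    using partial_eqI[OF has_derivative_mult[OF C_k_Suc_has_derivative[OF p] C_k_Suc_has_derivative[OF test_function_C_k[OF t]]]]
    by (simp add: partial_def)
  then have e: "f x * partial i (\<lambda>x. p x * \<psi> x) x = f x * (p x * partial i \<psi> x) + f x * (partial i p x * \<psi> x)" for x
    by (simp add: algebra_simps)
  have 1: "(LINT x:\<Omega>|lebesgue. f x * (p x * partial i \<psi> x)) + (LINT x:\<Omega>|lebesgue. f x * (partial i p x * \<psi> x))
      = - (LINT x:\<Omega>|lebesgue. g x * (p x * \<psi> x))"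
    using has_weak_partialD[OF w t1] unfolding e
    by (subst (asm) set_integral_add) (intro set_integrable_pairing_test l t2 t3)+
  have e': "(partial i p x * f x + p x * g x) * \<psi> x = f x * (partial i p x * \<psi> x) + g x * (p x * \<psi> x)" for x
    by (simp add: algebra_simps)
  have 2: "(LINT x:\<Omega>|lebesgue. (partial i p x * f x + p x * g x) * \<psi> x)
     = (LINT x:\<Omega>|lebesgue. f x * (partial i p x * \<psi> x)) + (LINT x:\<Omega>|lebesgue. g x * (p x * \<psi> x))"
    unfolding e' by (intro set_integral_add set_integrable_pairing_test l t2 t1)
  have e'': "p x * f x * partial i \<psi> x = f x * (p x * partial i \<psi> x)" for x by simp
  show "(LINT x:\<Omega>|lebesgue. p x * f x * partial i \<psi> x)
      = - (LINT x:\<Omega>|lebesgue. (partial i p x * f x + p x * g x) * \<psi> x)"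
    unfolding 2 e'' using 1 by simp
qed

section \<open>Uniqueness of weak derivatives\<close>

text \<open>The positive and the negative part of \<open>G\<close> are densities of two measures that agree on boxes,
  hence on all Borel sets.\<close>

lemma ae_zero_of_box_integrals_zero:
  fixes G :: "real^2 \<Rightarrow> real"
  assumes G: "integrable lebesgue G" and z: "\<And>c d. (LINT x:box c d|lebesgue. G x) = 0"
  shows "negligible {x. G x \<noteq> 0}"
proof -
  obtain g where g: "g \<in> borel_measurable lborel" and ae: "AE x in lborel. G x = g x"
    using completion_ex_borel_measurable_real[OF borel_measurable_integrable[OF G]] by blast
  have ae': "AE x in lebesgue. G x = g x" using ae by (rule AE_completion)
  have gl: "g \<in> borel_measurable lebesgue" using g by (rule measurable_completion)
  have "integrable lebesgue g"
    using integrable_cong_AE[OF borel_measurable_integrable[OF G] gl ae'] G by simp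
  then have ig: "integrable lborel g" using g by (simp add: integrable_completion)
  have zb: "integral\<^sup>L lborel (\<lambda>x. indicator (box c d) x * g x) = 0" for c d
  proof -
    have "integral\<^sup>L lborel (\<lambda>x. indicator (box c d) x * g x) = integral\<^sup>L lebesgue (\<lambda>x. indicator (box c d) x * g x)"
      using g by (intro integral_completion[symmetric]) auto
    also have "\<dots> = integral\<^sup>L lebesgue (\<lambda>x. indicator (box c d) x * G x)"
    proof (rule integral_cong_AE)
      have b: "(indicator (box c d) :: real^2 \<Rightarrow> real) \<in> borel_measurable lebesgue"
        by (intro borel_measurable_indicator) simp
      show "(\<lambda>x. indicator (box c d) x * g x) \<in> borel_measurable lebesgue"
        by (rule borel_measurable_times[OF b gl])
      show "(\<lambda>x. indicator (box c d) x * G x) \<in> borel_measurable lebesgue"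
        by (rule borel_measurable_times[OF b borel_measurable_integrable[OF G]])
      show "AE x in lebesgue. indicator (box c d) x * g x = indicator (box c d) x * G x"
        using ae' by (auto elim: eventually_mono)
    qed
    also have "\<dots> = 0" using z[of c d] by (simp add: set_lebesgue_integral_def)
    finally show ?thesis .
  qed
  let ?M = "density lborel (\<lambda>x. ennreal (g x))" and ?N = "density lborel (\<lambda>x. ennreal (- g x))"
  have fin: "(\<integral>\<^sup>+x. ennreal (g x) \<partial>lborel) < \<infinity>" "(\<integral>\<^sup>+x. ennreal (- g x) \<partial>lborel) < \<infinity>"
    using ig by (simp_all add: real_integrable_def less_top)
  have emM: "emeasure ?M (box c d) = (\<integral>\<^sup>+x. ennreal (indicator (box c d) x * g x) \<partial>lborel)"
    and emN: "emeasure ?N (box c d) = (\<integral>\<^sup>+x. ennreal (- (indicator (box c d) x * g x)) \<partial>lborel)" for c d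
    using g by (auto simp: emeasure_density indicator_def intro!: nn_integral_cong)
  have fb: "emeasure ?M (box c d) \<noteq> \<infinity>" "emeasure ?N (box c d) \<noteq> \<infinity>" for c d
  proof -
    have "emeasure ?M (box c d) \<le> (\<integral>\<^sup>+x. ennreal (g x) \<partial>lborel)"
      unfolding emM by (intro nn_integral_mono) (auto simp: indicator_def)
    then show "emeasure ?M (box c d) \<noteq> \<infinity>" using fin(1) by (auto simp: top_unique)
    have "emeasure ?N (box c d) \<le> (\<integral>\<^sup>+x. ennreal (- g x) \<partial>lborel)"
      unfolding emN by (intro nn_integral_mono) (auto simp: indicator_def)
    then show "emeasure ?N (box c d) \<noteq> \<infinity>" using fin(2) by (auto simp: top_unique)
  qed
  have "?M = ?N"
  proof (rule measure_eqI_generator_eq)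
    let ?E = "range (\<lambda>(a, b). box a b :: (real^2) set)"
    show "Int_stable ?E"
      by (auto simp: Int_stable_def box_Int_box)
    show "?E \<subseteq> Pow UNIV" "sets ?M = sigma_sets UNIV ?E" "sets ?N = sigma_sets UNIV ?E"
      by (simp_all add: borel_eq_box)
    let ?A = "\<lambda>n::nat. box (- (real n *\<^sub>R One)) (real n *\<^sub>R One) :: (real^2) set"
    show "range ?A \<subseteq> ?E" "(\<Union>i. ?A i) = UNIV"
      unfolding UN_box_eq_UNIV by auto
    show "emeasure ?M (?A i) \<noteq> \<infinity>" for i by (rule fb)
    fix X assume "X \<in> ?E"
    then obtain c d where X: "X = box c d" by auto
    let ?h = "\<lambda>x. indicator (box c d) x * g x"
    have "integrable lborel ?h" using ig by (intro integrable_mult_indicator[of "box c d" lborel g, simplified]) auto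
    then have "integral\<^sup>L lborel ?h = enn2real (emeasure ?M X) - enn2real (emeasure ?N X)"
      unfolding X emM emN by (rule real_lebesgue_integral_def)
    then have "enn2real (emeasure ?M X) = enn2real (emeasure ?N X)" using zb by simp
    then show "emeasure ?M X = emeasure ?N X"
      using fb[of c d] unfolding X by (metis ennreal_enn2real_if infinity_ennreal_def)
  qed
  then have "AE x in lborel. ennreal (g x) = ennreal (- g x)"
    using g by (intro sigma_finite_measure.density_unique[OF sigma_finite_lborel]) auto
  then have "AE x in lborel. G x = 0"
    using ae
  proof eventually_elim
    case (elim x)
    then show ?case by (cases "g x" "0::real" rule: linorder_cases) (auto simp: ennreal_neg)
  qed
  then have "AE x in lebesgue. G x = 0" by (rule AE_completion)
  then show ?thesis by (simp add: AE_lebesgue_iff_negligible)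
qed

lemma negligible_nonzero_in_box:
  fixes u :: "real^2 \<Rightarrow> real"
  assumes u: "u absolutely_integrable_on cbox a b"
    and z: "\<And>c d. cbox c d \<subseteq> cbox a b \<Longrightarrow> (LINT x:box c d|lebesgue. u x) = 0"
  shows "negligible {x \<in> box a b. u x \<noteq> 0}"
proof -
  define G where "G x = indicator (box a b) x * u x" for x
  have "negligible {x. G x \<noteq> 0}"
  proof (rule ae_zero_of_box_integrals_zero)
    have "set_integrable lebesgue (box a b) u"
      by (rule set_integrable_subset[OF u]) (auto simp: box_subset_cbox)
    then show "integrable lebesgue G" by (simp add: G_def[abs_def] set_integrable_def)
    fix c d :: "real^2"
    obtain c' d' where i: "box c d \<inter> box a b = box c' d'" using box_Int_box by blast
    have "(LINT x:box c d|lebesgue. G x) = (LINT x:box c' d'|lebesgue. u x)"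
      unfolding set_lebesgue_integral_def i[symmetric] G_def
      by (rule Bochner_Integration.integral_cong) (auto simp: indicator_def)
    also have "\<dots> = 0"
    proof (cases "box c' d' = {}")
      case False
      then have "cbox c' d' = closure (box c' d')" by simp
      also have "\<dots> \<subseteq> closure (box a b)" using i by (intro closure_mono) auto
      also have "\<dots> \<subseteq> cbox a b" by (intro closure_minimal box_subset_cbox closed_cbox)
      finally show ?thesis by (rule z)
    qed (simp add: set_lebesgue_integral_def)
    finally show "(LINT x:box c d|lebesgue. G x) = 0" .
  qed
  then show ?thesis by (rule negligible_subset) (auto simp: G_def)
qed

text \<open>The plane is second countable, so null sets can be recognised locally.\<close>

lemma negligible_locally_in_boxes:
  fixes \<Omega> :: "(real^2) set"
  assumes "\<And>x. x \<in> \<Omega> \<Longrightarrow> \<exists>a b. x \<in> box a b \<and> negligible {y \<in> box a b. P y}"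
  shows "negligible {x \<in> \<Omega>. P x}"
  unfolding locally_negligible_alt[of "{x \<in> \<Omega>. P x}"]
proof
  fix x assume "x \<in> {x \<in> \<Omega>. P x}"
  then obtain a b where ab: "x \<in> box a b" "negligible {y \<in> box a b. P y}" "x \<in> \<Omega>" "P x" using assms by blast
  let ?S = "{x \<in> \<Omega>. P x}"
  have "negligible (?S \<inter> box a b)" by (rule negligible_subset[OF ab(2)]) auto
  moreover have "openin (top_of_set ?S) (?S \<inter> box a b)" by (rule openin_open_Int) (rule open_box)
  ultimately show "\<exists>U. openin (top_of_set ?S) U \<and> x \<in> U \<and> negligible U" using ab by blast
qed

text \<open>The products of bump functions converge to the indicator of a box, so that testing with
  them recovers the integrals over boxes.\<close>

lemma bump_product_pairing_tendsto:
  fixes u :: "real^2 \<Rightarrow> real"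
  assumes u: "locally_integrable_on \<Omega> u" and cd: "cbox c d \<subseteq> \<Omega>"
  shows "(\<lambda>n. LINT x:\<Omega>|lebesgue. u x * (bump n (c$1) (d$1) (x$1) * bump n (c$2) (d$2) (x$2)))
     \<longlonglongrightarrow> (LINT x:box c d|lebesgue. u x)"
  unfolding set_lebesgue_integral_def
proof (rule integral_dominated_convergence[where w = "\<lambda>x. norm (indicator (cbox c d) x *\<^sub>R u x)"])
  let ?b = "\<lambda>n (x::real^2). bump n (c$1) (d$1) (x$1) * bump n (c$2) (d$2) (x$2)"
  have i: "set_integrable lebesgue (cbox c d) u"
    using u cd by (auto simp: locally_integrable_on_def)
  then show "integrable lebesgue (\<lambda>x. norm (indicator (cbox c d) x *\<^sub>R u x))"
    unfolding set_integrable_def by (rule integrable_norm)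
  have "set_integrable lebesgue (box c d) u"
    by (rule set_integrable_subset[OF i]) (auto simp: box_subset_cbox)
  then show "(\<lambda>x. indicator (box c d) x *\<^sub>R u x) \<in> borel_measurable lebesgue"
    unfolding set_integrable_def by auto
  have t: "test_function \<Omega> (?b n)" for n
    by (rule test_function_product[of _ _ c d]) (use cd in \<open>auto simp: smooth_bump bump_outside\<close>)
  then show "(\<lambda>x. indicator \<Omega> x *\<^sub>R (u x * ?b n x)) \<in> borel_measurable lebesgue" for n
    using set_integrable_pairing_test[OF u, of "?b n"] unfolding set_integrable_def by auto
  have out: "?b n x = 0" if "x \<notin> box c d" for n x
    using that bump_outside by (auto simp: mem_box_cart forall_2)
  show "AE x in lebesgue. (\<lambda>n. indicator \<Omega> x *\<^sub>R (u x * ?b n x)) \<longlonglongrightarrow> indicator (box c d) x *\<^sub>R u x"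
  proof (rule AE_I2)
    fix x :: "real^2"
    show "(\<lambda>n. indicator \<Omega> x *\<^sub>R (u x * ?b n x)) \<longlonglongrightarrow> indicator (box c d) x *\<^sub>R u x"
    proof (cases "x \<in> box c d")
      case True
      then have x: "x \<in> \<Omega>" "x $ 1 \<in> {c$1<..<d$1}" "x $ 2 \<in> {c$2<..<d$2}"
        using subset_trans[OF box_subset_cbox cd] by (blast, simp_all add: mem_box_cart)
      have "(\<lambda>n. u x * ?b n x) \<longlonglongrightarrow> u x * (indicator {c$1<..<d$1} (x$1) * indicator {c$2<..<d$2} (x$2))"
        by (intro tendsto_intros bump_tendsto)
      then show ?thesis using x True by simp
    qed (simp add: out)
  qed
  show "AE x in lebesgue. norm (indicator \<Omega> x *\<^sub>R (u x * ?b n x)) \<le> norm (indicator (cbox c d) x *\<^sub>R u x)" for n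
  proof (rule AE_I2)
    fix x :: "real^2"
    show "norm (indicator \<Omega> x *\<^sub>R (u x * ?b n x)) \<le> norm (indicator (cbox c d) x *\<^sub>R u x)"
    proof (cases "x \<in> box c d")
      case True
      have "\<bar>?b n x\<bar> \<le> 1" using bump_range by (auto simp: abs_mult intro!: mult_le_one)
      then have "\<bar>u x * ?b n x\<bar> \<le> \<bar>u x\<bar>" by (simp add: abs_mult mult_left_le)
      then show ?thesis using True box_subset_cbox[of c d] by (auto simp: indicator_def)
    qed (simp add: out)
  qed
qed

lemma negligible_of_pairings_zero:
  fixes u :: "real^2 \<Rightarrow> real"
  assumes \<Omega>: "open \<Omega>" and u: "locally_integrable_on \<Omega> u"
    and z: "\<And>\<psi>. test_function \<Omega> \<psi> \<Longrightarrow> pairing \<Omega> u \<psi> = 0"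
  shows "negligible {x \<in> \<Omega>. u x \<noteq> 0}"
proof (rule negligible_locally_in_boxes)
  fix x assume "x \<in> \<Omega>"
  then obtain a b where ab: "x \<in> box a b" "cbox a b \<subseteq> \<Omega>" using open_contains_cbox[OF \<Omega>] by metis
  have "negligible {y \<in> box a b. u y \<noteq> 0}"
  proof (rule negligible_nonzero_in_box)
    show "u absolutely_integrable_on cbox a b" using u ab by (auto simp: locally_integrable_on_def)
    fix c d :: "real^2" assume "cbox c d \<subseteq> cbox a b"
    then have cd: "cbox c d \<subseteq> \<Omega>" using ab by blast
    have "test_function \<Omega> (\<lambda>x. bump n (c$1) (d$1) (x$1) * bump n (c$2) (d$2) (x$2))" for n
      by (rule test_function_product[of _ _ c d]) (use cd in \<open>auto simp: smooth_bump bump_outside\<close>)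
    then show "(LINT x:box c d|lebesgue. u x) = 0"
      using bump_product_pairing_tendsto[OF u cd] by (simp add: z LIMSEQ_const_iff)
  qed
  with ab show "\<exists>a b. x \<in> box a b \<and> negligible {y \<in> box a b. u y \<noteq> 0}" by blast
qed

lemma ae_eq_of_pairings_eq:
  fixes u w :: "real^2 \<Rightarrow> real"
  assumes \<Omega>: "open \<Omega>" and u: "locally_integrable_on \<Omega> u" and w: "locally_integrable_on \<Omega> w"
    and e: "\<And>\<psi>. test_function \<Omega> \<psi> \<Longrightarrow> pairing \<Omega> u \<psi> = pairing \<Omega> w \<psi>"
  shows "ae_eq \<Omega> u w"
proof -
  have "negligible {x \<in> \<Omega>. u x + (- 1) * w x \<noteq> 0}"
  proof (rule negligible_of_pairings_zero[OF \<Omega>])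
    show "locally_integrable_on \<Omega> (\<lambda>x. u x + (- 1) * w x)"
      by (intro locally_integrable_add locally_integrable_cmult u w)
    fix \<psi> assume t: "test_function \<Omega> \<psi>"
    have "(LINT x:\<Omega>|lebesgue. u x * \<psi> x - w x * \<psi> x) = 0"
      using e[OF t] set_integrable_pairing_test[OF u t] set_integrable_pairing_test[OF w t]
      by (subst set_integral_diff) auto
    then show "(LINT x:\<Omega>|lebesgue. (u x + (- 1) * w x) * \<psi> x) = 0"
      by (simp add: algebra_simps)
  qed
  then show ?thesis using \<Omega> by (simp add: ae_eq_iff_negligible)
qed

lemma has_weak_partial_unique:
  assumes "open \<Omega>" "has_weak_partial \<Omega> i f g" "has_weak_partial \<Omega> i f g'"
  shows "ae_eq \<Omega> g g'"
proof (rule ae_eq_of_pairings_eq[OF assms(1)])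
  show "locally_integrable_on \<Omega> g" "locally_integrable_on \<Omega> g'"
    using assms has_weak_partial_integrable by blast+
  show "pairing \<Omega> g \<psi> = pairing \<Omega> g' \<psi>" if "test_function \<Omega> \<psi>" for \<psi>
    using has_weak_partialD[OF assms(2) that] has_weak_partialD[OF assms(3) that] by simp
qed

section \<open>Functions with vanishing weak gradient\<close>

lemma integral_bump_tendsto:
  assumes "a \<le> c" "c \<le> d" "d \<le> b"
  shows "(\<lambda>n. integral {a..b} (bump n c d)) \<longlonglongrightarrow> d - c"
proof -
  have i: "bump n c d integrable_on {a..b}" for n
    using smooth_bump[of n c d] smooth_upto_continuous[of 0 "bump n c d"]
    by (intro integrable_continuous_interval) (auto simp: smooth_def intro: continuous_on_subset)
  have "(\<lambda>n. integral {a..b} (bump n c d)) \<longlonglongrightarrow> integral {a..b} (indicator {c<..<d})"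
  proof (rule dominated_convergence(2)[OF i])
    show "(\<lambda>x. 1::real) integrable_on {a..b}" by (rule integrable_const_ivl)
    show "norm (bump n c d x) \<le> 1" for n x using bump_range by simp
    show "(\<lambda>n. bump n c d x) \<longlonglongrightarrow> indicator {c<..<d} x" for x by (rule bump_tendsto)
  qed
  also have "integral {a..b} (indicator {c<..<d}) = integral {a..b} (\<lambda>x. if x \<in> {c..d} then 1 else 0 :: real)"
    by (rule integral_spike[of "{c, d}"]) (auto simp: indicator_def)
  also have "\<dots> = d - c"
    using assms has_integral_restrict[of "{c..d}" "{a..b}" "\<lambda>x. 1::real" "d - c"]
      has_integral_const_real[of "1::real" c d] by (intro integral_unique) simp
  finally show ?thesis .
qed

text \<open>Testing with products \<open>\<phi>(x\<^sub>1) \<omega>(x\<^sub>2)\<close>: subtracting a multiple of a fixed bump from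
  \<open>\<phi>\<close> leaves a function of mean zero, hence a derivative, against which \<open>u\<close> integrates to zero.
  So the pairing depends on \<open>\<phi>\<close>, and likewise on \<open>\<omega>\<close>, only through the mean.\<close>

lemma weak_gradient_zero_box:
  fixes u :: "real^2 \<Rightarrow> real"
  assumes w: "\<And>i. has_weak_partial \<Omega> i u (\<lambda>_. 0)" and ab: "cbox a b \<subseteq> \<Omega>" "a$1 < b$1" "a$2 < b$2"
  shows "\<exists>C. negligible {x \<in> box a b. u x \<noteq> C}"
proof -
  have u: "locally_integrable_on \<Omega> u" using has_weak_partial_integrable[OF w] by blast
  define I where "I \<phi> \<omega> = (LINT x:\<Omega>|lebesgue. u x * (\<phi> (x$1) * \<omega> (x$2)))" for \<phi> \<omega> :: "real \<Rightarrow> real"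
  define adm where "adm i \<phi> \<longleftrightarrow> smooth \<phi> \<and> (\<forall>t. t \<notin> {a$i..b$i} \<longrightarrow> \<phi> t = 0)" for i and \<phi> :: "real \<Rightarrow> real"
  define m where "m i \<phi> = integral {a$i..b$i} \<phi>" for i and \<phi> :: "real \<Rightarrow> real"
  define \<phi>0 where "\<phi>0 i = bump 0 (a$i) (b$i)" for i
  have test: "test_function \<Omega> (\<lambda>x. \<phi> (x$1) * \<omega> (x$2))" if "adm 1 \<phi>" "adm 2 \<omega>" for \<phi> \<omega>
    by (rule test_function_product[of _ _ a b]) (use that ab in \<open>auto simp: adm_def\<close>)
  have z: "pairing \<Omega> u (partial i \<psi>) = 0" if "test_function \<Omega> \<psi>" for i \<psi>
    using has_weak_partialD[OF w that, of i] by (simp add: set_lebesgue_integral_def)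
  have cont: "continuous_on S \<phi>" if "adm i \<phi>" for \<phi> i S
    using that smooth_upto_continuous[of 0 \<phi>] continuous_on_subset[of UNIV \<phi> S] unfolding adm_def smooth_def by blast
  have a0: "adm i (\<phi>0 i)" for i by (auto simp: adm_def \<phi>0_def smooth_bump bump_outside)
  have ab': "a$i < b$i" for i using ab exhaust_2[of i] by auto
  have m0: "m i (\<phi>0 i) \<noteq> 0" for i
  proof
    assume "m i (\<phi>0 i) = 0"
    then have "\<forall>t\<in>{a$i..b$i}. \<phi>0 i t = 0"
      unfolding m_def by (subst (asm) integral_eq_0_iff) (use cont[OF a0] ab' in \<open>auto simp: \<phi>0_def bump_range\<close>)
    moreover have "\<phi>0 i ((a$i + b$i) / 2) > 0" unfolding \<phi>0_def by (rule bump_pos) (use ab'[of i] in auto)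
    ultimately show False using ab'[of i] by force
  qed
  have deriv: "\<exists>\<omega>'. \<forall>t. (\<omega> has_real_derivative \<omega>' t) (at t)" if "adm i \<omega>" for i \<omega>
    using that smooth_upto.simps(2)[of 0 \<omega>] unfolding adm_def smooth_def by blast
  have reduce: "\<exists>\<eta>. adm i \<eta> \<and> (\<forall>t. (\<eta> has_real_derivative (\<phi> t - m i \<phi> / m i (\<phi>0 i) * \<phi>0 i t)) (at t))"
    if \<phi>: "adm i \<phi>" for i \<phi>
  proof -
    let ?c = "m i \<phi> / m i (\<phi>0 i)"
    let ?\<theta> = "\<lambda>t. \<phi> t + - ?c * \<phi>0 i t"
    have s: "smooth ?\<theta>"
      using \<phi> a0[of i] unfolding adm_def smooth_def by (intro allI smooth_upto_add smooth_upto_mult smooth_upto_const) auto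
    have o: "?\<theta> t = 0" if "t \<notin> {a$i..b$i}" for t
      using \<phi> a0[of i] that unfolding adm_def by simp
    have "integral {a$i..b$i} ?\<theta> = m i \<phi> + - ?c * m i (\<phi>0 i)"
    proof -
      have "integral {a$i..b$i} ?\<theta> = integral {a$i..b$i} \<phi> + integral {a$i..b$i} (\<lambda>t. - ?c * \<phi>0 i t)"
        by (intro integral_add integrable_continuous_interval continuous_on_mult continuous_on_const
            cont[OF \<phi>] cont[OF a0])
      also have "integral {a$i..b$i} (\<lambda>t. - ?c * \<phi>0 i t) = - ?c * integral {a$i..b$i} (\<phi>0 i)"
        by (rule integral_mult_right)
      finally show ?thesis by (simp only: m_def)
    qed
    then have "integral {a$i..b$i} ?\<theta> = 0" using m0[of i] by simp
    from smooth_primitive[OF s o this] ab'[of i] obtain \<eta> where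
      "smooth \<eta>" "\<forall>t. (\<eta> has_real_derivative ?\<theta> t) (at t)" "\<forall>t. t \<notin> {a$i..b$i} \<longrightarrow> \<eta> t = 0"
      by (meson less_imp_le)
    then show ?thesis by (intro exI[of _ \<eta>]) (auto simp: adm_def)
  qed
  have I_int: "set_integrable lebesgue \<Omega> (\<lambda>x. u x * (\<phi> (x$1) * \<omega> (x$2)))" if "adm 1 \<phi>" "adm 2 \<omega>" for \<phi> \<omega>
    by (rule set_integrable_pairing_test[OF u test[OF that]])
  have I1: "I \<phi> \<omega> = m 1 \<phi> / m 1 (\<phi>0 1) * I (\<phi>0 1) \<omega>" if a: "adm 1 \<phi>" "adm 2 \<omega>" for \<phi> \<omega>
  proof -
    let ?c = "m 1 \<phi> / m 1 (\<phi>0 1)"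
    obtain \<eta> where \<eta>: "adm 1 \<eta>" "\<forall>t. (\<eta> has_real_derivative (\<phi> t - ?c * \<phi>0 1 t)) (at t)"
      using reduce[OF a(1)] by blast
    obtain \<omega>' where \<omega>': "\<forall>t. (\<omega> has_real_derivative \<omega>' t) (at t)" using deriv[OF a(2)] by blast
    have "0 = (LINT x:\<Omega>|lebesgue. u x * (\<phi> (x$1) * \<omega> (x$2)) - ?c * (u x * (\<phi>0 1 (x$1) * \<omega> (x$2))))"
    proof -
      have "partial 1 (\<lambda>x. \<eta> (x$1) * \<omega> (x$2)) x = (\<phi> (x$1) - ?c * \<phi>0 1 (x$1)) * \<omega> (x$2)" for x
        by (rule partial_product(1)[OF \<eta>(2)[rule_format] \<omega>'[rule_format]])
      then have "u x * partial 1 (\<lambda>x. \<eta> (x$1) * \<omega> (x$2)) x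
          = u x * (\<phi> (x$1) * \<omega> (x$2)) - ?c * (u x * (\<phi>0 1 (x$1) * \<omega> (x$2)))" for x
        by (simp only: left_diff_distrib right_diff_distrib mult_ac)
      then show ?thesis using z[OF test[OF \<eta>(1) a(2)], of 1] by simp
    qed
    also have "\<dots> = I \<phi> \<omega> - ?c * I (\<phi>0 1) \<omega>"
      unfolding I_def using I_int[OF a] I_int[OF a0 a(2)]
      by (subst set_integral_diff) auto
    finally show ?thesis by simp
  qed
  have I2: "I \<phi> \<omega> = m 2 \<omega> / m 2 (\<phi>0 2) * I \<phi> (\<phi>0 2)" if a: "adm 1 \<phi>" "adm 2 \<omega>" for \<phi> \<omega>
  proof -
    let ?c = "m 2 \<omega> / m 2 (\<phi>0 2)"
    obtain \<eta> where \<eta>: "adm 2 \<eta>" "\<forall>t. (\<eta> has_real_derivative (\<omega> t - ?c * \<phi>0 2 t)) (at t)"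
      using reduce[OF a(2)] by blast
    obtain \<phi>' where \<phi>': "\<forall>t. (\<phi> has_real_derivative \<phi>' t) (at t)" using deriv[OF a(1)] by blast
    have "0 = (LINT x:\<Omega>|lebesgue. u x * (\<phi> (x$1) * \<omega> (x$2)) - ?c * (u x * (\<phi> (x$1) * \<phi>0 2 (x$2))))"
    proof -
      have "partial 2 (\<lambda>x. \<phi> (x$1) * \<eta> (x$2)) x = \<phi> (x$1) * (\<omega> (x$2) - ?c * \<phi>0 2 (x$2))" for x
        by (rule partial_product(2)[OF \<phi>'[rule_format] \<eta>(2)[rule_format]])
      then have "u x * partial 2 (\<lambda>x. \<phi> (x$1) * \<eta> (x$2)) x
          = u x * (\<phi> (x$1) * \<omega> (x$2)) - ?c * (u x * (\<phi> (x$1) * \<phi>0 2 (x$2)))" for x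
        by (simp only: left_diff_distrib right_diff_distrib mult_ac)
      then show ?thesis using z[OF test[OF a(1) \<eta>(1)], of 2] by simp
    qed
    also have "\<dots> = I \<phi> \<omega> - ?c * I \<phi> (\<phi>0 2)"
      unfolding I_def using I_int[OF a] I_int[OF a(1) a0]
      by (subst set_integral_diff) auto
    finally show ?thesis by simp
  qed
  \<comment> \<open>the mean of \<open>u\<close> with respect to the fixed bumps is the constant\<close>
  define C where "C = I (\<phi>0 1) (\<phi>0 2) / (m 1 (\<phi>0 1) * m 2 (\<phi>0 2))"
  have I: "I \<phi> \<omega> = m 1 \<phi> * m 2 \<omega> * C" if "adm 1 \<phi>" "adm 2 \<omega>" for \<phi> \<omega>
    using I1[OF that] I2[OF a0 that(2)] by (simp add: C_def)
  have "negligible {x \<in> box a b. u x - C \<noteq> 0}"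
  proof (rule negligible_nonzero_in_box)
    have ui: "u absolutely_integrable_on cbox c d" if "cbox c d \<subseteq> cbox a b" for c d
      using u ab that by (auto simp: locally_integrable_on_def)
    have ci: "(\<lambda>x::real^2. C) absolutely_integrable_on cbox c d" for c d
      by (intro absolutely_integrable_on_const) auto
    show "(\<lambda>x. u x - C) absolutely_integrable_on cbox a b"
      by (intro set_integral_diff ui ci) simp
    fix c d :: "real^2" assume cd: "cbox c d \<subseteq> cbox a b"
    show "(LINT x:box c d|lebesgue. u x - C) = 0"
    proof (cases "box c d = {}")
      case False
      then have lt: "c$i < d$i" for i using False unfolding ex_in_conv[symmetric] mem_box_cart by (meson less_trans)
      then have "c \<in> cbox c d" "d \<in> cbox c d" by (auto simp: mem_box_cart less_imp_le)
      then have "c \<in> cbox a b" "d \<in> cbox a b" using cd by auto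
      then have le: "a$i \<le> c$i" "d$i \<le> b$i" for i by (auto simp: mem_box_cart)
      let ?b = "\<lambda>n i. bump n (c$i) (d$i)"
      have admb: "adm i (?b n i)" for n i
        unfolding adm_def using smooth_bump bump_outside le[of i] by force
      have "I (?b n 1) (?b n 2) = m 1 (?b n 1) * m 2 (?b n 2) * C" for n by (rule I[OF admb admb])
      moreover have "(\<lambda>n. I (?b n 1) (?b n 2)) \<longlonglongrightarrow> (LINT x:box c d|lebesgue. u x)"
        unfolding I_def by (rule bump_product_pairing_tendsto[OF u]) (use cd ab in blast)
      moreover have "(\<lambda>n. m i (?b n i)) \<longlonglongrightarrow> d$i - c$i" for i
        unfolding m_def by (rule integral_bump_tendsto) (use lt[of i] le[of i] in auto)
      then have "(\<lambda>n. m 1 (?b n 1) * m 2 (?b n 2) * C) \<longlonglongrightarrow> (d$1 - c$1) * (d$2 - c$2) * C"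
        by (intro tendsto_intros)
      ultimately have L: "(LINT x:box c d|lebesgue. u x) = (d$1 - c$1) * (d$2 - c$2) * C"
        by (simp add: LIMSEQ_unique)
      have "cbox c d \<noteq> {}" using \<open>c \<in> cbox c d\<close> by blast
      then have "measure lborel (cbox c d) = (d$1 - c$1) * (d$2 - c$2)"
        by (simp add: content_cbox_cart UNIV_2)
      then have "measure lebesgue (box c d) = (d$1 - c$1) * (d$2 - c$2)"
        by (simp add: measure_lborel_box_eq measure_lborel_cbox_eq)
      then have "(LINT x:box c d|lebesgue. C) = (d$1 - c$1) * (d$2 - c$2) * C"
        by (simp add: set_lebesgue_integral_def)
      moreover have "(LINT x:box c d|lebesgue. u x - C) = (LINT x:box c d|lebesgue. u x) - (LINT x:box c d|lebesgue. C)"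
        by (intro set_integral_diff set_integrable_subset[OF ui[OF cd]] set_integrable_subset[OF ci[of c d]])
           (auto simp: box_subset_cbox)
      ultimately show ?thesis using L by simp
    qed (simp add: set_lebesgue_integral_def)
  qed
  then show ?thesis by auto
qed

text \<open>Every point has a box around it on which \<open>u\<close> is almost everywhere equal to a constant. The
  constants of overlapping boxes agree, since the overlap is not a null set, so the constant is a
  locally constant function of the point.\<close>

theorem weak_gradient_zero_imp_constant:
  fixes u :: "real^2 \<Rightarrow> real"
  assumes \<Omega>: "open \<Omega>" "connected \<Omega>" and w: "\<And>i. has_weak_partial \<Omega> i u (\<lambda>_. 0)"
  shows "\<exists>C. ae_eq \<Omega> u (\<lambda>_. C)"
proof -
  define good where "good x C a b \<longleftrightarrow> x \<in> box a b \<and> cbox a b \<subseteq> \<Omega> \<and> negligible {y \<in> box a b. u y \<noteq> C}"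
    for x C a b
  define C where "C x = (SOME C. \<exists>a b. good x C a b)" for x
  have good: "\<exists>a b. good x (C x) a b" if x: "x \<in> \<Omega>" for x
  proof -
    obtain a b where ab: "x \<in> box a b" "cbox a b \<subseteq> \<Omega>" using open_contains_cbox[OF \<Omega>(1) x] by metis
    then have "a$1 < b$1" "a$2 < b$2" unfolding mem_box_cart by (meson less_trans)+
    with ab weak_gradient_zero_box[OF w ab(2)] have "\<exists>C a b. good x C a b" unfolding good_def by blast
    then show ?thesis unfolding C_def by (rule someI_ex)
  qed
  have loc: "C x = C y" if x: "good x (C x) a b" and y: "y \<in> box a b" for x y a b
  proof -
    have "y \<in> \<Omega>" using x y box_subset_cbox unfolding good_def by blast
    then obtain c d where cd: "good y (C y) c d" using good by blast
    let ?U = "box a b \<inter> box c d"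
    let ?N = "{z \<in> box a b. u z \<noteq> C x} \<union> {z \<in> box c d. u z \<noteq> C y}"
    have "y \<in> ?U" using y cd by (simp add: good_def)
    then have "\<not> negligible ?U" by (intro open_not_negligible open_Int open_box) blast
    moreover have "negligible ?N" using x cd unfolding good_def by (intro negligible_Un) auto
    ultimately have "\<not> ?U \<subseteq> ?N" using negligible_subset by blast
    then show ?thesis by auto
  qed
  have eq: "C x = C y" if "x \<in> \<Omega>" "y \<in> \<Omega>" for x y
  proof (rule connected_local_const[OF \<Omega>(2) that], rule ballI)
    fix z assume z: "z \<in> \<Omega>"
    show "\<forall>\<^sub>F y in at z within \<Omega>. C z = C y"
    proof -
      obtain a b where ab: "good z (C z) a b" using good[OF z] by blast
      then have "z \<in> box a b" by (simp add: good_def)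
      then show ?thesis
        unfolding eventually_at_topological using loc[OF ab] by (intro exI[of _ "box a b"]) auto
    qed
  qed
  show ?thesis
  proof (cases "\<Omega> = {}")
    case True
    then show ?thesis using \<Omega> by (simp add: ae_eq_iff_negligible)
  next
    case False
    then obtain x0 where x0: "x0 \<in> \<Omega>" by blast
    have "negligible {x \<in> \<Omega>. u x \<noteq> C x0}"
    proof (rule negligible_locally_in_boxes)
      fix x assume x: "x \<in> \<Omega>"
      show "\<exists>a b. x \<in> box a b \<and> negligible {y \<in> box a b. u y \<noteq> C x0}"
        using good[OF x] unfolding good_def eq[OF x x0] by blast
    qed
    then show ?thesis using \<Omega> by (auto simp: ae_eq_iff_negligible)
  qed
qed

section \<open>Weak curl and weak divergence\<close>

lemma ae_eq_vecI:
  fixes v w :: "real^2 \<Rightarrow> real^2"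
  assumes "ae_eq E (\<lambda>x. v x $ 1) (\<lambda>x. w x $ 1)" "ae_eq E (\<lambda>x. v x $ 2) (\<lambda>x. w x $ 2)"
  shows "ae_eq E v w"
  using assms unfolding ae_eq_def by (auto elim: eventually_elim2 simp: vec_eq_iff forall_2)

lemma ae_eq_apply: "ae_eq E v w \<Longrightarrow> ae_eq E (\<lambda>x. F (v x)) (\<lambda>x. F (w x))"
  unfolding ae_eq_def by (auto elim: eventually_mono)

lemma has_weak_curl_cong_ae:
  assumes "has_weak_curl \<Omega> \<phi> v" "ae_eq \<Omega> \<phi> \<phi>'" "ae_eq \<Omega> v v'" "open \<Omega>"
  shows "has_weak_curl \<Omega> \<phi>' v'"
  using assms unfolding has_weak_curl_def
  by (auto intro: has_weak_partial_cong_ae ae_eq_apply[of _ v v'])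

lemma has_weak_curl_unique:
  assumes "open \<Omega>" "has_weak_curl \<Omega> \<phi> v" "has_weak_curl \<Omega> \<phi> w"
  shows "ae_eq \<Omega> v w"
proof (rule ae_eq_vecI)
  show "ae_eq \<Omega> (\<lambda>x. v x $ 1) (\<lambda>x. w x $ 1)"
    using assms has_weak_partial_unique unfolding has_weak_curl_def by blast
  have "ae_eq \<Omega> (\<lambda>x. - (v x $ 2)) (\<lambda>x. - (w x $ 2))"
    using assms has_weak_partial_unique unfolding has_weak_curl_def by blast
  from ae_eq_apply[OF this, of uminus] show "ae_eq \<Omega> (\<lambda>x. v x $ 2) (\<lambda>x. w x $ 2)" by simp
qed

lemma has_weak_curl_add:
  assumes "has_weak_curl \<Omega> \<phi> v" "has_weak_curl \<Omega> \<phi>' v'"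
  shows "has_weak_curl \<Omega> (\<lambda>x. \<phi> x + \<phi>' x) (\<lambda>x. v x + v' x)"
  using assms has_weak_partial_add[of \<Omega> 2 \<phi> _ \<phi>' _] has_weak_partial_add[of \<Omega> 1 \<phi> "\<lambda>x. - (v x $ 2)" \<phi>' "\<lambda>x. - (v' x $ 2)"]
  unfolding has_weak_curl_def by simp

lemma has_weak_curl_cmult:
  assumes "has_weak_curl \<Omega> \<phi> v"
  shows "has_weak_curl \<Omega> (\<lambda>x. c * \<phi> x) (\<lambda>x. c *\<^sub>R v x)"
  using assms has_weak_partial_cmult[of \<Omega> 2 \<phi> _ c] has_weak_partial_cmult[of \<Omega> 1 \<phi> "\<lambda>x. - (v x $ 2)" c]
  unfolding has_weak_curl_def by simp

lemma has_weak_curl_exists: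
  assumes "has_weak_partial \<Omega> 1 \<phi> g1" "has_weak_partial \<Omega> 2 \<phi> g2"
  shows "has_weak_curl \<Omega> \<phi> (\<lambda>x. vector [g2 x, - g1 x])"
  using assms by (simp add: has_weak_curl_def)

lemma has_weak_curl_zero_imp_constant:
  assumes "open \<Omega>" "connected \<Omega>" "has_weak_curl \<Omega> \<phi> (\<lambda>_. 0)"
  shows "\<exists>C. ae_eq \<Omega> \<phi> (\<lambda>_. C)"
proof (rule weak_gradient_zero_imp_constant[OF assms(1,2)])
  show "has_weak_partial \<Omega> i \<phi> (\<lambda>_. 0)" for i
    using assms(3) exhaust_2[of i] by (auto simp: has_weak_curl_def)
qed

lemma locally_integrable_vec_iff:
  fixes v :: "real^2 \<Rightarrow> real^2"
  shows "locally_integrable_on \<Omega> v \<longleftrightarrow> (\<forall>i. locally_integrable_on \<Omega> (\<lambda>x. v x $ i))"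
proof -
  have "v absolutely_integrable_on K \<longleftrightarrow> (\<forall>i. (\<lambda>x. v x $ i) absolutely_integrable_on K)" for K
    unfolding absolutely_integrable_componentwise_iff[where f = v]
    by (simp add: Basis_vec_def inner_axis)
  then show ?thesis unfolding locally_integrable_on_def by blast
qed

lemma weak_div_pairing:
  fixes v :: "real^2 \<Rightarrow> real^2"
  assumes v: "locally_integrable_on \<Omega> v" and t: "test_function \<Omega> \<psi>"
  shows "(LINT x:\<Omega>|lebesgue. (\<Sum>i\<in>UNIV. v x $ i * partial i \<psi> x)) =
    pairing \<Omega> (\<lambda>x. v x $ 1) (partial 1 \<psi>) + pairing \<Omega> (\<lambda>x. v x $ 2) (partial 2 \<psi>)"
  unfolding sum_2 using v unfolding locally_integrable_vec_iff
  by (intro set_integral_add set_integrable_pairing_test test_function_partial t) auto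

lemma has_weak_div_of_partials:
  assumes "has_weak_partial \<Omega> 1 (\<lambda>x. v x $ 1) g1" "has_weak_partial \<Omega> 2 (\<lambda>x. v x $ 2) g2"
  shows "has_weak_div \<Omega> v (\<lambda>x. g1 x + g2 x)"
proof -
  have v: "locally_integrable_on \<Omega> v"
    using has_weak_partial_integrable(1)[OF assms(1)] has_weak_partial_integrable(1)[OF assms(2)]
    by (simp add: locally_integrable_vec_iff forall_2)
  note g = has_weak_partial_integrable(2)[OF assms(1)] has_weak_partial_integrable(2)[OF assms(2)]
  show ?thesis
    unfolding has_weak_div_def
  proof (intro conjI allI impI v locally_integrable_add g)
    fix \<psi> assume t: "test_function \<Omega> \<psi>"
    have "(LINT x:\<Omega>|lebesgue. g1 x * \<psi> x + g2 x * \<psi> x)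
      = pairing \<Omega> g1 \<psi> + pairing \<Omega> g2 \<psi>"
      by (intro set_integral_add set_integrable_pairing_test t g)
    then show "(LINT x:\<Omega>|lebesgue. (\<Sum>i\<in>UNIV. v x $ i * partial i \<psi> x)) =
        - (LINT x:\<Omega>|lebesgue. (g1 x + g2 x) * \<psi> x)"
      unfolding weak_div_pairing[OF v t] distrib_right
      using has_weak_partialD[OF assms(1) t] has_weak_partialD[OF assms(2) t] by simp
  qed
qed

lemma has_weak_divD:
  assumes "has_weak_div \<Omega> v g" "test_function \<Omega> \<psi>"
  shows "pairing \<Omega> (\<lambda>x. v x $ 1) (partial 1 \<psi>) + pairing \<Omega> (\<lambda>x. v x $ 2) (partial 2 \<psi>)
     = - pairing \<Omega> g \<psi>"
proof -
  have "locally_integrable_on \<Omega> v" and "(LINT x:\<Omega>|lebesgue. (\<Sum>i\<in>UNIV. v x $ i * partial i \<psi> x)) = - pairing \<Omega> g \<psi>"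
    using assms unfolding has_weak_div_def by blast+
  then show ?thesis using weak_div_pairing[OF _ assms(2), of v] by simp
qed

lemma has_weak_divI:
  assumes "locally_integrable_on \<Omega> v" "locally_integrable_on \<Omega> g"
   "\<And>\<psi>. test_function \<Omega> \<psi> \<Longrightarrow>
     pairing \<Omega> (\<lambda>x. v x $ 1) (partial 1 \<psi>) + pairing \<Omega> (\<lambda>x. v x $ 2) (partial 2 \<psi>)
     = - pairing \<Omega> g \<psi>"
  shows "has_weak_div \<Omega> v g"
  using assms weak_div_pairing[OF assms(1)] unfolding has_weak_div_def by simp

lemma has_weak_div_integrable:
  assumes "has_weak_div \<Omega> v g"
  shows "locally_integrable_on \<Omega> v" "locally_integrable_on \<Omega> g" "locally_integrable_on \<Omega> (\<lambda>x. v x $ i)"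
  using assms locally_integrable_vec_iff[of \<Omega> v] unfolding has_weak_div_def by auto

lemma has_weak_div_cong_ae:
  assumes d: "has_weak_div \<Omega> v g" and "ae_eq \<Omega> v v'" "ae_eq \<Omega> g g'" "open \<Omega>"
  shows "has_weak_div \<Omega> v' g'"
proof (rule has_weak_divI)
  note l = has_weak_div_integrable[OF d]
  show "locally_integrable_on \<Omega> v'" "locally_integrable_on \<Omega> g'"
    using l assms locally_integrable_cong_ae by blast+
  fix \<psi> assume t: "test_function \<Omega> \<psi>"
  have "pairing \<Omega> (\<lambda>x. v x $ i) (partial i \<psi>) = pairing \<Omega> (\<lambda>x. v' x $ i) (partial i \<psi>)" for i
    by (intro pairing_cong_ae set_integrable_pairing_test l test_function_partial t assms
        ae_eq_apply[OF assms(2), of "\<lambda>z. z $ i"])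
  moreover have "pairing \<Omega> g \<psi> = pairing \<Omega> g' \<psi>"
    by (intro pairing_cong_ae set_integrable_pairing_test l t assms)
  ultimately show "pairing \<Omega> (\<lambda>x. v' x $ 1) (partial 1 \<psi>) + pairing \<Omega> (\<lambda>x. v' x $ 2) (partial 2 \<psi>)
     = - pairing \<Omega> g' \<psi>"
    using has_weak_divD[OF d t] by simp
qed

lemma has_weak_div_add:
  assumes d: "has_weak_div \<Omega> v g" and d': "has_weak_div \<Omega> v' g'"
  shows "has_weak_div \<Omega> (\<lambda>x. v x + v' x) (\<lambda>x. g x + g' x)"
proof (rule has_weak_divI)
  note l = has_weak_div_integrable[OF d] has_weak_div_integrable[OF d']
  show "locally_integrable_on \<Omega> (\<lambda>x. v x + v' x)" "locally_integrable_on \<Omega> (\<lambda>x. g x + g' x)"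
    using l by (auto intro: locally_integrable_add)
  fix \<psi> assume t: "test_function \<Omega> \<psi>"
  have split: "(LINT x:\<Omega>|lebesgue. (u x + w x) * \<theta> x) =
      pairing \<Omega> u \<theta> + pairing \<Omega> w \<theta>"
    if "locally_integrable_on \<Omega> u" "locally_integrable_on \<Omega> w" "test_function \<Omega> \<theta>" for u w \<theta> :: "real^2 \<Rightarrow> real"
    unfolding distrib_right using that by (intro set_integral_add set_integrable_pairing_test)
  show "(LINT x:\<Omega>|lebesgue. (v x + v' x) $ 1 * partial 1 \<psi> x) + (LINT x:\<Omega>|lebesgue. (v x + v' x) $ 2 * partial 2 \<psi> x)
     = - (LINT x:\<Omega>|lebesgue. (g x + g' x) * \<psi> x)"
    using has_weak_divD[OF d t] has_weak_divD[OF d' t]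
    by (simp add: split l t test_function_partial)
qed

lemma has_weak_div_unique:
  assumes "open \<Omega>" "has_weak_div \<Omega> v g" "has_weak_div \<Omega> v g'"
  shows "ae_eq \<Omega> g g'"
proof (rule ae_eq_of_pairings_eq[OF assms(1)])
  show "locally_integrable_on \<Omega> g" "locally_integrable_on \<Omega> g'"
    using assms has_weak_div_integrable by blast+
  show "pairing \<Omega> g \<psi> = pairing \<Omega> g' \<psi>" if "test_function \<Omega> \<psi>" for \<psi>
    using has_weak_divD[OF assms(2) that] has_weak_divD[OF assms(3) that] by simp
qed

text \<open>Here the derivatives fall on the test function twice, where they commute.\<close>

lemma has_weak_div_curl:
  assumes "has_weak_curl \<Omega> \<phi> v"
  shows "has_weak_div \<Omega> v (\<lambda>_. 0)"
proof (rule has_weak_divI)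
  have w: "has_weak_partial \<Omega> 2 \<phi> (\<lambda>x. v x $ 1)" "has_weak_partial \<Omega> 1 \<phi> (\<lambda>x. - (v x $ 2))"
    using assms by (auto simp: has_weak_curl_def)
  have "locally_integrable_on \<Omega> (\<lambda>x. v x $ 1)" "locally_integrable_on \<Omega> (\<lambda>x. (- 1) * - (v x $ 2))"
    using has_weak_partial_integrable(2)[OF w(1)] locally_integrable_cmult[OF has_weak_partial_integrable(2)[OF w(2)]] by blast+
  then show "locally_integrable_on \<Omega> v"
    by (simp add: locally_integrable_vec_iff forall_2)
  show "locally_integrable_on \<Omega> (\<lambda>_. 0 :: real)" by (intro locally_integrable_continuous continuous_on_const)
  fix \<psi> assume t: "test_function \<Omega> \<psi>"
  have "partial 2 (partial 1 \<psi>) = partial 1 (partial 2 \<psi>)"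
    using partial_commute[OF test_function_C_k[OF t]] by blast
  then show "pairing \<Omega> (\<lambda>x. v x $ 1) (partial 1 \<psi>) + pairing \<Omega> (\<lambda>x. v x $ 2) (partial 2 \<psi>)
     = - (LINT x:\<Omega>|lebesgue. 0 * \<psi> x)"
    using has_weak_partialD[OF w(1) test_function_partial[OF t], of 1] 
      has_weak_partialD[OF w(2) test_function_partial[OF t], of 2] 
    by (simp add: set_lebesgue_integral_def)
qed

section \<open>Polynomials in two variables\<close>

abbreviation mon :: "real \<Rightarrow> nat \<Rightarrow> nat \<Rightarrow> real^2 \<Rightarrow> real" where
  "mon c i j \<equiv> (\<lambda>x. c * (x $ 1) ^ i * (x $ 2) ^ j)"

lemma pointwise_sum_induct:
  assumes "finite A" "\<And>a. a \<in> A \<Longrightarrow> P (f a)" "\<And>f g. P f \<Longrightarrow> P g \<Longrightarrow> P (\<lambda>x. f x + g x)" "P (\<lambda>_. 0)"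
  shows "P (\<lambda>x. \<Sum>a\<in>A. f a x)"
  using assms(1,2) by (induction A rule: finite_induct) (use assms(3,4) in auto)

lemma polys_induct [consumes 1, case_names mon add zero]:
  assumes "p \<in> polys k" "\<And>c i j. i + j \<le> k \<Longrightarrow> P (mon c i j)"
    "\<And>f g. P f \<Longrightarrow> P g \<Longrightarrow> P (\<lambda>x. f x + g x)" "P (\<lambda>_. 0)"
  shows "P p"
proof -
  obtain c where p: "p = (\<lambda>x. \<Sum>i\<le>k. \<Sum>j\<le>k - i. mon (c i j) i j x)"
    using assms(1) by (auto simp: polys_def)
  show ?thesis unfolding p
    by (intro pointwise_sum_induct[where P = P] assms finite_atMost) auto
qed

lemma polys_add: "f \<in> polys k \<Longrightarrow> g \<in> polys k \<Longrightarrow> (\<lambda>x. f x + g x) \<in> polys k"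
proof -
  assume "f \<in> polys k" "g \<in> polys k"
  then obtain c d where "f = (\<lambda>x. \<Sum>i\<le>k. \<Sum>j\<le>k - i. mon (c i j) i j x)"
    "g = (\<lambda>x. \<Sum>i\<le>k. \<Sum>j\<le>k - i. mon (d i j) i j x)"
    by (auto simp: polys_def)
  then have "(\<lambda>x. f x + g x) = (\<lambda>x. \<Sum>i\<le>k. \<Sum>j\<le>k - i. mon (c i j + d i j) i j x)"
    by (simp add: distrib_right sum.distrib)
  then show ?thesis unfolding polys_def by (intro CollectI exI[of _ "\<lambda>i j. c i j + d i j"]) simp
qed

lemma polys_mon: "i + j \<le> k \<Longrightarrow> mon c i j \<in> polys k"
proof -
  assume ij: "i + j \<le> k"
  let ?c = "\<lambda>i' j'. if i' = i then if j' = j then c else 0 else 0"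
  have inner: "(\<Sum>j'\<le>k - i'. mon (?c i' j') i' j' x) = (if i' = i then mon c i j x else 0)" for x i'
  proof (cases "i' = i")
    case True
    have "(\<Sum>j'\<le>k - i. mon (?c i j') i j' x) = (\<Sum>j'\<le>k - i. if j' = j then mon c i j x else 0)"
      by (rule sum.cong) auto
    also have "\<dots> = mon c i j x" using ij by simp
    finally show ?thesis using True by simp
  qed simp
  have "mon c i j x = (\<Sum>i'\<le>k. \<Sum>j'\<le>k - i'. mon (?c i' j') i' j' x)" for x
    unfolding inner using ij by simp
  then have "mon c i j = (\<lambda>x. \<Sum>i'\<le>k. \<Sum>j'\<le>k - i'. mon (?c i' j') i' j' x)" by blast
  then show ?thesis unfolding polys_def by (intro CollectI exI[of _ ?c]) simp
qed

lemma polys_zero: "(\<lambda>_. 0) \<in> polys k"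
  using polys_mon[of 0 0 k 0] by simp

lemma polys_const: "(\<lambda>_. c) \<in> polys k"
  using polys_mon[of 0 0 k c] by simp

lemma polys_mono: "k \<le> m \<Longrightarrow> p \<in> polys k \<Longrightarrow> p \<in> polys m"
  by (rotate_tac, induction p rule: polys_induct) (auto intro: polys_mon polys_add polys_zero)

lemma polys_cmult: "p \<in> polys k \<Longrightarrow> (\<lambda>x. c * p x) \<in> polys k"
proof (induction p rule: polys_induct)
  case (mon d i j)
  then show ?case using polys_mon[of i j k "c * d"] by (simp add: mult.assoc)
qed (auto intro: polys_add polys_zero simp: distrib_left)

lemma C_k_polys: "p \<in> polys m \<Longrightarrow> C_k k p"
  by (induction p rule: polys_induct) (auto intro!: C_k_mult C_k_add C_k_const C_k_power C_k_component)

lemma partial_add: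
  assumes "C_k 1 f" "C_k 1 g"
  shows "partial i (\<lambda>x. f x + g x) = (\<lambda>x. partial i f x + partial i g x)"
  using assms partial_eqI[OF has_derivative_add[OF C_k_Suc_has_derivative[of 0 f] C_k_Suc_has_derivative[of 0 g]]]
  by (auto simp: partial_def)

lemma partial_mult:
  assumes "C_k 1 f" "C_k 1 g"
  shows "partial i (\<lambda>x. f x * g x) = (\<lambda>x. f x * partial i g x + partial i f x * g x)"
  using assms partial_eqI[OF has_derivative_mult[OF C_k_Suc_has_derivative[of 0 f] C_k_Suc_has_derivative[of 0 g]]]
  by (auto simp: partial_def)

lemma partial_add_polys:
  assumes "f \<in> polys m" "g \<in> polys n"
  shows "partial i (\<lambda>x. f x + g x) = (\<lambda>x. partial i f x + partial i g x)"
  by (intro partial_add C_k_polys[OF assms(1)] C_k_polys[OF assms(2)])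

lemma partial_const: "partial i (\<lambda>_. c) = (\<lambda>_. 0)"
  using partial_eqI[OF has_derivative_const[of c]] by auto

lemma partial_cmult:
  assumes "C_k 1 f"
  shows "partial i (\<lambda>x. c * f x) = (\<lambda>x. c * partial i f x)"
  using partial_mult[OF C_k_const[of 1 c] assms, of i] by (simp add: partial_const)

lemma partial_component: "partial i (\<lambda>x. x $ j) = (\<lambda>_. if i = j then 1 else 0)"
  by (rule ext, subst partial_eqI[OF bounded_linear_imp_has_derivative[OF bounded_linear_vec_nth]]) (simp add: axis_def)

lemma partial_mon:
  "partial 1 (mon c i j) = mon (c * real i) (i - 1) j"
  "partial 2 (mon c i j) = mon (c * real j) i (j - 1)"
proof -
  have "partial 1 (\<lambda>x. (\<lambda>t. c * t ^ i) (x $ 1) * (\<lambda>t. t ^ j) (x $ 2)) x = c * (real i * x $ 1 ^ (i - 1)) * x $ 2 ^ j" for x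
    by (rule partial_product(1)[where \<omega>' = "\<lambda>t. real j * t ^ (j - 1)"]) (auto intro!: derivative_eq_intros)
  then show "partial 1 (mon c i j) = mon (c * real i) (i - 1) j" by (auto simp: mult_ac)
  have "partial 2 (\<lambda>x. (\<lambda>t. c * t ^ i) (x $ 1) * (\<lambda>t. t ^ j) (x $ 2)) x = c * x $ 1 ^ i * (real j * x $ 2 ^ (j - 1))" for x
    by (rule partial_product(2)[where \<phi>' = "\<lambda>t. c * (real i * t ^ (i - 1))"]) (auto intro!: derivative_eq_intros)
  then show "partial 2 (mon c i j) = mon (c * real j) i (j - 1)" by (auto simp: mult_ac)
qed

lemma partial_polys: "p \<in> polys k \<Longrightarrow> partial i p \<in> polys (k - 1)"
proof -
  assume "p \<in> polys k"
  then have "C_k 1 p \<and> partial 1 p \<in> polys (k - 1) \<and> partial 2 p \<in> polys (k - 1)"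
  proof (induction p rule: polys_induct)
    case (mon c i j)
    have "C_k 1 (mon c i j)" using mon C_k_polys polys_mon by blast
    moreover have "mon (c * real i) (i - 1) j \<in> polys (k - 1)"
      by (cases i) (use mon polys_zero in \<open>auto intro!: polys_mon\<close>)
    moreover have "mon (c * real j) i (j - 1) \<in> polys (k - 1)"
      by (cases j) (use mon polys_zero in \<open>auto intro!: polys_mon\<close>)
    ultimately show ?case by (simp add: partial_mon)
  next
    case (add f g)
    then show ?case using C_k_add[of 1 f g] partial_add[of f g] polys_add by auto
  next
    case zero
    then show ?case using C_k_const[of 1 0] by (auto simp: partial_const polys_zero)
  qed
  then show ?thesis using exhaust_2[of i] by auto
qed

lemma polys_antiderivative: "p \<in> polys k \<Longrightarrow> \<exists>q\<in>polys (Suc k). partial i q = p"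
proof (induction p rule: polys_induct)
  case (mon c a b)
  have "partial 1 (mon (c / (real a + 1)) (Suc a) b) = mon c a b"
    "partial 2 (mon (c / (real b + 1)) a (Suc b)) = mon c a b"
    unfolding partial_mon by (auto simp: field_simps)
  moreover have "mon (c / (real a + 1)) (Suc a) b \<in> polys (Suc k)" "mon (c / (real b + 1)) a (Suc b) \<in> polys (Suc k)"
    using mon by (intro polys_mon, simp)+
  moreover consider "i = 1" | "i = 2" using exhaust_2[of i] by blast
  ultimately show ?case by cases blast+
next
  case (add f g)
  then obtain F G where "F \<in> polys (Suc k)" "partial i F = f" "G \<in> polys (Suc k)" "partial i G = g" by blast
  then show ?case by (intro bexI[of _ "\<lambda>x. F x + G x"]) (auto simp: partial_add_polys intro: polys_add)
next
  case zero
  then show ?case by (intro bexI[of _ "\<lambda>_. 0"]) (auto simp: partial_const polys_zero)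
qed

definition onto_first_axis :: "real^2 \<Rightarrow> real^2" where
  "onto_first_axis x = vector [x $ 1, 0]"

lemma polys_onto_first_axis:
  assumes "p \<in> polys k"
  shows "(\<lambda>x. p (onto_first_axis x)) \<in> polys k" "partial 1 (\<lambda>x. p (onto_first_axis x)) = (\<lambda>x. partial 1 p (onto_first_axis x))"
    "partial 2 (\<lambda>x. p (onto_first_axis x)) = (\<lambda>_. 0)"
proof -
  have "p \<in> polys k \<and> (\<lambda>x. p (onto_first_axis x)) \<in> polys k \<and>
   partial 1 (\<lambda>x. p (onto_first_axis x)) = (\<lambda>x. partial 1 p (onto_first_axis x)) \<and> partial 2 (\<lambda>x. p (onto_first_axis x)) = (\<lambda>_. 0)"
    using assms
  proof (induction p rule: polys_induct)
    case (mon c i j)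
    have e: "(\<lambda>x. mon c i j (onto_first_axis x)) = mon (if j = 0 then c else 0) i 0"
      by (auto simp: onto_first_axis_def)
    have "mon (if j = 0 then c else 0) i 0 \<in> polys k" using mon by (intro polys_mon) simp
    then show ?case unfolding e partial_mon by (auto simp: onto_first_axis_def intro: polys_mon[OF mon])
  next
    case (add f g)
    then have "partial i (\<lambda>x. f x + g x) = (\<lambda>x. partial i f x + partial i g x)"
      "partial i (\<lambda>x. f (onto_first_axis x) + g (onto_first_axis x)) = (\<lambda>x. partial i (\<lambda>x. f (onto_first_axis x)) x + partial i (\<lambda>x. g (onto_first_axis x)) x)" for i
      using partial_add_polys by blast+
    then show ?case using add by (auto intro: polys_add)
  next
    case zero
    then show ?case by (simp add: polys_zero partial_const)
  qed
  then show "(\<lambda>x. p (onto_first_axis x)) \<in> polys k" "partial 1 (\<lambda>x. p (onto_first_axis x)) = (\<lambda>x. partial 1 p (onto_first_axis x))"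
    "partial 2 (\<lambda>x. p (onto_first_axis x)) = (\<lambda>_. 0)" by blast+
qed

text \<open>The line through \<open>x\<close> in the second direction meets the first axis in \<open>onto_first_axis x\<close>.\<close>

lemma constant_along_second_axis:
  assumes "C_k 1 f" "partial 2 f = (\<lambda>_. 0)"
  shows "f x = f (onto_first_axis x)"
proof -
  have "((\<lambda>t. f (onto_first_axis x + t *\<^sub>R axis 2 1)) has_real_derivative 0) (at t)" for t
    using C_k_has_partial_line[of 0 f "onto_first_axis x" 2 t] assms by (simp add: assms(2))
  then have "f (onto_first_axis x + (x $ 2) *\<^sub>R axis 2 1) = f (onto_first_axis x + 0 *\<^sub>R axis 2 1)"
    by (intro DERIV_isconst_all) blast
  moreover have "onto_first_axis x + (x $ 2) *\<^sub>R axis 2 1 = x"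
    by (simp add: vec_eq_iff forall_2 onto_first_axis_def axis_def)
  ultimately show ?thesis by simp
qed

text \<open>Integrate \<open>w1\<close> in the second variable to get \<open>q\<close>. The vanishing divergence makes the error
  \<open>w2 + \<partial>\<^sub>1 q\<close> independent of the second variable, so it can be corrected by a function of the first
  variable, which is obtained by restricting an antiderivative to the first axis.\<close>

lemma polys_potential:
  assumes w: "w1 \<in> polys k" "w2 \<in> polys k" and d: "\<And>x. partial 1 w1 x + partial 2 w2 x = 0"
  shows "\<exists>p\<in>polys (Suc k). partial 2 p = w1 \<and> (\<forall>x. - partial 1 p x = w2 x)"
proof -
  obtain q where q: "q \<in> polys (Suc k)" "partial 2 q = w1" using polys_antiderivative[OF w(1)] by blast
  \<comment> \<open>the error of \<open>- \<partial>\<^sub>1 q\<close> as the second component\<close>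
  define f where "f x = w2 x + partial 1 q x" for x
  have f: "f \<in> polys k" unfolding f_def[abs_def] using polys_add w(2) partial_polys[OF q(1), of 1] by simp
  have "partial 2 f = (\<lambda>x. partial 2 w2 x + partial 2 (partial 1 q) x)"
    unfolding f_def[abs_def] using w(2) partial_polys[OF q(1), of 1] by (rule partial_add_polys)
  moreover have "partial 2 (partial 1 q) x = partial 1 w1 x" for x
    using partial_commute[OF C_k_polys[OF q(1)], of 2 1] q(2) by simp
  ultimately have f0: "partial 2 f = (\<lambda>_. 0)" using d by (auto simp: add.commute)
  obtain g where g: "g \<in> polys (Suc k)" "partial 1 g = f" using polys_antiderivative[OF f] by blast
  define h where "h x = (- 1) * g (onto_first_axis x)" for x
  note gf = polys_onto_first_axis[OF g(1)]
  have h: "h \<in> polys (Suc k)" unfolding h_def[abs_def] using gf polys_cmult by blast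
  have hp: "partial i h = (\<lambda>x. (- 1) * partial i (\<lambda>x. g (onto_first_axis x)) x)" for i
    unfolding h_def[abs_def] by (rule partial_cmult) (use gf C_k_polys in blast)
  have "f x = f (onto_first_axis x)" for x by (rule constant_along_second_axis[OF C_k_polys[OF f] f0])
  then have h1: "partial 1 h = (\<lambda>x. - f x)" and h2: "partial 2 h = (\<lambda>_. 0)"
    unfolding hp using gf g(2) by auto
  let ?p = "\<lambda>x. q x + h x"
  have pp: "partial i ?p = (\<lambda>x. partial i q x + partial i h x)" for i
    by (rule partial_add[OF C_k_polys[OF q(1)] C_k_polys[OF h]])
  show ?thesis
  proof (intro bexI[of _ ?p] conjI allI)
    show "?p \<in> polys (Suc k)" using q h polys_add by blast
    show "partial 2 ?p = w1" unfolding pp h2 q(2) by simp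
    show "- partial 1 ?p x = w2 x" for x unfolding pp h1 f_def by simp
  qed
qed

lemma coeff_mult_top:
  fixes p q :: "real poly"
  assumes "degree p \<le> m" "degree q \<le> n"
  shows "coeff (p * q) (m + n) = coeff p m * coeff q n"
proof -
  have "coeff (p * q) (m + n) = (\<Sum>i\<le>m + n. coeff p i * coeff q (m + n - i))" by (rule coeff_mult)
  also have "\<dots> = (\<Sum>i\<le>m + n. if i = m then coeff p m * coeff q n else 0)"
  proof (rule sum.cong[OF refl])
    fix i assume "i \<in> {..m + n}"
    show "coeff p i * coeff q (m + n - i) = (if i = m then coeff p m * coeff q n else 0)"
    proof (cases i m rule: linorder_cases)
      case less
      then have "coeff q (m + n - i) = 0" using assms by (intro coeff_eq_0) simp
      then show ?thesis using less by simp
    next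
      case greater
      then have "coeff p i = 0" using assms by (intro coeff_eq_0) simp
      then show ?thesis using greater by simp
    qed simp
  qed
  also have "\<dots> = coeff p m * coeff q n" by simp
  finally show ?thesis .
qed

lemma linear_power_top:
  fixes a b :: real
  shows "degree ([:a, b:] ^ n) \<le> n \<and> coeff ([:a, b:] ^ n) n = b ^ n"
proof (induction n)
  case (Suc n)
  have d: "degree [:a, b:] \<le> 1" by simp
  have "degree ([:a, b:] * [:a, b:] ^ n) \<le> 1 + n"
    using degree_mult_le[of "[:a, b:]" "[:a, b:] ^ n"] d Suc by linarith
  moreover have "coeff ([:a, b:] * [:a, b:] ^ n) (1 + n) = coeff [:a, b:] 1 * coeff ([:a, b:] ^ n) n"
    by (rule coeff_mult_top) (use d Suc in auto)
  ultimately show ?case using Suc by (simp del: mult_pCons_left)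
qed simp

text \<open>The coefficient of \<open>t\<^sup>k\<close> along the line \<open>a + t v\<close> is the value at \<open>v\<close> of the homogeneous part of degree
  \<open>k\<close>: it does not depend on \<open>a\<close> and is homogeneous in \<open>v\<close>.\<close>

lemma polys_on_lines:
  assumes "p \<in> polys k"
  shows "\<exists>L. (\<forall>\<kappa> v. L (\<kappa> *\<^sub>R v) = \<kappa> ^ k * L v) \<and>
    (\<forall>a v. \<exists>P. degree P \<le> k \<and> coeff P k = L v \<and> (\<forall>t. p (a + t *\<^sub>R v) = poly P t))"
  using assms
proof (induction p rule: polys_induct)
  case (mon c i j)
  define L where "L v = (if i + j = k then mon c i j v else 0)" for v
  have "\<exists>P. degree P \<le> k \<and> coeff P k = L v \<and> (\<forall>t. mon c i j (a + t *\<^sub>R v) = poly P t)" for a v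
  proof -
    let ?A = "[:a $ 1, v $ 1:] ^ i" and ?B = "[:a $ 2, v $ 2:] ^ j"
    \<comment> \<open>the factors are linear powers in \<open>t\<close>, so only for \<open>i + j = k\<close> is there a term of degree \<open>k\<close>\<close>
    let ?P = "smult c (?A * ?B)"
    have d: "degree ?A \<le> i" "degree ?B \<le> j" and l: "coeff ?A i = v $ 1 ^ i" "coeff ?B j = v $ 2 ^ j"
      using linear_power_top by blast+
    have dp: "degree ?P \<le> i + j"
      using degree_smult_le[of c "?A * ?B"] degree_mult_le[of ?A ?B] d by linarith
    have "coeff ?P (i + j) = mon c i j v" using coeff_mult_top[OF d] l by simp
    then have "coeff ?P k = L v"
      using mon dp by (auto simp: L_def intro!: coeff_eq_0)
    moreover have "mon c i j (a + t *\<^sub>R v) = poly ?P t" for t by (simp add: mult.assoc)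
    ultimately show ?thesis using dp mon by (intro exI[of _ ?P]) auto
  qed
  moreover have "L (\<kappa> *\<^sub>R v) = \<kappa> ^ k * L v" for \<kappa> v
    by (auto simp: L_def power_mult_distrib power_add)
  ultimately show ?case by blast
next
  case (add f g)
  then obtain L M where
    L: "\<And>\<kappa> v. L (\<kappa> *\<^sub>R v) = \<kappa> ^ k * L v"
       "\<And>a v. \<exists>P. degree P \<le> k \<and> coeff P k = L v \<and> (\<forall>t. f (a + t *\<^sub>R v) = poly P t)" and
    M: "\<And>\<kappa> v. M (\<kappa> *\<^sub>R v) = \<kappa> ^ k * M v"
       "\<And>a v. \<exists>P. degree P \<le> k \<and> coeff P k = M v \<and> (\<forall>t. g (a + t *\<^sub>R v) = poly P t)"
    by blast
  have "\<exists>P. degree P \<le> k \<and> coeff P k = L v + M v \<and> (\<forall>t. f (a + t *\<^sub>R v) + g (a + t *\<^sub>R v) = poly P t)" for a v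
  proof -
    obtain P Q where "degree P \<le> k" "coeff P k = L v" "\<forall>t. f (a + t *\<^sub>R v) = poly P t"
      "degree Q \<le> k" "coeff Q k = M v" "\<forall>t. g (a + t *\<^sub>R v) = poly Q t"
      using L(2)[of v a] M(2)[of v a] by blast
    then show ?thesis by (intro exI[of _ "P + Q"]) (auto intro: degree_add_le)
  qed
  then show ?case using L(1) M(1) by (intro exI[of _ "\<lambda>v. L v + M v"]) (auto simp: distrib_left)
next
  case zero
  show ?case by (intro exI[of _ "\<lambda>v. 0"]) (auto intro!: exI[of _ 0])
qed

lemma poly_zero_of_zeros_on_interval:
  fixes P :: "real poly"
  assumes "a < b" "\<And>t. a < t \<Longrightarrow> t < b \<Longrightarrow> poly P t = 0"
  shows "P = 0"
proof (rule ccontr)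
  assume "P \<noteq> 0"
  then have "finite {t. poly P t = 0}" by (rule poly_roots_finite)
  moreover have "{a<..<b} \<subseteq> {t. poly P t = 0}" using assms by auto
  ultimately have "finite {a<..<b}" by (rule finite_subset[rotated])
  then show False using infinite_Ioo[OF assms(1)] by blast
qed

lemma polys_zero_of_zero_on_open:
  assumes p: "p \<in> polys k" and U: "open U" "x0 \<in> U" and z: "\<And>x. x \<in> U \<Longrightarrow> p x = 0"
  shows "p y = 0"
proof -
  obtain P where P: "\<And>t. p (x0 + t *\<^sub>R (y - x0)) = poly P t" using polys_on_lines[OF p] by blast
  have "isCont (\<lambda>t. x0 + t *\<^sub>R (y - x0)) 0" by (intro continuous_intros)
  then have "((\<lambda>t. x0 + t *\<^sub>R (y - x0)) \<longlongrightarrow> x0) (at 0)" by (simp add: isCont_def)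
  then have "\<forall>\<^sub>F t in at (0::real). x0 + t *\<^sub>R (y - x0) \<in> U" using U by (rule topological_tendstoD)
  then obtain d :: real where d: "d > 0" "\<And>t. t \<noteq> 0 \<Longrightarrow> dist t 0 < d \<Longrightarrow> x0 + t *\<^sub>R (y - x0) \<in> U"
    unfolding eventually_at by auto
  have "P = 0"
    by (rule poly_zero_of_zeros_on_interval[OF d(1)]) (use d(2) z P in \<open>auto simp flip: P\<close>)
  then have "p (x0 + 1 *\<^sub>R (y - x0)) = 0" unfolding P by simp
  then show ?thesis by simp
qed

text \<open>Along lines through the origin, \<open>h\<close> contributes only to the coefficient of \<open>t\<^sup>n\<close>, and \<open>q\<close> does not reach it.\<close>

lemma homogeneous_zero_of_lower_degree:
  assumes q: "q \<in> polys m" and h: "\<And>t x. h (t *\<^sub>R x) = t ^ n * h x" and mn: "m < n"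
    and e: "\<And>x. q x + h x = 0"
  shows "h x = 0"
proof -
  obtain P where P: "degree P \<le> m" "\<And>t. q (0 + t *\<^sub>R x) = poly P t" using polys_on_lines[OF q] by blast
  have "poly (P + monom (h x) n) t = 0" for t
    using e[of "t *\<^sub>R x"] P(2)[of t] by (simp add: poly_monom h mult.commute)
  then have "P + monom (h x) n = 0" unfolding poly_all_0_iff_0[symmetric] by blast
  then have "coeff (P + monom (h x) n) n = 0" by simp
  moreover have "coeff P n = 0" using P(1) mn by (intro coeff_eq_0) simp
  ultimately show ?thesis by simp
qed

lemma hom_polys_induct [consumes 1, case_names mon add zero]:
  assumes "p \<in> hom_polys k" "\<And>c i. i \<le> k \<Longrightarrow> P (mon c i (k - i))"
    "\<And>f g. P f \<Longrightarrow> P g \<Longrightarrow> P (\<lambda>x. f x + g x)" "P (\<lambda>_. 0)"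
  shows "P p"
proof -
  obtain c where p: "p = (\<lambda>x. \<Sum>i\<le>k. mon (c i) i (k - i) x)"
    using assms(1) by (auto simp: hom_polys_def)
  show ?thesis unfolding p
    by (intro pointwise_sum_induct[where P = P] assms finite_atMost) auto
qed

lemma hom_polys_subset: "h \<in> hom_polys k \<Longrightarrow> h \<in> polys k"
  by (induction h rule: hom_polys_induct) (auto intro: polys_mon polys_add polys_zero)

lemma hom_polys_scale: "h \<in> hom_polys k \<Longrightarrow> h (t *\<^sub>R x) = t ^ k * h x"
proof (induction h rule: hom_polys_induct)
  case (mon c i)
  then have "t ^ k = t ^ i * t ^ (k - i)" by (simp flip: power_add)
  then show ?case by (simp add: power_mult_distrib)
qed (auto simp: distrib_left)

lemma hom_polys_add: "f \<in> hom_polys k \<Longrightarrow> g \<in> hom_polys k \<Longrightarrow> (\<lambda>x. f x + g x) \<in> hom_polys k"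
proof -
  assume "f \<in> hom_polys k" "g \<in> hom_polys k"
  then obtain c d where "f = (\<lambda>x. \<Sum>i\<le>k. mon (c i) i (k - i) x)" "g = (\<lambda>x. \<Sum>i\<le>k. mon (d i) i (k - i) x)"
    by (auto simp: hom_polys_def)
  then have "(\<lambda>x. f x + g x) = (\<lambda>x. \<Sum>i\<le>k. mon (c i + d i) i (k - i) x)"
    by (simp add: distrib_right sum.distrib)
  then show ?thesis unfolding hom_polys_def by (intro CollectI exI[of _ "\<lambda>i. c i + d i"]) simp
qed

lemma hom_polys_zero: "(\<lambda>_. 0) \<in> hom_polys k"
  unfolding hom_polys_def by (intro CollectI exI[of _ "\<lambda>i. 0"]) simp

lemma hom_polys_mon:
  assumes "i \<le> k"
  shows "mon c i (k - i) \<in> hom_polys k"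
proof -
  have "(\<Sum>i'\<le>k. mon (if i' = i then c else 0) i' (k - i') x) = (\<Sum>i'\<le>k. if i' = i then mon c i (k - i) x else 0)" for x
    by (rule sum.cong) auto
  then have "mon c i (k - i) = (\<lambda>x. \<Sum>i'\<le>k. mon (if i' = i then c else 0) i' (k - i') x)"
    using assms by simp
  then show ?thesis unfolding hom_polys_def by (intro CollectI exI[of _ "\<lambda>i'. if i' = i then c else 0"]) simp
qed

lemma hom_polys_cmult: "h \<in> hom_polys k \<Longrightarrow> (\<lambda>x. c * h x) \<in> hom_polys k"
proof (induction h rule: hom_polys_induct)
  case (mon d i)
  then show ?case using hom_polys_mon[of i k "c * d"] by (simp add: mult.assoc)
qed (auto simp: distrib_left intro: hom_polys_add hom_polys_zero)

lemma polys_split_top: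
  assumes "p \<in> polys (Suc k)"
  shows "\<exists>q\<in>polys k. \<exists>h\<in>hom_polys (Suc k). p = (\<lambda>x. q x + h x)"
  using assms
proof (induction p rule: polys_induct)
  case (mon c i j)
  show ?case
  proof (cases "i + j = Suc k")
    case True
    then have "j = Suc k - i" "i \<le> Suc k" by auto
    then have "mon c i j \<in> hom_polys (Suc k)" using hom_polys_mon by blast
    then show ?thesis using polys_zero by (intro bexI[of _ "\<lambda>_. 0"] bexI[of _ "mon c i j"]) auto
  next
    case False
    then have "mon c i j \<in> polys k" using mon by (intro polys_mon) simp
    then show ?thesis using hom_polys_zero by (intro bexI[of _ "mon c i j"] bexI[of _ "\<lambda>_. 0"]) auto
  qed
next
  case (add f g)
  then obtain q h q' h' where "q \<in> polys k" "h \<in> hom_polys (Suc k)" "f = (\<lambda>x. q x + h x)"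
    "q' \<in> polys k" "h' \<in> hom_polys (Suc k)" "g = (\<lambda>x. q' x + h' x)" by blast
  then show ?case
    by (intro bexI[of _ "\<lambda>x. q x + q' x"] bexI[of _ "\<lambda>x. h x + h' x"]) (auto intro: polys_add hom_polys_add)
next
  case zero
  then show ?case using polys_zero hom_polys_zero by (intro bexI[of _ "\<lambda>_. 0"] bexI[of _ "\<lambda>_. 0"]) auto
qed

lemma euler_homogeneous:
  assumes "h \<in> hom_polys k"
  shows "x $ 1 * partial 1 h x + x $ 2 * partial 2 h x = real k * h x"
proof -
  have "C_k 1 h \<and> x $ 1 * partial 1 h x + x $ 2 * partial 2 h x = real k * h x"
    using assms
  proof (induction h rule: hom_polys_induct)
    case (mon c i)
    have "C_k 1 (mon c i (k - i))" using mon by (intro C_k_polys[of _ k] polys_mon) simp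
    moreover have "x $ 1 * (c * real i * x $ 1 ^ (i - 1) * x $ 2 ^ (k - i)) = real i * mon c i (k - i) x"
      by (cases i) auto
    moreover have "x $ 2 * (c * real (k - i) * x $ 1 ^ i * x $ 2 ^ (k - i - 1)) = real (k - i) * mon c i (k - i) x"
      by (cases "k - i") auto
    ultimately show ?case using mon by (simp only: partial_mon) (simp add: of_nat_diff algebra_simps)
  next
    case (add f g)
    then have "C_k 1 (\<lambda>x. f x + g x)" using C_k_add by blast
    with add show ?case by (simp add: partial_add distrib_left)
  next
    case zero
    have "C_k 1 (\<lambda>_. 0)" by (rule C_k_const)
    then show ?case by (simp add: partial_const)
  qed
  then show ?thesis by blast
qed

section \<open>The sides of a convex quadrilateral\<close>

text \<open>The point of the plane with \<open>i\<close>-th coordinate \<open>s\<close> and other coordinate \<open>t\<close>. With it each argument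
  about a pair of opposite sides covers both pairs at once.\<close>

definition pt :: "2 \<Rightarrow> real \<Rightarrow> real \<Rightarrow> real^2" where
  "pt i s t = (\<chi> k. if k = i then s else t)"

lemma pt_component: "pt i s t $ k = (if k = i then s else t)"
  by (simp add: pt_def)

lemma pt_exhaust: "\<exists>t. x = pt i (x $ i) t"
  using exhaust_2[of i] by (auto simp: vec_eq_iff pt_component forall_2)

lemma mem_ref_square: "x \<in> ref_square \<longleftrightarrow> \<bar>x $ 1\<bar> \<le> 1 \<and> \<bar>x $ 2\<bar> \<le> 1"
  by (auto simp: ref_square_def mem_box_cart forall_2 abs_le_iff)

lemma pt_in_ref_square: "pt i s t \<in> ref_square \<longleftrightarrow> \<bar>s\<bar> \<le> 1 \<and> \<bar>t\<bar> \<le> 1"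
  using exhaust_2[of i] by (auto simp: mem_ref_square pt_component)

lemma ref_side_eq:
  assumes "\<bar>s\<bar> \<le> 1"
  shows "{x \<in> ref_square. x $ i = s} = pt i s ` {-1..1}"
proof
  show "{x \<in> ref_square. x $ i = s} \<subseteq> pt i s ` {-1..1}"
  proof
    fix x assume x: "x \<in> {x \<in> ref_square. x $ i = s}"
    then obtain t where t: "x = pt i s t" using pt_exhaust[of x i] by auto
    with x have "\<bar>t\<bar> \<le> 1" using pt_in_ref_square by auto
    then show "x \<in> pt i s ` {-1..1}" using t by (auto simp: abs_le_iff)
  qed
  show "pt i s ` {-1..1} \<subseteq> {x \<in> ref_square. x $ i = s}"
    using assms by (auto simp: pt_in_ref_square pt_component abs_le_iff)
qed

lemma side_eq: "\<bar>s\<bar> \<le> 1 \<Longrightarrow> side F i s = (\<lambda>t. F (pt i s t)) ` {-1..1}"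
  by (simp add: side_def ref_side_eq image_image)

text \<open>A bilinear map takes edges to edges, so the sides of the reference square have to be recognised
  as faces of dimension one.\<close>

lemma ref_side_edge:
  assumes s: "s = -1 \<or> s = 1"
  shows "{x \<in> ref_square. x $ i = s} edge_of ref_square"
proof -
  have c: "convex ref_square" by (simp add: ref_square_def)
  have i: "axis i 1 \<bullet> x = x $ i" for x :: "real^2" by (simp add: inner_axis' )
  have b: "\<bar>x $ i\<bar> \<le> 1" if "x \<in> ref_square" for x using that exhaust_2[of i] by (auto simp: mem_ref_square)
  have e: "{x \<in> ref_square. x $ i = s} = ref_square \<inter> {x. axis i 1 \<bullet> x = s}" by (auto simp: i)
  have f: "{x \<in> ref_square. x $ i = s} face_of ref_square"
    unfolding e
  proof (cases "s = 1")
    case True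
    show "ref_square \<inter> {x. axis i 1 \<bullet> x = s} face_of ref_square"
      by (rule face_of_Int_supporting_hyperplane_le[OF c]) (use b True in \<open>auto simp: i abs_le_iff\<close>)
  next
    case False
    show "ref_square \<inter> {x. axis i 1 \<bullet> x = s} face_of ref_square"
      by (rule face_of_Int_supporting_hyperplane_ge[OF c]) (use b False s in \<open>auto simp: i abs_le_iff\<close>)
  qed
  have ne: "pt i s (-1) \<noteq> pt i s 1"
    using exhaust_2[of i] by (auto simp: vec_eq_iff forall_2 pt_component)
  have "pt i s ` {-1..1} = closed_segment (pt i s (-1)) (pt i s 1)"
  proof -
    have p: "pt i s t = (1 - u) *\<^sub>R pt i s (-1) + u *\<^sub>R pt i s 1" if "t = 2 * u - 1" for t u
      using that by (auto simp: vec_eq_iff pt_component algebra_simps)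
    show ?thesis
    proof
      show "pt i s ` {-1..1} \<subseteq> closed_segment (pt i s (-1)) (pt i s 1)"
      proof
        fix x assume "x \<in> pt i s ` {-1..1}"
        then obtain t where t: "x = pt i s t" "-1 \<le> t" "t \<le> 1" by auto
        then show "x \<in> closed_segment (pt i s (-1)) (pt i s 1)"
        proof -
          have "t = 2 * ((t + 1) / 2) - 1" by (simp add: field_simps)
          from p[OF this] t show ?thesis unfolding closed_segment_def
            by (intro CollectI exI[of _ "(t + 1) / 2"]) simp
        qed
      qed
      show "closed_segment (pt i s (-1)) (pt i s 1) \<subseteq> pt i s ` {-1..1}"
      proof
        fix x assume "x \<in> closed_segment (pt i s (-1)) (pt i s 1)"
        then obtain u where u: "0 \<le> u" "u \<le> 1" "x = (1 - u) *\<^sub>R pt i s (-1) + u *\<^sub>R pt i s 1"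
          unfolding closed_segment_def by auto
        then have "x = pt i s (2 * u - 1)" using p[of "2 * u - 1" u] by simp
        then show "x \<in> pt i s ` {-1..1}" using u by auto
      qed
    qed
  qed
  then have "aff_dim {x \<in> ref_square. x $ i = s} = 1"
    using ref_side_eq[of s i] s ne by (auto simp: segment_convex_hull aff_dim_convex_hull)
  with f show ?thesis by (simp add: edge_of_def)
qed

lemma unit_normals_parallel:
  fixes \<nu> n \<tau> :: "real^2"
  assumes "norm \<nu> = 1" "norm n = 1" "\<tau> \<bullet> \<nu> = 0" "\<tau> \<bullet> n = 0" "\<tau> \<noteq> 0"
  shows "\<nu> = n \<or> \<nu> = - n"
proof -
  let ?x = "\<nu> $ 1" and ?y = "\<nu> $ 2" and ?u = "n $ 1" and ?v = "n $ 2" and ?p = "\<tau> $ 1" and ?q = "\<tau> $ 2"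
  have e: "?p * ?x + ?q * ?y = 0" "?p * ?u + ?q * ?v = 0" using assms(3,4) by (auto simp: inner_vec_def sum_2)
  have "?p * (?x * ?v - ?y * ?u) = 0" "?q * (?x * ?v - ?y * ?u) = 0" using e by algebra+
  moreover have "?p \<noteq> 0 \<or> ?q \<noteq> 0" using assms(5) by (auto simp: vec_eq_iff forall_2)
  ultimately have d: "?x * ?v - ?y * ?u = 0" by auto
  have n: "?x * ?x + ?y * ?y = 1" "?u * ?u + ?v * ?v = 1"
    using assms(1,2) by (auto simp: norm_eq_1 inner_vec_def sum_2)
  have "(?x * ?u + ?y * ?v)^2 = 1" using d n by algebra
  then have "?x * ?u + ?y * ?v = 1 \<or> ?x * ?u + ?y * ?v = - 1" by (simp add: power2_eq_1_iff)
  then show ?thesis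
  proof
    assume "?x * ?u + ?y * ?v = 1"
    then have "(?x - ?u)^2 + (?y - ?v)^2 = 0" using n by (simp add: power2_eq_square algebra_simps)
    then have "?x - ?u = 0 \<and> ?y - ?v = 0" unfolding sum_power2_eq_zero_iff .
    then show ?thesis by (simp add: vec_eq_iff forall_2)
  next
    assume "?x * ?u + ?y * ?v = - 1"
    then have "(?x + ?u)^2 + (?y + ?v)^2 = 0" using n by (simp add: power2_eq_square algebra_simps)
    then have "?x + ?u = 0 \<and> ?y + ?v = 0" unfolding sum_power2_eq_zero_iff .
    then show ?thesis by (simp add: vec_eq_iff forall_2 eq_neg_iff_add_eq_0)
  qed
qed

text \<open>An edge is exposed by a linear functional \<open>a\<close>. In the plane the unit normal of the edge is unique up
  to sign, and a point \<open>z\<close> of \<open>E\<close> off the edge fixes the sign, so the description that defines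
  \<open>outer_normal\<close> determines it. All points of the edge have the same product with it, so the choice of the
  base point of \<open>edge_dist\<close> has no influence.\<close>

lemma edge_dist_affine:
  assumes h: "e = E \<inter> {x. a \<bullet> x = b}" "E \<subseteq> {x. a \<bullet> x \<le> b}"
    and e: "p \<in> e" "q \<in> e" "p \<noteq> q" and z: "z \<in> E" "z \<notin> e"
  shows "edge_dist E e x = (- (a /\<^sub>R norm a)) \<bullet> x + b / norm a"
proof -
  have az: "a \<bullet> z < b" using h z by force
  have a0: "a \<noteq> 0" using az e(1) h by auto
  define n where "n = a /\<^sub>R norm a"
  have nn: "norm n = 1" using a0 by (simp add: n_def)
  have ni: "y \<bullet> n = (a \<bullet> y) / norm a" for y
    by (simp add: n_def inner_commute divide_inverse mult.commute)
  have ne: "y \<bullet> n = b / norm a" if "y \<in> e" for y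
    using that h by (simp add: ni)
  have nE: "y \<bullet> n \<le> b / norm a" if "y \<in> E" for y
    using that h(2) unfolding ni by (intro divide_right_mono) auto
  have nz: "z \<bullet> n < b / norm a"
    using az a0 by (simp add: ni divide_strict_right_mono)
  have "outer_normal E e = n"
    unfolding outer_normal_def
  proof (rule the_equality)
    show "norm n = 1 \<and> (\<forall>x\<in>e. \<forall>y\<in>e. (y - x) \<bullet> n = 0) \<and> (\<forall>x\<in>e. \<forall>y\<in>E. (y - x) \<bullet> n \<le> 0)"
    proof (intro conjI ballI)
      show "(y - x) \<bullet> n = 0" if "x \<in> e" "y \<in> e" for x y
        unfolding inner_diff_left ne[OF that(1)] ne[OF that(2)] by (rule diff_self)
      show "(y - x) \<bullet> n \<le> 0" if "x \<in> e" "y \<in> E" for x y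
        unfolding inner_diff_left ne[OF that(1)] using nE[OF that(2)] by linarith
    qed (rule nn)
  next
    fix \<nu> assume \<nu>: "norm \<nu> = 1 \<and> (\<forall>x\<in>e. \<forall>y\<in>e. (y - x) \<bullet> \<nu> = 0) \<and> (\<forall>x\<in>e. \<forall>y\<in>E. (y - x) \<bullet> \<nu> \<le> 0)"
    have "(q - p) \<bullet> \<nu> = 0" "norm \<nu> = 1" using \<nu> e by blast+
    moreover have "(q - p) \<bullet> n = 0" by (simp only: inner_diff_left ne[OF e(1)] ne[OF e(2)] diff_self)
    moreover have "q - p \<noteq> 0" using e(3) by simp
    ultimately have "\<nu> = n \<or> \<nu> = - n" using unit_normals_parallel[of \<nu> n "q - p"] nn by blast
    moreover have "\<nu> \<noteq> - n"
    proof
      assume "\<nu> = - n"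
      then have "(z - p) \<bullet> (- n) \<le> 0" using \<nu> e z by blast
      then show False using nz unfolding inner_minus_right inner_diff_left ne[OF e(1)] by linarith
    qed
    ultimately show "\<nu> = n" by blast
  qed
  moreover have "(SOME y. y \<in> e) \<in> e" using e(1) by (rule someI)
  ultimately have "edge_dist E e x = - (x \<bullet> n) + b / norm a"
    unfolding edge_dist_def by (simp add: inner_diff_left ne)
  then show ?thesis by (simp add: n_def inner_commute)
qed

locale quadrilateral =
  fixes E :: "(real^2) set" and F :: "real^2 \<Rightarrow> real^2"
  assumes quad: "convex_quadrilateral E" and bilin: "bilinear_map E F"
begin

lemma polytope: "polytope E"
  using quad by (simp add: convex_quadrilateral_def)

lemma inj: "inj_on F ref_square" and image: "F ` ref_square = E"
  using bilin by (auto simp: bilinear_map_def bij_betw_def)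

lemma F_in: "y \<in> ref_square \<Longrightarrow> F y \<in> E"
  using image by blast

lemma F_eq_iff: "y \<in> ref_square \<Longrightarrow> z \<in> ref_square \<Longrightarrow> F y = F z \<longleftrightarrow> y = z"
  using inj by (auto simp: inj_on_def)

lemma side_line: "\<exists>m \<tau>. \<forall>t. F (pt i s t) = m + t *\<^sub>R \<tau>"
proof -
  obtain a b c d where F: "\<And>x. F x = a + (x $ 1) *\<^sub>R b + (x $ 2) *\<^sub>R c + (x $ 1 * x $ 2) *\<^sub>R d"
    using bilin unfolding bilinear_map_def by blast
  consider "i = 1" | "i = 2" using exhaust_2[of i] by blast
  then show ?thesis
  proof cases
    case 1
    then show ?thesis
      by (intro exI[of _ "a + s *\<^sub>R b"] exI[of _ "c + s *\<^sub>R d"]) (simp add: F pt_component algebra_simps)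
  next
    case 2
    then show ?thesis
      by (intro exI[of _ "a + s *\<^sub>R c"] exI[of _ "b + s *\<^sub>R d"]) (simp add: F pt_component algebra_simps)
  qed
qed

text \<open>The edge is a proper face, because \<open>F\<close> is injective and the opposite side is mapped outside of it;
  comparing dimensions, \<open>E\<close> is two-dimensional.\<close>

lemma side_properties:
  assumes s: "s = -1 \<or> s = 1"
  shows "\<exists>\<nu> \<beta>. (\<forall>x. edge_dist E (side F i s) x = \<nu> \<bullet> x + \<beta>) \<and> (\<forall>x\<in>E. 0 \<le> \<nu> \<bullet> x + \<beta>) \<and>
    (\<forall>x\<in>E. \<nu> \<bullet> x + \<beta> = 0 \<longleftrightarrow> x \<in> side F i s)"
    and "aff_dim E = 2"
proof -
  let ?e = "side F i s"
  have "?e edge_of E"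
    using bilin ref_side_edge[OF s] by (auto simp: bilinear_map_def side_def)
  then have f: "?e face_of E" "aff_dim ?e = 1" by (auto simp: edge_of_def)
  then have "?e exposed_face_of E"
    using polytope exposed_face_of_polyhedron polytope_imp_polyhedron by blast
  then obtain a b where ab: "?e = E \<inter> {x. a \<bullet> x = b}" "E \<subseteq> {x. a \<bullet> x \<le> b}"
    by (auto simp: exposed_face_of_def)
  have s': "\<bar>s\<bar> \<le> 1" using s by auto
  let ?p = "F (pt i s (-1))" and ?q = "F (pt i s 1)" and ?z = "F (pt i (- s) 1)"
  have pq: "?p \<in> ?e" "?q \<in> ?e" using s' by (auto simp: side_eq)
  have "pt i s (-1) \<noteq> pt i s 1"
    using exhaust_2[of i] by (auto simp: vec_eq_iff forall_2 pt_component)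
  then have ne: "?p \<noteq> ?q" using s' by (subst F_eq_iff) (auto simp: pt_in_ref_square)
  have z: "?z \<in> E" "?z \<notin> ?e"
  proof -
    show "?z \<in> E" using s' by (intro F_in) (simp add: pt_in_ref_square)
    show "?z \<notin> ?e"
    proof
      assume "?z \<in> ?e"
      then obtain t where t: "F (pt i (- s) 1) = F (pt i s t)" "\<bar>t\<bar> \<le> 1" using s' by (auto simp: side_eq abs_le_iff)
      then have "pt i (- s) 1 = pt i s t" using s' by (subst (asm) F_eq_iff) (auto simp: pt_in_ref_square)
      then have "pt i (- s) 1 $ i = pt i s t $ i" by simp
      then show False using s by (auto simp: pt_component)
    qed
  qed
  note d = edge_dist_affine[OF ab pq ne z]
  have a0: "norm a > 0" using ab z pq(1) by auto
  show "\<exists>\<nu> \<beta>. (\<forall>x. edge_dist E (side F i s) x = \<nu> \<bullet> x + \<beta>) \<and> (\<forall>x\<in>E. 0 \<le> \<nu> \<bullet> x + \<beta>) \<and>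
    (\<forall>x\<in>E. \<nu> \<bullet> x + \<beta> = 0 \<longleftrightarrow> x \<in> side F i s)"
  proof (intro exI[of _ "- (a /\<^sub>R norm a)"] exI[of _ "b / norm a"] conjI allI ballI)
    show "edge_dist E ?e x = - (a /\<^sub>R norm a) \<bullet> x + b / norm a" for x by (rule d)
    have v: "- (a /\<^sub>R norm a) \<bullet> x + b / norm a = (b - a \<bullet> x) / norm a" for x
      by (simp add: divide_inverse algebra_simps)
    fix x assume x: "x \<in> E"
    show "0 \<le> - (a /\<^sub>R norm a) \<bullet> x + b / norm a" unfolding v using x ab(2) a0 by auto
    show "(- (a /\<^sub>R norm a) \<bullet> x + b / norm a = 0) = (x \<in> ?e)" unfolding v using x ab(1) a0 by auto
  qed
  have "aff_dim ?e < aff_dim E"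
    by (rule face_of_aff_dim_lt) (use f z polytope polytope_imp_convex in auto)
  moreover have "aff_dim E \<le> 2" using aff_dim_le_DIM[of E] by simp
  ultimately show "aff_dim E = 2" using f by simp
qed

lemma compact_E: "compact E" and convex_E: "convex E"
  using polytope by (auto simp: polytope_imp_compact polytope_imp_convex)

lemma interior_nonempty: "interior E \<noteq> {}"
  using side_properties(2)[of 1] polytope_imp_convex[OF polytope] rel_interior_eq_empty[of E]
    interior_rel_interior_gen[of E] by auto

lemma closure_interior_E: "closure (interior E) = E"
  using convex_closure_interior[OF convex_E interior_nonempty] compact_E by (simp add: compact_imp_closed)

text \<open>\<open>dst i s\<close> is the affine function \<open>\<lambda>\<close> of the side on which the \<open>i\<close>-th reference coordinate
  is \<open>s\<close>.\<close>

abbreviation dst :: "2 \<Rightarrow> real \<Rightarrow> real^2 \<Rightarrow> real" where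
  "dst i s \<equiv> edge_dist E (side F i s)"

lemma dst_affine: "s = -1 \<or> s = 1 \<Longrightarrow> \<exists>\<nu> \<beta>. \<forall>x. dst i s x = \<nu> \<bullet> x + \<beta>"
  using side_properties(1)[of s i] by blast

lemma dst_nonneg: "s = -1 \<or> s = 1 \<Longrightarrow> x \<in> E \<Longrightarrow> 0 \<le> dst i s x"
  using side_properties(1)[of s i] by auto

lemma dst_zero_iff:
  assumes "s = -1 \<or> s = 1" "y \<in> ref_square"
  shows "dst i s (F y) = 0 \<longleftrightarrow> y $ i = s"
proof -
  have "dst i s (F y) = 0 \<longleftrightarrow> F y \<in> side F i s"
    using side_properties(1)[OF assms(1), of i] F_in[OF assms(2)] by auto
  also have "\<dots> \<longleftrightarrow> y $ i = s"
    using F_eq_iff assms(2) by (auto simp: side_def)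
  finally show ?thesis .
qed

lemma dst_on_line:
  assumes "s = -1 \<or> s = 1"
  shows "\<exists>f0 f1. \<forall>t. dst i s (m + t *\<^sub>R \<tau>) = f0 + f1 * t"
proof -
  obtain \<nu> \<beta> where "\<And>x. dst i s x = \<nu> \<bullet> x + \<beta>" using dst_affine[OF assms] by blast
  then show ?thesis
    by (intro exI[of _ "\<nu> \<bullet> m + \<beta>"] exI[of _ "\<nu> \<bullet> \<tau>"]) (simp add: inner_add_right mult.commute)
qed

text \<open>On an adjacent side the distance is an affine function of the parameter that vanishes at one end
  and is positive at the other.\<close>

lemma dst_adjacent:
  assumes ij: "i \<noteq> j" and s: "s = -1 \<or> s = 1" "s' = -1 \<or> s' = (1::real)"
  shows "\<exists>k>0. \<forall>t. dst j s' (F (pt i s t)) = k * (1 - s' * t)"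
proof -
  obtain m \<tau> where m: "\<And>t. F (pt i s t) = m + t *\<^sub>R \<tau>" using side_line by blast
  obtain f0 f1 where f: "\<And>t. dst j s' (F (pt i s t)) = f0 + f1 * t"
    unfolding m using dst_on_line[OF s(2)] by blast
  have c: "pt i s t $ j = t" for t using ij by (simp add: pt_component)
  have r: "pt i s t \<in> ref_square" if "\<bar>t\<bar> \<le> 1" for t using that s by (auto simp: pt_in_ref_square)
  have "f0 + f1 * s' = 0" using dst_zero_iff[OF s(2) r[of s'], of j] s f[of s'] by (auto simp: c)
  moreover have "f0 + f1 * (- s') \<noteq> 0" using dst_zero_iff[OF s(2) r[of "- s'"], of j] s f[of "- s'"] by (auto simp: c)
  moreover have "f0 + f1 * (- s') \<ge> 0" using dst_nonneg[OF s(2) F_in[OF r[of "- s'"]], of j] s f[of "- s'"] by auto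
  ultimately have "f0 > 0" "f1 = - f0 * s'" using s(2) by auto
  then show ?thesis using f by (intro exI[of _ f0]) (auto simp: algebra_simps)
qed

lemma dst_same:
  assumes s: "s = -1 \<or> s = 1"
  shows "dst i s (F (pt i s t)) = 0"
proof -
  obtain m \<tau> where m: "\<And>t. F (pt i s t) = m + t *\<^sub>R \<tau>" using side_line by blast
  obtain f0 f1 where f: "\<And>t. dst i s (F (pt i s t)) = f0 + f1 * t"
    unfolding m using dst_on_line[OF s] by blast
  have "dst i s (F (pt i s t)) = 0" if "\<bar>t\<bar> \<le> 1" for t
    using that s by (subst dst_zero_iff) (auto simp: pt_in_ref_square pt_component)
  from this[of 0] this[of 1] have "f0 = 0" "f1 = 0" using f[of 0] f[of 1] by auto
  then show ?thesis using f by simp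
qed

lemma dst_opposite:
  assumes s: "s = -1 \<or> s = 1" and t: "\<bar>t\<bar> \<le> 1"
  shows "dst i s (F (pt i (- s) t)) > 0"
proof -
  have r: "pt i (- s) t \<in> ref_square" using s t by (auto simp: pt_in_ref_square)
  have "dst i s (F (pt i (- s) t)) \<noteq> 0" using dst_zero_iff[OF s r, of i] s by (auto simp: pt_component)
  then show ?thesis using dst_nonneg[OF s F_in[OF r], of i] by simp
qed

end

section \<open>Supplements and polynomials on opposite sides\<close>

lemma perp_parallel:
  fixes b u \<tau> :: "real^2"
  assumes "b \<bullet> u = 0" "b \<bullet> \<tau> = 0" "b \<noteq> 0" "\<tau> \<noteq> 0"
  shows "\<exists>k. u = k *\<^sub>R \<tau>"
proof -
  have e: "b $ 1 * u $ 1 + b $ 2 * u $ 2 = 0" "b $ 1 * \<tau> $ 1 + b $ 2 * \<tau> $ 2 = 0"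
    using assms(1,2) by (auto simp: inner_vec_def sum_2)
  have "b $ 1 * (u $ 1 * \<tau> $ 2 - u $ 2 * \<tau> $ 1) = 0" "b $ 2 * (u $ 1 * \<tau> $ 2 - u $ 2 * \<tau> $ 1) = 0"
    using e by algebra+
  moreover have "b $ 1 \<noteq> 0 \<or> b $ 2 \<noteq> 0" using assms(3) by (auto simp: vec_eq_iff forall_2)
  ultimately have d: "u $ 1 * \<tau> $ 2 = u $ 2 * \<tau> $ 1" by auto
  consider "\<tau> $ 1 \<noteq> 0" | "\<tau> $ 2 \<noteq> 0" using assms(4) by (auto simp: vec_eq_iff forall_2)
  then show ?thesis
  proof cases
    case 1
    then show ?thesis using d by (intro exI[of _ "u $ 1 / \<tau> $ 1"]) (auto simp: vec_eq_iff forall_2 field_simps)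
  next
    case 2
    then show ?thesis using d by (intro exI[of _ "u $ 2 / \<tau> $ 2"]) (auto simp: vec_eq_iff forall_2 field_simps)
  qed
qed

lemma det_zero_parallel:
  fixes u \<tau> :: "real^2"
  assumes "\<tau> $ 1 * u $ 2 = \<tau> $ 2 * u $ 1" "\<tau> \<noteq> 0"
  shows "\<exists>k. u = k *\<^sub>R \<tau>"
  by (rule perp_parallel[of "vector [- \<tau> $ 2, \<tau> $ 1]"])
     (use assms in \<open>auto simp: inner_vec_def sum_2 vec_eq_iff forall_2\<close>)

lemma lines_meet:
  fixes m \<tau> m' \<tau>' :: "real^2"
  assumes "\<tau> $ 1 * \<tau>' $ 2 \<noteq> \<tau> $ 2 * \<tau>' $ 1"
  shows "\<exists>t t'. m + t *\<^sub>R \<tau> = m' + t' *\<^sub>R \<tau>'"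
proof -
  \<comment> \<open>Cramer's rule\<close>
  define D where "D = \<tau> $ 1 * \<tau>' $ 2 - \<tau> $ 2 * \<tau>' $ 1"
  define w where "w = m' - m"
  have D: "D \<noteq> 0" using assms by (simp add: D_def)
  let ?t = "(w $ 1 * \<tau>' $ 2 - w $ 2 * \<tau>' $ 1) / D" and ?t' = "(w $ 1 * \<tau> $ 2 - w $ 2 * \<tau> $ 1) / D"
  have "?t * \<tau> $ k - ?t' * \<tau>' $ k = w $ k" for k
  proof -
    have "(w $ 1 * \<tau>' $ 2 - w $ 2 * \<tau>' $ 1) * \<tau> $ k - (w $ 1 * \<tau> $ 2 - w $ 2 * \<tau> $ 1) * \<tau>' $ k = w $ k * D"
      using exhaust_2[of k] by (auto simp: D_def algebra_simps)
    then have "((w $ 1 * \<tau>' $ 2 - w $ 2 * \<tau>' $ 1) * \<tau> $ k - (w $ 1 * \<tau> $ 2 - w $ 2 * \<tau> $ 1) * \<tau>' $ k) / D = w $ k"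
      using D by simp
    then show ?thesis by (simp only: diff_divide_distrib[of "_ * _ $ k"] times_divide_eq_left)
  qed
  then have "m + ?t *\<^sub>R \<tau> = m' + ?t' *\<^sub>R \<tau>'"
    by (simp add: vec_eq_iff w_def algebra_simps)
  then show ?thesis by blast
qed

lemma affine_hull_line_segment:
  fixes m \<tau> :: "'a::real_vector"
  shows "affine hull ((\<lambda>t. m + t *\<^sub>R \<tau>) ` {-1..1}) = range (\<lambda>t. m + t *\<^sub>R \<tau>)"
proof
  have "affine (range (\<lambda>t. m + t *\<^sub>R \<tau>))"
    unfolding affine_def
  proof clarify
    fix t t' u v :: real assume "u + v = 1"
    have "u *\<^sub>R (m + t *\<^sub>R \<tau>) + v *\<^sub>R (m + t' *\<^sub>R \<tau>) = (u + v) *\<^sub>R m + (u * t + v * t') *\<^sub>R \<tau>"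
      by (simp add: algebra_simps)
    also have "\<dots> = m + (u * t + v * t') *\<^sub>R \<tau>" using \<open>u + v = 1\<close> by simp
    finally show "u *\<^sub>R (m + t *\<^sub>R \<tau>) + v *\<^sub>R (m + t' *\<^sub>R \<tau>) \<in> range (\<lambda>t. m + t *\<^sub>R \<tau>)" by blast
  qed
  then show "affine hull ((\<lambda>t. m + t *\<^sub>R \<tau>) ` {-1..1}) \<subseteq> range (\<lambda>t. m + t *\<^sub>R \<tau>)"
    by (intro hull_minimal) auto
  show "range (\<lambda>t. m + t *\<^sub>R \<tau>) \<subseteq> affine hull ((\<lambda>t. m + t *\<^sub>R \<tau>) ` {-1..1})"
  proof clarify
    fix t :: real
    let ?H = "affine hull ((\<lambda>t. m + t *\<^sub>R \<tau>) ` {-1..1::real})"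
    have "m + u *\<^sub>R \<tau> \<in> ?H" if "u \<in> {-1..1}" for u using that by (intro hull_inc imageI)
    from this[of 0] this[of 1] have "m + 0 *\<^sub>R \<tau> \<in> ?H" "m + 1 *\<^sub>R \<tau> \<in> ?H" by simp_all
    then have "(1 - t) *\<^sub>R (m + 0 *\<^sub>R \<tau>) + t *\<^sub>R (m + 1 *\<^sub>R \<tau>) \<in> ?H"
      by (intro mem_affine[OF affine_affine_hull]) auto
    then show "m + t *\<^sub>R \<tau> \<in> ?H" by (simp add: algebra_simps)
  qed
qed

context quadrilateral
begin

text \<open>The two cases for the lines through a pair of opposite sides. For parallel lines the factor \<open>\<kappa>\<close>
  compares the parametrisations by \<open>F\<close>; it is positive because the sides of a convex quadrilateral are
  run through in the same sense (\<open>opposite_sides_cases\<close>). In \<open>sides_meet\<close> the parameters are those of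
  the point of intersection.\<close>

definition parallel_sides :: "2 \<Rightarrow> real \<Rightarrow> bool" where
  "parallel_sides i \<kappa> \<longleftrightarrow> \<kappa> > 0 \<and>
    (\<forall>t. F (pt i 1 t) - F (pt i 1 0) = \<kappa> *\<^sub>R (F (pt i (-1) t) - F (pt i (-1) 0)))"

definition sides_meet :: "2 \<Rightarrow> real \<Rightarrow> real \<Rightarrow> bool" where
  "sides_meet i t1 t2 \<longleftrightarrow> F (pt i (-1) t1) = F (pt i 1 t2)"

lemma other_index: "\<exists>j::2. i \<noteq> j"
  by (cases "i = 1") (auto intro: exI[of _ 2] exI[of _ 1])

text \<open>The affine function of a third side vanishes at parameter \<open>-1\<close> on both lines and increases
  towards the fourth side, which forces the two parameters to the same side of the quadrilateral.\<close>

lemma sides_meet_outside: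
  assumes "sides_meet i t1 t2"
  shows "\<bar>t1\<bar> > 1" "\<bar>t2\<bar> > 1" "t1 * t2 > 0"
proof -
  have e: "F (pt i (-1) t1) = F (pt i 1 t2)" using assms by (simp add: sides_meet_def)
  show 1: "\<bar>t1\<bar> > 1"
    using dst_opposite[of 1 t1 i] dst_same[of 1 i t2] e by fastforce
  show 2: "\<bar>t2\<bar> > 1"
    using dst_opposite[of "-1" t2 i] dst_same[of "-1" i t1] e by fastforce
  obtain j where j: "i \<noteq> j" using other_index by blast
  obtain k k' where k: "k > 0" "k' > 0" "\<And>t. dst j (-1) (F (pt i (-1) t)) = k * (1 + t)"
    "\<And>t. dst j (-1) (F (pt i 1 t)) = k' * (1 + t)"
    using dst_adjacent[OF j, of "-1" "-1"] dst_adjacent[OF j, of 1 "-1"] by auto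
  have "k * (1 + t1) = k' * (1 + t2)" using k(3)[of t1] k(4)[of t2] e by simp
  then have "k * k' * (1 + t1) * (1 + t2) = (k' * (1 + t2))\<^sup>2" by (simp add: power2_eq_square)
  moreover have "\<dots> > 0" using 2 k(2) by auto
  ultimately have "0 < (k * k') * ((1 + t1) * (1 + t2))" by (simp add: mult.assoc)
  then have "(1 + t1) * (1 + t2) > 0" using zero_less_mult_pos[OF _ mult_pos_pos[OF k(1,2)]] by blast
  then show "t1 * t2 > 0" using 1 2 by (auto simp: zero_less_mult_iff)
qed

lemma side_direction_nonzero:
  assumes "s = -1 \<or> s = 1" "\<And>t. F (pt i s t) = m + t *\<^sub>R \<tau>"
  shows "\<tau> \<noteq> 0"
proof
  assume "\<tau> = 0"
  then have "F (pt i s 0) = F (pt i s 1)" using assms(2) by simp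
  then have "pt i s 0 = pt i s 1" using assms(1) by (subst (asm) F_eq_iff) (auto simp: pt_in_ref_square)
  then show False using exhaust_2[of i] by (auto simp: vec_eq_iff forall_2 pt_component)
qed

lemma opposite_sides_cases:
  obtains \<kappa> where "parallel_sides i \<kappa>" | t1 t2 where "sides_meet i t1 t2"
proof -
  obtain m1 \<tau>1 where 1: "\<And>t. F (pt i (-1) t) = m1 + t *\<^sub>R \<tau>1" using side_line by blast
  obtain m2 \<tau>2 where 2: "\<And>t. F (pt i 1 t) = m2 + t *\<^sub>R \<tau>2" using side_line by blast
  show thesis
  proof (cases "\<tau>1 $ 1 * \<tau>2 $ 2 = \<tau>1 $ 2 * \<tau>2 $ 1")
    case False
    then obtain t1 t2 where "m1 + t1 *\<^sub>R \<tau>1 = m2 + t2 *\<^sub>R \<tau>2" using lines_meet by blast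
    then have "sides_meet i t1 t2" using 1 2 by (simp add: sides_meet_def)
    then show thesis by (rule that(2))
  next
    case True
    have "\<tau>1 \<noteq> 0" by (rule side_direction_nonzero[OF _ 1]) simp
    with True obtain \<kappa> where \<kappa>: "\<tau>2 = \<kappa> *\<^sub>R \<tau>1" using det_zero_parallel by blast
    obtain j where j: "i \<noteq> j" using other_index by blast
    obtain k k' where k: "k > 0" "k' > 0" "\<And>t. dst j (-1) (F (pt i (-1) t)) = k * (1 + t)"
      "\<And>t. dst j (-1) (F (pt i 1 t)) = k' * (1 + t)"
      using dst_adjacent[OF j, of "-1" "-1"] dst_adjacent[OF j, of 1 "-1"] by auto
    obtain \<nu> \<beta> where \<nu>: "\<And>x. dst j (-1) x = \<nu> \<bullet> x + \<beta>" using dst_affine[of "-1" j] by auto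
    have "\<nu> \<bullet> \<tau>1 = k" using k(3)[of 0] k(3)[of 1] unfolding 1 \<nu> by (simp add: inner_add_right)
    moreover have "\<nu> \<bullet> \<tau>2 = k'" using k(4)[of 0] k(4)[of 1] unfolding 2 \<nu> by (simp add: inner_add_right)
    ultimately have "k' = \<kappa> * k" using \<kappa> by simp
    then have "\<kappa> > 0" using k(1,2) by (simp add: zero_less_mult_iff)
    then have "parallel_sides i \<kappa>" using 1 2 \<kappa> by (simp add: parallel_sides_def)
    then show thesis by (rule that(1))
  qed
qed

text \<open>The affine functions \<open>\<alpha>1 + \<beta>1 t\<close> and \<open>\<alpha>2 + \<beta>2 t\<close> on the two lines have the same sign at the
  point of intersection. For parallel lines that point is at infinity, and the slopes take the place of
  the values.\<close>

definition same_sign_at_meeting :: "2 \<Rightarrow> real \<Rightarrow> real \<Rightarrow> real \<Rightarrow> real \<Rightarrow> bool" where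
  "same_sign_at_meeting i \<alpha>1 \<beta>1 \<alpha>2 \<beta>2 \<longleftrightarrow>
     (\<forall>\<kappa>. parallel_sides i \<kappa> \<longrightarrow> \<beta>1 * \<beta>2 > 0) \<and>
     (\<forall>t1 t2. sides_meet i t1 t2 \<longrightarrow> (\<alpha>1 + \<beta>1 * t1) * (\<alpha>2 + \<beta>2 * t2) > 0)"

text \<open>The shape that direct and mapped supplement functions have in common on a pair of opposite sides.
  What matters is the opposite sign in front of the two values.\<close>

definition odd_profile :: "2 \<Rightarrow> nat \<Rightarrow> (real^2 \<Rightarrow> real) \<Rightarrow> bool" where
  "odd_profile i n f \<longleftrightarrow> (\<exists>\<omega>1 \<omega>2 \<alpha>1 \<beta>1 \<alpha>2 \<beta>2. \<omega>1 > 0 \<and> \<omega>2 > 0 \<and>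
     (\<forall>t. \<bar>t\<bar> \<le> 1 \<longrightarrow> f (F (pt i (-1) t)) = - \<omega>1 * (1 - t\<^sup>2) * (\<alpha>1 + \<beta>1 * t) ^ n) \<and>
     (\<forall>t. \<bar>t\<bar> \<le> 1 \<longrightarrow> f (F (pt i 1 t)) = \<omega>2 * (1 - t\<^sup>2) * (\<alpha>2 + \<beta>2 * t) ^ n) \<and>
     same_sign_at_meeting i \<alpha>1 \<beta>1 \<alpha>2 \<beta>2)"

text \<open>After multiplication by \<open>y q2\<^sup>n\<close> the equation reads \<open>A\<close> times a positive number equals zero.\<close>

lemma opposite_signs_zero:
  fixes A :: real
  assumes "\<omega>1 > 0" "\<omega>2 > 0" "x * y > 0" "q1 * q2 > 0" "- A * \<omega>1 * x * q1 ^ n = A * \<omega>2 * y * q2 ^ n"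
  shows "A = 0"
proof -
  have "A * (\<omega>1 * (x * y) * (q1 * q2) ^ n + \<omega>2 * (y * q2 ^ n)\<^sup>2)
     = (A * \<omega>1 * x * q1 ^ n + A * \<omega>2 * y * q2 ^ n) * (y * q2 ^ n)"
    by (simp add: power_mult_distrib power2_eq_square algebra_simps)
  also have "\<dots> = 0" using assms(5) by simp
  finally have "A = 0 \<or> \<omega>1 * (x * y) * (q1 * q2) ^ n + \<omega>2 * (y * q2 ^ n)\<^sup>2 = 0" by simp
  moreover have "\<omega>1 * (x * y) * (q1 * q2) ^ n + \<omega>2 * (y * q2 ^ n)\<^sup>2 > 0"
    using assms(1-4) by (intro add_pos_nonneg mult_pos_pos[OF mult_pos_pos[OF assms(1,3)] zero_less_power[OF assms(4)]]) simp
  ultimately show ?thesis by linarith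
qed

text \<open>A polynomial of degree \<open>n + 2\<close> that equals \<open>A f\<close> on two opposite sides does so on their lines.
  Comparing the two values at the intersection point, or the two leading coefficients if the
  lines are parallel, the opposite signs leave only \<open>A = 0\<close>.\<close>

lemma odd_profile_not_polynomial:
  assumes f: "odd_profile i n f" and p: "p \<in> polys (n + 2)"
    and e: "\<And>s t. s = -1 \<or> s = 1 \<Longrightarrow> \<bar>t\<bar> \<le> 1 \<Longrightarrow> p (F (pt i s t)) = A * f (F (pt i s t))"
  shows "A = 0"
proof -
  obtain \<omega>1 \<omega>2 \<alpha>1 \<beta>1 \<alpha>2 \<beta>2 where \<omega>: "\<omega>1 > 0" "\<omega>2 > 0"
    and f1: "\<And>t. \<bar>t\<bar> \<le> 1 \<Longrightarrow> f (F (pt i (-1) t)) = - \<omega>1 * (1 - t\<^sup>2) * (\<alpha>1 + \<beta>1 * t) ^ n"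
    and f2: "\<And>t. \<bar>t\<bar> \<le> 1 \<Longrightarrow> f (F (pt i 1 t)) = \<omega>2 * (1 - t\<^sup>2) * (\<alpha>2 + \<beta>2 * t) ^ n"
    and par: "\<And>\<kappa>. parallel_sides i \<kappa> \<Longrightarrow> \<beta>1 * \<beta>2 > 0"
    and meet: "\<And>t1 t2. sides_meet i t1 t2 \<Longrightarrow> (\<alpha>1 + \<beta>1 * t1) * (\<alpha>2 + \<beta>2 * t2) > 0"
    using f unfolding odd_profile_def same_sign_at_meeting_def by blast
  obtain m1 \<tau>1 where 1: "\<And>t. F (pt i (-1) t) = m1 + t *\<^sub>R \<tau>1" using side_line by blast
  obtain m2 \<tau>2 where 2: "\<And>t. F (pt i 1 t) = m2 + t *\<^sub>R \<tau>2" using side_line by blast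
  obtain L where L: "\<And>\<kappa> v. L (\<kappa> *\<^sub>R v) = \<kappa> ^ (n + 2) * L v"
    "\<And>a v. \<exists>P. degree P \<le> n + 2 \<and> coeff P (n + 2) = L v \<and> (\<forall>t. p (a + t *\<^sub>R v) = poly P t)"
    using polys_on_lines[OF p] by blast
  define Q where "Q c \<alpha> \<beta> = smult c ([:1, 0, -1:] * [:\<alpha>, \<beta>:] ^ n)" for c \<alpha> \<beta> :: real
  have Q: "poly (Q c \<alpha> \<beta>) t = c * (1 - t\<^sup>2) * (\<alpha> + \<beta> * t) ^ n" for c \<alpha> \<beta> t
    by (simp add: Q_def power2_eq_square algebra_simps)
  have Qc: "coeff (Q c \<alpha> \<beta>) (n + 2) = - c * \<beta> ^ n" for c \<alpha> \<beta>
  proof -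
    have "coeff ([:1, 0, -1:] * [:\<alpha>, \<beta>:] ^ n) (2 + n) = coeff [:1, 0, -1:] 2 * coeff ([:\<alpha>, \<beta>:] ^ n) n"
      by (rule coeff_mult_top) (use linear_power_top in auto)
    also have "\<dots> = - (\<beta> ^ n)" using linear_power_top[of \<alpha> \<beta> n] by (simp add: numeral_2_eq_2)
    finally show ?thesis by (simp only: Q_def coeff_smult add.commute[of n])
  qed
  have eq: "P = Q'" if "\<And>t. \<bar>t\<bar> \<le> 1 \<Longrightarrow> poly P t = poly Q' t" for P Q' :: "real poly"
  proof -
    have "P - Q' = 0" by (rule poly_zero_of_zeros_on_interval[of "-1" 1]) (use that in auto)
    then show ?thesis by simp
  qed
  obtain P1 where P1: "coeff P1 (n + 2) = L \<tau>1" "\<And>t. p (m1 + t *\<^sub>R \<tau>1) = poly P1 t" using L(2)[of \<tau>1 m1] by blast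
  have P1Q: "P1 = Q (- A * \<omega>1) \<alpha>1 \<beta>1"
    by (rule eq) (use e[of "-1"] f1 in \<open>simp add: Q 1 P1(2)\<close>)
  obtain P2 where P2: "coeff P2 (n + 2) = L \<tau>2" "\<And>t. p (m2 + t *\<^sub>R \<tau>2) = poly P2 t" using L(2)[of \<tau>2 m2] by blast
  have P2Q: "P2 = Q (A * \<omega>2) \<alpha>2 \<beta>2"
    by (rule eq) (use e[of 1] f2 in \<open>simp add: Q 2 P2(2)\<close>)
  consider \<kappa> where "parallel_sides i \<kappa>" | t1 t2 where "sides_meet i t1 t2"
    by (rule opposite_sides_cases)
  then show "A = 0"
  proof cases
    case (1 \<kappa>)
    then have \<kappa>: "\<kappa> > 0" "\<tau>2 = \<kappa> *\<^sub>R \<tau>1"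
      using \<open>\<And>t. F (pt i (-1) t) = m1 + t *\<^sub>R \<tau>1\<close> 2 unfolding parallel_sides_def by (auto dest: spec[of _ 1])
    have "- (A * \<omega>2) * \<beta>2 ^ n = \<kappa> ^ (n + 2) * (- (- A * \<omega>1) * \<beta>1 ^ n)"
      using P1(1) P2(1) L(1)[of \<kappa> \<tau>1] unfolding P1Q P2Q Qc \<kappa>(2) by simp
    then have "- A * (\<kappa> ^ (n + 2) * \<omega>1) * 1 * \<beta>1 ^ n = A * \<omega>2 * 1 * \<beta>2 ^ n"
      by (simp add: algebra_simps)
    then show ?thesis
      using \<kappa>(1) \<omega> par[OF 1] by (intro opposite_signs_zero[of "\<kappa> ^ (n + 2) * \<omega>1" \<omega>2 1 1 \<beta>1 \<beta>2 A n]) auto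
  next
    case (2 t1 t2)
    have o: "\<bar>t1\<bar> > 1" "\<bar>t2\<bar> > 1" using sides_meet_outside[OF 2] by auto
    have "1 - t1\<^sup>2 < 0" "1 - t2\<^sup>2 < 0" using one_less_power[OF o(1), of 2] one_less_power[OF o(2), of 2] by simp_all
    then have s: "(1 - t1\<^sup>2) * (1 - t2\<^sup>2) > 0" by (rule mult_neg_neg)
    have "poly P1 t1 = poly P2 t2"
      using 2 P1(2)[of t1] P2(2)[of t2] unfolding sides_meet_def 1 \<open>\<And>t. F (pt i 1 t) = m2 + t *\<^sub>R \<tau>2\<close> by simp
    then have "- A * \<omega>1 * (1 - t1\<^sup>2) * (\<alpha>1 + \<beta>1 * t1) ^ n = A * \<omega>2 * (1 - t2\<^sup>2) * (\<alpha>2 + \<beta>2 * t2) ^ n"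
      unfolding P1Q P2Q Q .
    then show ?thesis by (rule opposite_signs_zero[OF \<omega> s meet[OF 2]])
  qed
qed

lemma affine_hull_side:
  assumes "s = -1 \<or> s = 1" "\<And>t. F (pt i s t) = m + t *\<^sub>R \<tau>"
  shows "affine hull (side F i s) = range (\<lambda>t. m + t *\<^sub>R \<tau>)"
proof -
  have "side F i s = (\<lambda>t. m + t *\<^sub>R \<tau>) ` {-1..1}" using assms by (subst side_eq) auto
  then show ?thesis using affine_hull_line_segment by simp
qed

text \<open>If the lines meet, both edge distances vanish at the intersection, so there \<open>l\<close> is the constant
  \<open>\<gamma>\<close> on either line. If they are parallel, a zero slope along one line would be a zero slope along the other;
  as \<open>l\<close> has a zero on both, it would vanish on two distinct parallel lines, hence everywhere.\<close>

lemma admissible_linear_on_sides: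
  assumes "admissible_linear E (side F i (-1)) (side F i 1) l"
  shows "\<exists>\<alpha>1 \<beta>1 \<alpha>2 \<beta>2. (\<forall>t. l (F (pt i (-1) t)) = \<alpha>1 + \<beta>1 * t) \<and> (\<forall>t. l (F (pt i 1 t)) = \<alpha>2 + \<beta>2 * t) \<and>
     same_sign_at_meeting i \<alpha>1 \<beta>1 \<alpha>2 \<beta>2"
    and "\<exists>\<nu> \<beta>. \<forall>x. l x = \<nu> \<bullet> x + \<beta>"
proof -
  obtain m1 \<tau>1 where 1: "\<And>t. F (pt i (-1) t) = m1 + t *\<^sub>R \<tau>1" using side_line by blast
  obtain m2 \<tau>2 where 2: "\<And>t. F (pt i 1 t) = m2 + t *\<^sub>R \<tau>2" using side_line by blast
  let ?L1 = "range (\<lambda>t. m1 + t *\<^sub>R \<tau>1)" and ?L2 = "range (\<lambda>t. m2 + t *\<^sub>R \<tau>2)"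
  have h: "affine hull (side F i (-1)) = ?L1" "affine hull (side F i 1) = ?L2"
    by (rule affine_hull_side; use 1 2 in simp)+
  have \<tau>1: "\<tau>1 \<noteq> 0" by (rule side_direction_nonzero[OF _ 1]) simp
  have distinct: "m2 \<noteq> m1 + t *\<^sub>R \<tau>1" for t
    using dst_opposite[of "-1" 0 i] dst_same[of "-1" i t] 1[of t] 2[of 0] by auto
  have goal: "(\<exists>\<alpha>1 \<beta>1 \<alpha>2 \<beta>2. (\<forall>t. l (F (pt i (-1) t)) = \<alpha>1 + \<beta>1 * t) \<and> (\<forall>t. l (F (pt i 1 t)) = \<alpha>2 + \<beta>2 * t) \<and>
     same_sign_at_meeting i \<alpha>1 \<beta>1 \<alpha>2 \<beta>2) \<and> (\<exists>\<nu> \<beta>. \<forall>x. l x = \<nu> \<bullet> x + \<beta>)"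
  proof (cases "affine_parallel ?L1 ?L2")
    case True
    then obtain b c where bc: "b \<noteq> 0" "l = (\<lambda>x. b \<bullet> x + c)"
      and z: "\<exists>x\<in>?L1. l x = 0" "\<exists>x\<in>?L2. l x = 0"
      using assms unfolding admissible_linear_def h by auto
    obtain w where w: "?L2 = (\<lambda>x. w + x) ` ?L1" using True unfolding affine_parallel_def by blast
    have in2: "m2 + t *\<^sub>R \<tau>2 \<in> (\<lambda>x. w + x) ` ?L1" for t using w by blast
    obtain u where u: "m2 + 0 *\<^sub>R \<tau>2 = w + (m1 + u *\<^sub>R \<tau>1)" using in2[of 0] by blast
    obtain u' where u': "m2 + 1 *\<^sub>R \<tau>2 = w + (m1 + u' *\<^sub>R \<tau>1)" using in2[of 1] by blast
    define \<kappa>0 where "\<kappa>0 = u' - u"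
    have "\<tau>2 = (m2 + 1 *\<^sub>R \<tau>2) - (m2 + 0 *\<^sub>R \<tau>2)" by simp
    also have "\<dots> = \<kappa>0 *\<^sub>R \<tau>1" unfolding u u' by (simp add: \<kappa>0_def algebra_simps)
    finally have \<kappa>0: "\<tau>2 = \<kappa>0 *\<^sub>R \<tau>1" .
    have b1: "b \<bullet> \<tau>1 \<noteq> 0"
    proof
      assume b0: "b \<bullet> \<tau>1 = 0"
      obtain t t' where "l (m1 + t *\<^sub>R \<tau>1) = 0" "l (m2 + t' *\<^sub>R \<tau>2) = 0" using z by blast
      then have "b \<bullet> (m2 - m1) = 0" using b0 by (simp add: bc \<kappa>0 inner_add_right inner_diff_right)
      then obtain k where "m2 - m1 = k *\<^sub>R \<tau>1" using perp_parallel[OF _ b0 bc(1) \<tau>1] by blast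
      then have "m2 = m1 + k *\<^sub>R \<tau>1" by (metis add.commute diff_add_cancel)
      then show False using distinct by blast
    qed
    have "\<forall>\<kappa>. parallel_sides i \<kappa> \<longrightarrow> (b \<bullet> \<tau>1) * (b \<bullet> \<tau>2) > 0"
    proof (intro allI impI)
      fix \<kappa> assume "parallel_sides i \<kappa>"
      then have \<kappa>: "\<kappa> > 0" "\<tau>2 = \<kappa> *\<^sub>R \<tau>1"
        using 1 2 unfolding parallel_sides_def by (auto dest: spec[of _ 1])
      have "(b \<bullet> \<tau>1) * (b \<bullet> \<tau>2) = \<kappa> * (b \<bullet> \<tau>1)\<^sup>2" unfolding \<kappa>(2) by (simp add: power2_eq_square)
      then show "(b \<bullet> \<tau>1) * (b \<bullet> \<tau>2) > 0" using \<kappa>(1) b1 by simp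
    qed
    moreover have "\<not> sides_meet i t1 t2" for t1 t2
    proof
      assume "sides_meet i t1 t2"
      then have "m1 + t1 *\<^sub>R \<tau>1 = m2 + t2 *\<^sub>R \<tau>2" by (simp add: sides_meet_def 1 2)
      then have "m2 = m1 + (t1 - t2 * \<kappa>0) *\<^sub>R \<tau>1" unfolding \<kappa>0 by (simp add: algebra_simps)
      then show False using distinct by blast
    qed
    moreover have "\<forall>t. l (F (pt i (-1) t)) = (b \<bullet> m1 + c) + (b \<bullet> \<tau>1) * t" "\<forall>t. l (F (pt i 1 t)) = (b \<bullet> m2 + c) + (b \<bullet> \<tau>2) * t"
      by (auto simp: bc 1 2 inner_add_right mult.commute)
    ultimately show ?thesis unfolding same_sign_at_meeting_def using bc(2) by blast
  next
    case False
    then obtain \<alpha> \<beta> \<gamma> where g: "\<gamma> \<noteq> 0" "l = (\<lambda>x. \<alpha> * dst i (-1) x + \<beta> * dst i 1 x + \<gamma>)"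
      using assms unfolding admissible_linear_def h by auto
    obtain \<nu>1 \<beta>1 \<nu>2 \<beta>2 where d: "\<And>x. dst i (-1) x = \<nu>1 \<bullet> x + \<beta>1" "\<And>x. dst i 1 x = \<nu>2 \<bullet> x + \<beta>2"
      using dst_affine[of "-1" i] dst_affine[of 1 i] by auto
    define \<nu> \<beta>' where "\<nu> = \<alpha> *\<^sub>R \<nu>1 + \<beta> *\<^sub>R \<nu>2" "\<beta>' = \<alpha> * \<beta>1 + \<beta> * \<beta>2 + \<gamma>"
    have l: "l x = \<nu> \<bullet> x + \<beta>'" for x
      unfolding g(2) d \<nu>_\<beta>'_def by (simp add: inner_add_left algebra_simps)
    have L: "l (F (pt i (-1) t)) = (\<nu> \<bullet> m1 + \<beta>') + (\<nu> \<bullet> \<tau>1) * t" "l (F (pt i 1 t)) = (\<nu> \<bullet> m2 + \<beta>') + (\<nu> \<bullet> \<tau>2) * t" for t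
      by (auto simp: l 1 2 inner_add_right mult.commute)
    have "\<not> parallel_sides i \<kappa>" for \<kappa>
    proof
      assume "parallel_sides i \<kappa>"
      then have \<kappa>: "\<kappa> > 0" "\<tau>2 = \<kappa> *\<^sub>R \<tau>1"
        using 1 2 unfolding parallel_sides_def by (auto dest: spec[of _ 1])
      have "?L2 = (\<lambda>x. (m2 - m1) + x) ` ?L1"
      proof
        show "?L2 \<subseteq> (\<lambda>x. (m2 - m1) + x) ` ?L1"
        proof clarify
          fix t show "m2 + t *\<^sub>R \<tau>2 \<in> (\<lambda>x. (m2 - m1) + x) ` ?L1"
            unfolding image_image \<kappa>(2) by (intro image_eqI[of _ _ "t * \<kappa>"]) auto
        qed
        show "(\<lambda>x. (m2 - m1) + x) ` ?L1 \<subseteq> ?L2"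
        proof clarify
          fix t show "m2 - m1 + (m1 + t *\<^sub>R \<tau>1) \<in> ?L2"
            unfolding \<kappa>(2) using \<kappa>(1) by (intro image_eqI[of _ _ "t / \<kappa>"]) auto
        qed
      qed
      then show False using False unfolding affine_parallel_def by blast
    qed
    moreover have "((\<nu> \<bullet> m1 + \<beta>') + (\<nu> \<bullet> \<tau>1) * t1) * ((\<nu> \<bullet> m2 + \<beta>') + (\<nu> \<bullet> \<tau>2) * t2) > 0" if "sides_meet i t1 t2" for t1 t2
    proof -
      have "l (F (pt i (-1) t1)) = \<gamma>" "l (F (pt i 1 t2)) = \<gamma>"
        using that dst_same[of "-1" i t1] dst_same[of 1 i t2] unfolding g(2) sides_meet_def by auto
      then show ?thesis unfolding L using g(1) by (simp add: zero_less_mult_iff) linarith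
    qed
    ultimately show ?thesis unfolding same_sign_at_meeting_def using L l by blast
  qed
  then show "\<exists>\<alpha>1 \<beta>1 \<alpha>2 \<beta>2. (\<forall>t. l (F (pt i (-1) t)) = \<alpha>1 + \<beta>1 * t) \<and> (\<forall>t. l (F (pt i 1 t)) = \<alpha>2 + \<beta>2 * t) \<and>
     same_sign_at_meeting i \<alpha>1 \<beta>1 \<alpha>2 \<beta>2"
    and "\<exists>\<nu> \<beta>. \<forall>x. l x = \<nu> \<bullet> x + \<beta>" by blast+
qed

end

lemma has_derivative_partials:
  assumes "C_k 1 f"
  shows "(f has_derivative (\<lambda>h. h $ 1 * partial 1 f x + h $ 2 * partial 2 f x)) (at x)"
proof -
  have d: "(f has_derivative frechet_derivative f (at x)) (at x)"
    using assms C_k_Suc_has_derivative[of 0 f x] by simp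
  have l: "linear (frechet_derivative f (at x))" using d has_derivative_linear by blast
  have "frechet_derivative f (at x) h = h $ 1 * partial 1 f x + h $ 2 * partial 2 f x" for h
  proof -
    have h: "h = (h $ 1) *\<^sub>R axis 1 1 + (h $ 2) *\<^sub>R axis 2 1"
      by (simp add: vec_eq_iff forall_2 axis_def)
    have "frechet_derivative f (at x) ((h $ 1) *\<^sub>R axis 1 1 + (h $ 2) *\<^sub>R axis 2 1)
       = h $ 1 * partial 1 f x + h $ 2 * partial 2 f x"
      by (simp add: linear_add[OF l] linear_cmul[OF l] partial_def)
    then show ?thesis using h by simp
  qed
  then have "frechet_derivative f (at x) = (\<lambda>h. h $ 1 * partial 1 f x + h $ 2 * partial 2 f x)" by blast
  with d show ?thesis by simp
qed

context quadrilateral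
begin

definition vanishes_on_sides :: "2 \<Rightarrow> (real^2 \<Rightarrow> real) \<Rightarrow> bool" where
  "vanishes_on_sides i f \<longleftrightarrow> (\<forall>s t. (s = -1 \<or> s = 1) \<longrightarrow> \<bar>t\<bar> \<le> 1 \<longrightarrow> f (F (pt i s t)) = 0)"

text \<open>All that the exact sequences need to know about a basis function of the supplement.\<close>

definition supplement_fun :: "2 \<Rightarrow> nat \<Rightarrow> (real^2 \<Rightarrow> real) \<Rightarrow> bool" where
  "supplement_fun i n f \<longleftrightarrow> continuous_on E f \<and> (\<forall>k. \<exists>h. has_weak_partial (interior E) k f h) \<and>
     odd_profile i n f \<and> (\<forall>j. j \<noteq> i \<longrightarrow> vanishes_on_sides j f)"

lemma pt_in_E: "\<bar>s\<bar> \<le> 1 \<Longrightarrow> \<bar>t\<bar> \<le> 1 \<Longrightarrow> F (pt i s t) \<in> E"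
  by (intro F_in) (simp add: pt_in_ref_square)

subsection \<open>Fully direct supplements\<close>

text \<open>The product of the two adjacent edge distances is a positive multiple of \<open>1 - t\<^sup>2\<close> on each of the
  two sides, and \<open>R\<close> supplies the opposite signs.\<close>

lemma direct_supplement_fun:
  assumes ij: "i \<noteq> j" and l: "admissible_linear E (side F i (-1)) (side F i 1) l"
    and R: "admissible_R E (side F i (-1)) (side F i 1) R"
  shows "supplement_fun i n (\<lambda>x. dst j (-1) x * dst j 1 x * l x ^ n * R x)"
  unfolding supplement_fun_def
proof (intro conjI allI impI)
  let ?p = "\<lambda>x. dst j (-1) x * dst j 1 x * l x ^ n"
  let ?f = "\<lambda>x. ?p x * R x"
  obtain \<eta> \<xi> where R1: "continuous_on E R" "R \<in> H1_on (interior E)" and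
    R2: "\<eta> > 0" "\<xi> > 0" "\<And>x. x \<in> side F i (-1) \<Longrightarrow> R x = - \<eta>" "\<And>x. x \<in> side F i 1 \<Longrightarrow> R x = \<xi>"
    using R unfolding admissible_R_def by blast
  have dk: "C_k k (dst j s)" if s: "s = -1 \<or> s = 1" for k s
  proof -
    obtain \<nu> \<beta> where "\<And>x. dst j s x = \<nu> \<bullet> x + \<beta>" using dst_affine[OF s] by blast
    then have "dst j s = (\<lambda>x. \<nu> \<bullet> x + \<beta>)" by blast
    then show ?thesis using C_k_affine by simp
  qed
  have lk: "C_k k l" for k
  proof -
    obtain \<nu> \<beta> where "\<And>x. l x = \<nu> \<bullet> x + \<beta>" using admissible_linear_on_sides(2)[OF l] by blast
    then have "l = (\<lambda>x. \<nu> \<bullet> x + \<beta>)" by blast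
    then show ?thesis using C_k_affine by simp
  qed
  have p: "C_k k ?p" for k by (intro C_k_mult C_k_power dk lk) auto
  show "continuous_on E ?f"
    by (rule continuous_on_mult[OF continuous_on_subset[OF C_k_continuous[OF p[of 0]]] R1(1)]) simp
  show "\<exists>h. has_weak_partial (interior E) k ?f h" for k
  proof -
    obtain g where "has_weak_partial (interior E) k R g" using R1(2) unfolding H1_on_def by blast
    from has_weak_partial_mult_smooth[OF this p] show ?thesis by blast
  qed
  show "odd_profile i n ?f"
  proof -
    obtain \<alpha>1 \<beta>1 \<alpha>2 \<beta>2 where lp: "\<And>t. l (F (pt i (-1) t)) = \<alpha>1 + \<beta>1 * t" "\<And>t. l (F (pt i 1 t)) = \<alpha>2 + \<beta>2 * t"
     "same_sign_at_meeting i \<alpha>1 \<beta>1 \<alpha>2 \<beta>2"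
      using admissible_linear_on_sides(1)[OF l] by blast
    have "\<exists>k>0. \<forall>t. dst j (-1) (F (pt i s t)) * dst j 1 (F (pt i s t)) = k * (1 - t\<^sup>2)" if s: "s = -1 \<or> s = 1" for s
    proof -
      obtain k k' where k: "k > 0" "k' > 0" "\<And>t. dst j (-1) (F (pt i s t)) = k * (1 - (-1) * t)"
        "\<And>t. dst j 1 (F (pt i s t)) = k' * (1 - 1 * t)"
        using dst_adjacent[OF ij s, of "-1"] dst_adjacent[OF ij s, of 1] by blast
      show ?thesis unfolding k(3,4)
        using k(1,2) by (intro exI[of _ "k * k'"]) (simp add: power2_eq_square algebra_simps)
    qed
    from this[of "-1"] this[of 1] obtain k k' where k: "k > 0" "k' > 0"
      "\<And>t. dst j (-1) (F (pt i (-1) t)) * dst j 1 (F (pt i (-1) t)) = k * (1 - t\<^sup>2)"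
      "\<And>t. dst j (-1) (F (pt i 1 t)) * dst j 1 (F (pt i 1 t)) = k' * (1 - t\<^sup>2)" by blast
    have r: "R (F (pt i (-1) t)) = - \<eta>" "R (F (pt i 1 t)) = \<xi>" if "\<bar>t\<bar> \<le> 1" for t
      using that by (auto intro!: R2 simp: side_eq abs_le_iff)
    show ?thesis unfolding odd_profile_def
    proof (intro exI conjI allI impI)
      show "k * \<eta> > 0" "k' * \<xi> > 0" using k R2 by auto
      show "?f (F (pt i (-1) t)) = - (k * \<eta>) * (1 - t\<^sup>2) * (\<alpha>1 + \<beta>1 * t) ^ n" if "\<bar>t\<bar> \<le> 1" for t
        by (simp add: k(3) lp(1) r[OF that])
      show "?f (F (pt i 1 t)) = (k' * \<xi>) * (1 - t\<^sup>2) * (\<alpha>2 + \<beta>2 * t) ^ n" if "\<bar>t\<bar> \<le> 1" for t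
        by (simp add: k(4) lp(2) r[OF that])
    qed (rule lp(3))
  qed
  show "vanishes_on_sides k ?f" if "k \<noteq> i" for k
  proof -
    have "k = j" using that ij exhaust_2[of k] exhaust_2[of i] exhaust_2[of j] by auto
    then show ?thesis unfolding vanishes_on_sides_def using dst_same[of "-1" j] dst_same[of 1 j] by auto
  qed
qed

subsection \<open>Mapped supplements\<close>

abbreviation G :: "real^2 \<Rightarrow> real^2" where
  "G \<equiv> inv_into ref_square F"

lemma G_F: "y \<in> ref_square \<Longrightarrow> G (F y) = y"
  using inj by (rule inv_into_f_f)

lemma F_G: "x \<in> E \<Longrightarrow> F (G x) = x"
  using image by (auto intro: f_inv_into_f)

lemma G_in: "x \<in> E \<Longrightarrow> G x \<in> ref_square"
  using image by (auto intro: inv_into_into)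

text \<open>In the plane, the determinant with \<open>u\<close> is a multiple of the inner product with a normal \<open>\<nu>\<close> of \<open>u\<close>.\<close>

lemma det_orth_sign:
  fixes \<nu> u v w :: "real^2"
  assumes "\<nu> \<bullet> u = 0" "(\<nu> \<bullet> v) * (\<nu> \<bullet> w) > 0" "u \<noteq> 0"
  shows "(u $ 1 * v $ 2 - u $ 2 * v $ 1) * (u $ 1 * w $ 2 - u $ 2 * w $ 1) > 0"
proof -
  have "\<nu> \<noteq> 0" using assms(2) by auto
  define z :: "real^2" where "z = vector [- u $ 2, u $ 1]"
  have "u \<bullet> z = 0" by (simp add: z_def inner_vec_def sum_2)
  moreover have "u \<bullet> \<nu> = 0" using assms(1) by (simp add: inner_commute)
  ultimately obtain k where k: "z = k *\<^sub>R \<nu>" using perp_parallel[OF _ _ assms(3) \<open>\<nu> \<noteq> 0\<close>] by blast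
  have "k \<noteq> 0" using k assms(3) by (auto simp: z_def vec_eq_iff forall_2)
  have d: "u $ 1 * y $ 2 - u $ 2 * y $ 1 = k * (\<nu> \<bullet> y)" for y :: "real^2"
  proof -
    have "u $ 1 * y $ 2 - u $ 2 * y $ 1 = z \<bullet> y" by (simp add: z_def inner_vec_def sum_2)
    then show ?thesis by (simp add: k)
  qed
  have "k * (\<nu> \<bullet> v) * (k * (\<nu> \<bullet> w)) = k\<^sup>2 * ((\<nu> \<bullet> v) * (\<nu> \<bullet> w))" by (simp add: power2_eq_square)
  also have "\<dots> > 0" using assms(2) \<open>k \<noteq> 0\<close> by simp
  finally show ?thesis unfolding d .
qed

text \<open>The Jacobian determinant of a bilinear map is affine, because its quadratic part is the determinant of
  \<open>d\<close> with itself. At the two ends of a side it has the same sign, since the two adjacent sides point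
  to the same half plane; so it has one sign at all four corners, and then on the square.\<close>

lemma jacobian:
  obtains a b c d where "\<And>x. F x = a + (x $ 1) *\<^sub>R b + (x $ 2) *\<^sub>R c + (x $ 1 * x $ 2) *\<^sub>R d"
    "\<And>y. y \<in> ref_square \<Longrightarrow> (b + y $ 2 *\<^sub>R d) $ 1 * (c + y $ 1 *\<^sub>R d) $ 2 - (b + y $ 2 *\<^sub>R d) $ 2 * (c + y $ 1 *\<^sub>R d) $ 1 \<noteq> 0"
proof -
  obtain a b c d where F: "\<And>x. F x = a + (x $ 1) *\<^sub>R b + (x $ 2) *\<^sub>R c + (x $ 1 * x $ 2) *\<^sub>R d"
    using bilin unfolding bilinear_map_def by blast
  define J where "J s t = (b + t *\<^sub>R d) $ 1 * (c + s *\<^sub>R d) $ 2 - (b + t *\<^sub>R d) $ 2 * (c + s *\<^sub>R d) $ 1" for s t :: real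
  have 1: "F (pt 1 s t) = (a + s *\<^sub>R b) + t *\<^sub>R (c + s *\<^sub>R d)" for s t by (simp add: F pt_component algebra_simps)
  have 2: "F (pt 2 s t) = (a + s *\<^sub>R c) + t *\<^sub>R (b + s *\<^sub>R d)" for s t by (simp add: F pt_component algebra_simps)
  have J2: "J (-1) t * J 1 t > 0" if t: "t = -1 \<or> t = 1" for t
  proof -
    obtain \<nu> \<beta> where \<nu>: "\<And>x. dst 2 t x = \<nu> \<bullet> x + \<beta>" using dst_affine[OF t] by blast
    obtain k k' where k: "k > 0" "k' > 0" "\<And>u. dst 2 t (F (pt 1 (-1) u)) = k * (1 - t * u)" "\<And>u. dst 2 t (F (pt 1 1 u)) = k' * (1 - t * u)"
      using dst_adjacent[of 1 2 "-1" t] dst_adjacent[of 1 2 1 t] t by auto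
    have "\<nu> \<bullet> (c + (-1) *\<^sub>R d) = - k * t" using k(3)[of 0] k(3)[of 1] unfolding 1 \<nu> by (simp add: inner_add_right algebra_simps)
    moreover have "\<nu> \<bullet> (c + 1 *\<^sub>R d) = - k' * t" using k(4)[of 0] k(4)[of 1] unfolding 1 \<nu> by (simp add: inner_add_right algebra_simps)
    ultimately have s: "(\<nu> \<bullet> (c + (-1) *\<^sub>R d)) * (\<nu> \<bullet> (c + 1 *\<^sub>R d)) > 0" using k t by auto
    have "\<nu> \<bullet> (b + t *\<^sub>R d) = 0"
      using dst_same[OF t, of 2 0] dst_same[OF t, of 2 1] unfolding 2 \<nu> by (simp add: inner_add_right)
    moreover have "b + t *\<^sub>R d \<noteq> 0" using side_direction_nonzero[OF t 2] .
    ultimately show ?thesis unfolding J_def by (intro det_orth_sign[of \<nu>] s)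
  qed
  have J1: "J s (-1) * J s 1 > 0" if s: "s = -1 \<or> s = 1" for s
  proof -
    obtain \<nu> \<beta> where \<nu>: "\<And>x. dst 1 s x = \<nu> \<bullet> x + \<beta>" using dst_affine[OF s] by blast
    obtain k k' where k: "k > 0" "k' > 0" "\<And>u. dst 1 s (F (pt 2 (-1) u)) = k * (1 - s * u)" "\<And>u. dst 1 s (F (pt 2 1 u)) = k' * (1 - s * u)"
      using dst_adjacent[of 2 1 "-1" s] dst_adjacent[of 2 1 1 s] s by auto
    have "\<nu> \<bullet> (b + (-1) *\<^sub>R d) = - k * s" using k(3)[of 0] k(3)[of 1] unfolding 2 \<nu> by (simp add: inner_add_right algebra_simps)
    moreover have "\<nu> \<bullet> (b + 1 *\<^sub>R d) = - k' * s" using k(4)[of 0] k(4)[of 1] unfolding 2 \<nu> by (simp add: inner_add_right algebra_simps)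
    ultimately have p: "(\<nu> \<bullet> (b + (-1) *\<^sub>R d)) * (\<nu> \<bullet> (b + 1 *\<^sub>R d)) > 0" using k s by auto
    have "\<nu> \<bullet> (c + s *\<^sub>R d) = 0"
      using dst_same[OF s, of 1 0] dst_same[OF s, of 1 1] unfolding 1 \<nu> by (simp add: inner_add_right)
    moreover have "c + s *\<^sub>R d \<noteq> 0" using side_direction_nonzero[OF s 1] .
    ultimately have "((c + s *\<^sub>R d) $ 1 * (b + (-1) *\<^sub>R d) $ 2 - (c + s *\<^sub>R d) $ 2 * (b + (-1) *\<^sub>R d) $ 1) *
       ((c + s *\<^sub>R d) $ 1 * (b + 1 *\<^sub>R d) $ 2 - (c + s *\<^sub>R d) $ 2 * (b + 1 *\<^sub>R d) $ 1) > 0"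
      by (intro det_orth_sign[of \<nu>] p)
    then show ?thesis unfolding J_def by (simp add: algebra_simps)
  qed
  \<comment> \<open>the coefficients of the affine function \<open>J\<close>\<close>
  define j0 j1 j2 where "j0 = b $ 1 * c $ 2 - b $ 2 * c $ 1" "j1 = b $ 1 * d $ 2 - b $ 2 * d $ 1" "j2 = d $ 1 * c $ 2 - d $ 2 * c $ 1"
  have J: "J s t = j0 + j1 * s + j2 * t" for s t by (simp add: J_def j0_j1_j2_def algebra_simps)
  have "J s t \<noteq> 0" if "\<bar>s\<bar> \<le> 1" "\<bar>t\<bar> \<le> 1" for s t
  proof -
    have c: "(j0 - j1 - j2) * (j0 + j1 - j2) > 0" "(j0 - j1 + j2) * (j0 + j1 + j2) > 0"
      "(j0 - j1 - j2) * (j0 - j1 + j2) > 0"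
      using J2[of "-1"] J2[of 1] J1[of "-1"] by (simp_all add: J)
    have b: "\<bar>j1 * s\<bar> \<le> \<bar>j1\<bar>" "\<bar>j2 * t\<bar> \<le> \<bar>j2\<bar>" using that by (simp_all add: abs_mult mult_left_le)
    \<comment> \<open>the four corner values \<open>j0 \<plusminus> j1 \<plusminus> j2\<close> have one sign\<close>
    have "\<bar>j0\<bar> > \<bar>j1\<bar> + \<bar>j2\<bar>" using c by (auto simp: zero_less_mult_iff)
    then show ?thesis unfolding J using b by linarith
  qed
  then show thesis using that[OF F] unfolding J_def by (auto simp: mem_ref_square)
qed

lemma continuous_on_F: "continuous_on A F"
proof -
  obtain a b c d where "\<And>x. F x = a + (x $ 1) *\<^sub>R b + (x $ 2) *\<^sub>R c + (x $ 1 * x $ 2) *\<^sub>R d"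
    using bilin unfolding bilinear_map_def by blast
  then have "F = (\<lambda>x. a + (x $ 1) *\<^sub>R b + (x $ 2) *\<^sub>R c + (x $ 1 * x $ 2) *\<^sub>R d)" by blast
  then show ?thesis by (auto intro!: continuous_intros)
qed

lemma continuous_on_G: "continuous_on E G"
proof -
  have "compact ref_square" by (simp add: ref_square_def)
  from continuous_on_inv[OF continuous_on_F this, of G] show ?thesis using G_F image by simp
qed

text \<open>The inverse of \<open>F\<close> is continuous by compactness of the square and hence differentiable with the
  inverse matrix as its derivative. Cramer's rule shows that the derivative is continuous.\<close>

lemma pull_weak_partial:
  assumes \<phi>: "\<And>k. C_k k \<phi>"
  shows "\<exists>h. has_weak_partial (interior E) i (pull F \<phi>) h"
proof -
  obtain a b c d where F: "\<And>x. F x = a + (x $ 1) *\<^sub>R b + (x $ 2) *\<^sub>R c + (x $ 1 * x $ 2) *\<^sub>R d"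
    and J0: "\<And>y. y \<in> ref_square \<Longrightarrow> (b + y $ 2 *\<^sub>R d) $ 1 * (c + y $ 1 *\<^sub>R d) $ 2 - (b + y $ 2 *\<^sub>R d) $ 2 * (c + y $ 1 *\<^sub>R d) $ 1 \<noteq> 0"
    using jacobian by blast
  define u where "u y = b + y $ 2 *\<^sub>R d" for y :: "real^2"
  define v where "v y = c + y $ 1 *\<^sub>R d" for y :: "real^2"
  define J where "J y = u y $ 1 * v y $ 2 - u y $ 2 * v y $ 1" for y
  have J: "J y \<noteq> 0" if "y \<in> ref_square" for y using J0[OF that] by (simp add: J_def u_def v_def)
  \<comment> \<open>the inverse of the derivative matrix with columns \<open>u y\<close> and \<open>v y\<close>\<close>
  define D where "D y k = (vector [(k $ 1 * v y $ 2 - k $ 2 * v y $ 1) / J y, (u y $ 1 * k $ 2 - u y $ 2 * k $ 1) / J y] :: real^2)"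
    for y and k :: "real^2"
  have dF: "(F has_derivative (\<lambda>h. h $ 1 *\<^sub>R u y + h $ 2 *\<^sub>R v y)) (at y)" for y
  proof -
    have "((\<lambda>x. a + (x $ 1) *\<^sub>R b + (x $ 2) *\<^sub>R c + (x $ 1 * x $ 2) *\<^sub>R d) has_derivative
      (\<lambda>h. h $ 1 *\<^sub>R u y + h $ 2 *\<^sub>R v y)) (at y)"
      by (auto intro!: derivative_eq_intros bounded_linear_imp_has_derivative bounded_linear_vec_nth
          simp: u_def v_def algebra_simps)
    then show ?thesis using F by presburger
  qed
  have lin: "bounded_linear (D y)" for y
    unfolding linear_conv_bounded_linear[symmetric]
    by (rule linearI) (auto simp: D_def vec_eq_iff forall_2 field_simps add_divide_distrib diff_divide_distrib)
  have inv: "D y \<circ> (\<lambda>h. h $ 1 *\<^sub>R u y + h $ 2 *\<^sub>R v y) = id" if "y \<in> ref_square" for y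
  proof
    fix h :: "real^2"
    have "(h $ 1 * u y $ 1 + h $ 2 * v y $ 1) * v y $ 2 - (h $ 1 * u y $ 2 + h $ 2 * v y $ 2) * v y $ 1 = h $ 1 * J y"
      "u y $ 1 * (h $ 1 * u y $ 2 + h $ 2 * v y $ 2) - u y $ 2 * (h $ 1 * u y $ 1 + h $ 2 * v y $ 1) = h $ 2 * J y"
      by (auto simp: J_def algebra_simps)
    then show "(D y \<circ> (\<lambda>h. h $ 1 *\<^sub>R u y + h $ 2 *\<^sub>R v y)) h = id h"
      using J[OF that] by (simp add: D_def vec_eq_iff forall_2)
  qed
  have dG: "(G has_derivative D (G x)) (at x)" if x: "x \<in> interior E" for x
  proof (rule has_derivative_inverse_basic[where f = F and T = "interior E"])
    have xE: "x \<in> E" using x interior_subset by blast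
    show "(F has_derivative (\<lambda>h. h $ 1 *\<^sub>R u (G x) + h $ 2 *\<^sub>R v (G x))) (at (G x))" by (rule dF)
    show "bounded_linear (D (G x))" by (rule lin)
    show "D (G x) \<circ> (\<lambda>h. h $ 1 *\<^sub>R u (G x) + h $ 2 *\<^sub>R v (G x)) = id" by (rule inv[OF G_in[OF xE]])
    show "isCont G x" using continuous_on_interior[OF continuous_on_G x] .
    show "F (G z) = z" if "z \<in> interior E" for z using that interior_subset F_G by blast
  qed (use x in auto)
  let ?d = "\<lambda>x h. D (G x) h $ 1 * partial 1 \<phi> (G x) + D (G x) h $ 2 * partial 2 \<phi> (G x)"
  have "has_weak_partial (interior E) i (\<lambda>x. \<phi> (G x)) (\<lambda>x. ?d x (axis i 1))"
  proof (rule has_weak_partial_classical[OF open_interior])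
    show "((\<lambda>x. \<phi> (G x)) has_derivative ?d x) (at x)" if "x \<in> interior E" for x
      using has_derivative_compose[OF dG[OF that] has_derivative_partials[OF \<phi>]] .
    have cG: "continuous_on (interior E) G" using continuous_on_G interior_subset by (rule continuous_on_subset)
    have cp: "continuous_on UNIV (partial k \<phi>)" for k
      using \<phi>[of 1] by simp
    have cpG: "continuous_on (interior E) (\<lambda>x. partial k \<phi> (G x))" for k
      by (rule continuous_on_compose2[OF cp cG]) simp
    have cGk: "continuous_on (interior E) (\<lambda>x. G x $ k)" for k
      using cG by (intro continuous_intros)
    have cu: "continuous_on (interior E) (\<lambda>x. u (G x) $ k)" "continuous_on (interior E) (\<lambda>x. v (G x) $ k)" for k
      unfolding u_def v_def using cG by (auto intro!: continuous_intros)
    have cJ: "continuous_on (interior E) (\<lambda>x. J (G x))"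
      unfolding J_def by (intro continuous_intros cu)
    have nJ: "\<forall>x\<in>interior E. J (G x) \<noteq> 0" using J G_in interior_subset by blast
    show "continuous_on (interior E) (\<lambda>x. ?d x (axis i 1))"
      unfolding D_def using nJ by (simp, intro continuous_intros cu cJ cpG) auto
  qed
  then show ?thesis unfolding pull_def[abs_def] by blast
qed

text \<open>On the sides the reference coordinates are the parameters, so the same-sign condition says that the lines
  meet beyond the same end of the two sides.\<close>

lemma mapped_supplement_fun:
  assumes ij: "i \<noteq> j"
  shows "supplement_fun i n (pull F (\<lambda>y. (1 - (y $ j)\<^sup>2) * y $ i * (y $ j) ^ n))"
  unfolding supplement_fun_def
proof (intro conjI allI impI)
  let ?\<phi> = "\<lambda>y::real^2. (1 - (y $ j)\<^sup>2) * y $ i * (y $ j) ^ n"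
  have c: "C_k k ?\<phi>" for k
    by (intro C_k_mult C_k_diff C_k_const C_k_power C_k_component)
  show "continuous_on E (pull F ?\<phi>)"
    unfolding pull_def[abs_def]
    by (rule continuous_on_compose2[OF C_k_continuous[OF c[of 0]] continuous_on_G]) simp
  show "\<exists>h. has_weak_partial (interior E) k (pull F ?\<phi>) h" for k by (rule pull_weak_partial[OF c])
  have v: "pull F ?\<phi> (F (pt k s t)) = ?\<phi> (pt k s t)" if "\<bar>s\<bar> \<le> 1" "\<bar>t\<bar> \<le> 1" for k s t
  proof -
    have "G (F (pt k s t)) = pt k s t" using that by (intro G_F) (simp add: pt_in_ref_square)
    then show ?thesis by (simp only: pull_def)
  qed
  show "odd_profile i n (pull F ?\<phi>)"
    unfolding odd_profile_def
  proof (rule exI[of _ 1], rule exI[of _ 1], rule exI[of _ 0], rule exI[of _ 1], rule exI[of _ 0],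
      rule exI[of _ 1], intro conjI allI impI)
    show "pull F ?\<phi> (F (pt i (-1) t)) = - 1 * (1 - t\<^sup>2) * (0 + 1 * t) ^ n" if "\<bar>t\<bar> \<le> 1" for t
      using that ij by (simp add: v pt_component)
    show "pull F ?\<phi> (F (pt i 1 t)) = 1 * (1 - t\<^sup>2) * (0 + 1 * t) ^ n" if "\<bar>t\<bar> \<le> 1" for t
      using that ij by (simp add: v pt_component)
    show "same_sign_at_meeting i 0 1 0 1"
      unfolding same_sign_at_meeting_def using sides_meet_outside(3) by auto
  qed auto
  show "vanishes_on_sides k (pull F ?\<phi>)" if "k \<noteq> i" for k
  proof -
    have "k = j" using that ij exhaust_2[of k] exhaust_2[of i] exhaust_2[of j] by auto
    then show ?thesis unfolding vanishes_on_sides_def by (auto simp: v pt_component)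
  qed
qed

lemma supplement_basis:
  assumes "DS_supplement E F r S"
  obtains f g where "S = span2 f g" "supplement_fun 1 (r - 1) f" "supplement_fun 2 (r - 1) g"
proof -
  consider "fully_direct_supplement E F r S" | "S = mapped_supplement F r"
    using assms by (auto simp: DS_supplement_def)
  then show thesis
  proof cases
    case 1
    then obtain lH lV RV RH where
      "admissible_linear E (side F 1 (-1)) (side F 1 1) lH" "admissible_linear E (side F 2 (-1)) (side F 2 1) lV"
      "admissible_R E (side F 1 (-1)) (side F 1 1) RV" "admissible_R E (side F 2 (-1)) (side F 2 1) RH"
      and S: "S = span2 (\<lambda>x. dst 2 (-1) x * dst 2 1 x * lH x ^ (r - 1) * RV x)
                  (\<lambda>x. dst 1 (-1) x * dst 1 1 x * lV x ^ (r - 1) * RH x)"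
      unfolding fully_direct_supplement_def Let_def by blast
    then show thesis
      by (intro that[OF S] direct_supplement_fun) auto
  next
    case 2
    show thesis
      by (rule that[OF 2[unfolded mapped_supplement_def]]; rule mapped_supplement_fun) simp_all
  qed
qed

lemma supplement_not_polynomial:
  assumes f: "supplement_fun 1 n f" and g: "supplement_fun 2 n g" and p: "p \<in> polys (n + 2)"
    and e: "\<And>x. x \<in> E \<Longrightarrow> p x = A * f x + B * g x"
  shows "A = 0" "B = 0"
proof -
  have z: "g (F (pt 1 s t)) = 0" "f (F (pt 2 s t)) = 0" if "s = -1 \<or> s = 1" "\<bar>t\<bar> \<le> 1" for s t
    using f g that unfolding supplement_fun_def vanishes_on_sides_def by auto
  have e': "p (F (pt i s t)) = A * f (F (pt i s t)) + B * g (F (pt i s t))" if "s = -1 \<or> s = 1" "\<bar>t\<bar> \<le> 1" for i s t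
    using that by (intro e pt_in_E) auto
  show "A = 0"
    by (rule odd_profile_not_polynomial[of 1 n f p]) (use f p z e' in \<open>auto simp: supplement_fun_def\<close>)
  show "B = 0"
    by (rule odd_profile_not_polynomial[of 2 n g p]) (use g p z e' in \<open>auto simp: supplement_fun_def\<close>)
qed

end

section \<open>Exactness\<close>

lemma has_weak_partial_polys: "p \<in> polys k \<Longrightarrow> open \<Omega> \<Longrightarrow> has_weak_partial \<Omega> i p (partial i p)"
proof -
  assume p: "p \<in> polys k" and o: "open \<Omega>"
  let ?d = "\<lambda>x h. h $ 1 * partial 1 p x + h $ 2 * partial 2 p x"
  have e: "(\<lambda>x. ?d x (axis i 1)) = partial i p"
    using exhaust_2[of i] by (auto simp: axis_def)
  have "continuous_on \<Omega> (partial i p)"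
    using C_k_polys[OF p, of 1] by (auto intro: continuous_on_subset)
  then show ?thesis
    using has_weak_partial_classical[OF o has_derivative_partials[OF C_k_polys[OF p]], of i] unfolding e by blast
qed

lemma has_weak_curl_polys:
  assumes "p \<in> polys k" "open \<Omega>"
  shows "has_weak_curl \<Omega> p (\<lambda>x. vector [partial 2 p x, - partial 1 p x])"
  by (intro has_weak_curl_exists has_weak_partial_polys[OF assms])

lemma continuous_on_polys: "p \<in> polys k \<Longrightarrow> continuous_on A p"
  using C_k_continuous[OF C_k_polys[of p k 0]] by (auto intro: continuous_on_subset)

lemma vec_polysD: "v \<in> vec_polys k \<Longrightarrow> (\<lambda>x. v x $ i) \<in> polys k"
  by (simp add: vec_polys_def)

lemma curl_polys_in_vec_polys:
  assumes "p \<in> polys (Suc k)"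
  shows "(\<lambda>x. vector [partial 2 p x, - partial 1 p x]) \<in> vec_polys k"
proof -
  have d: "partial i p \<in> polys k" for i using partial_polys[OF assms] by simp
  have "(\<lambda>x. (- 1) * partial 1 p x) \<in> polys k" "partial 2 p \<in> polys k" by (rule polys_cmult[OF d], rule d)
  then show ?thesis by (simp add: vec_polys_def forall_2)
qed

lemma hom_times_component_polys:
  assumes "h \<in> hom_polys k"
  shows "(\<lambda>x. h x * x $ i) \<in> polys (Suc k)"
  using assms
proof (induction h rule: hom_polys_induct)
  case (mon c j)
  consider "i = 1" | "i = 2" using exhaust_2[of i] by blast
  then show ?case
  proof cases
    case 1
    have "(\<lambda>x. mon c j (k - j) x * x $ i) = mon c (Suc j) (k - j)" using 1 by (auto simp: mult_ac)
    moreover have "mon c (Suc j) (k - j) \<in> polys (Suc k)" using mon by (intro polys_mon) simp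
    ultimately show ?thesis by simp
  next
    case 2
    have "(\<lambda>x. mon c j (k - j) x * x $ i) = mon c j (Suc (k - j))" using 2 by (auto simp: mult_ac)
    moreover have "mon c j (Suc (k - j)) \<in> polys (Suc k)" using mon by (intro polys_mon) simp
    ultimately show ?thesis by simp
  qed
qed (auto simp: distrib_right intro: polys_add polys_zero)

text \<open>Euler's identity gives \<open>div (x h) = (k + 2) h\<close>.\<close>

lemma has_weak_div_poly_field:
  assumes w: "w \<in> vec_polys k" and h: "h \<in> hom_polys k" and o: "open \<Omega>"
  shows "has_weak_div \<Omega> (\<lambda>x. w x + h x *\<^sub>R x)
    (\<lambda>x. partial 1 (\<lambda>x. w x $ 1) x + partial 2 (\<lambda>x. w x $ 2) x + (real k + 2) * h x)"
proof -
  have a: "has_weak_partial \<Omega> i (\<lambda>x. (w x + h x *\<^sub>R x) $ i) (\<lambda>x. partial i (\<lambda>x. w x $ i) x + (h x + partial i h x * x $ i))" for i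
  proof -
    have "partial i (\<lambda>x. h x * x $ i) = (\<lambda>x. h x * 1 + partial i h x * x $ i)"
      using partial_mult[OF C_k_polys[OF hom_polys_subset[OF h]] C_k_component[of 1 i], of i]
      by (simp add: partial_component)
    then have "has_weak_partial \<Omega> i (\<lambda>x. h x * x $ i) (\<lambda>x. h x + partial i h x * x $ i)"
      using has_weak_partial_polys[OF hom_times_component_polys[OF h] o, of i i] by simp
    from has_weak_partial_add[OF has_weak_partial_polys[OF vec_polysD[OF w] o] this]
    show ?thesis by simp
  qed
  have "(\<lambda>x. partial 1 (\<lambda>x. w x $ 1) x + (h x + partial 1 h x * x $ 1) +
      (partial 2 (\<lambda>x. w x $ 2) x + (h x + partial 2 h x * x $ 2))) =
    (\<lambda>x. partial 1 (\<lambda>x. w x $ 1) x + partial 2 (\<lambda>x. w x $ 2) x + (real k + 2) * h x)"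
  proof
    fix x
    have "x $ 1 * partial 1 h x + x $ 2 * partial 2 h x = real k * h x" by (rule euler_homogeneous[OF h])
    then show "partial 1 (\<lambda>x. w x $ 1) x + (h x + partial 1 h x * x $ 1) +
        (partial 2 (\<lambda>x. w x $ 2) x + (h x + partial 2 h x * x $ 2)) =
      partial 1 (\<lambda>x. w x $ 1) x + partial 2 (\<lambda>x. w x $ 2) x + (real k + 2) * h x"
      by (simp add: algebra_simps)
  qed
  with has_weak_div_of_partials[OF a a] show ?thesis by simp
qed

lemma restr_superset: "f \<in> A \<Longrightarrow> f \<in> restr E A"
  using ae_eq_refl unfolding restr_def by blast

lemma restr_cong: "f \<in> restr E A \<Longrightarrow> ae_eq E f' f \<Longrightarrow> f' \<in> restr E A"
  using ae_eq_trans unfolding restr_def by blast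

lemma fun_sumI: "f \<in> A \<Longrightarrow> g \<in> B \<Longrightarrow> (\<lambda>x. f x + g x) \<in> fun_sum A B"
  unfolding fun_sum_def by blast

lemma x_hom_polysI: "h \<in> hom_polys k \<Longrightarrow> (\<lambda>x. h x *\<^sub>R x) \<in> x_hom_polys k"
  unfolding x_hom_polys_def by blast

lemma span2_mem: "(\<lambda>x. a * f x + b * g x) \<in> span2 f g"
  unfolding span2_def by blast

lemma span2_zero: "(\<lambda>_. 0) \<in> span2 f g"
  using span2_mem[of 0 f 0 g] by simp

context quadrilateral
begin

lemma ae_eq_interior: "ae_eq E u v \<longleftrightarrow> ae_eq (interior E) u v"
proof -
  have c: "closed E" using compact_E by (rule compact_imp_closed)
  have n: "negligible (frontier E)" by (rule negligible_convex_frontier[OF convex_E])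
  have "E = interior E \<union> frontier E" using c interior_subset by (auto simp: frontier_def)
  then have s: "{x \<in> E. u x \<noteq> v x} \<subseteq> {x \<in> interior E. u x \<noteq> v x} \<union> frontier E" by blast
  have t: "{x \<in> interior E. u x \<noteq> v x} \<subseteq> {x \<in> E. u x \<noteq> v x}" using interior_subset by blast
  have m: "E \<in> sets lebesgue" using compact_E by (simp add: fmeasurableD lmeasurable_compact)
  have "negligible {x \<in> E. u x \<noteq> v x} \<longleftrightarrow> negligible {x \<in> interior E. u x \<noteq> v x}"
    using negligible_subset[OF _ s] negligible_subset[OF _ t] n by (auto intro: negligible_Un)
  then show ?thesis using m by (simp add: ae_eq_iff_negligible)
qed

text \<open>The set where the functions differ in the interior is open and null, hence empty; \<open>E\<close> is the
  closure of its interior.\<close>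

lemma ae_eq_continuous_imp_eq:
  fixes u v :: "real^2 \<Rightarrow> real"
  assumes u: "continuous_on E u" and v: "continuous_on E v" and e: "ae_eq E u v" and x: "x \<in> E"
  shows "u x = v x"
proof -
  let ?h = "\<lambda>x. u x - v x"
  have h: "continuous_on E ?h" using u v by (rule continuous_on_diff)
  have "open (interior E \<inter> ?h -` (- {0}))"
    using continuous_on_subset[OF h interior_subset] by (intro continuous_open_preimage) auto
  moreover have "negligible (interior E \<inter> ?h -` (- {0}))"
    using e unfolding ae_eq_interior by (subst (asm) ae_eq_iff_negligible) (auto elim: negligible_subset)
  ultimately have "interior E \<inter> ?h -` (- {0}) = {}" using open_not_negligible by blast
  then have "interior E \<subseteq> {x \<in> E. ?h x = 0}" using interior_subset by auto
  moreover have "closed {x \<in> E. ?h x = 0}"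
    using h compact_E by (intro continuous_closed_preimage_constant) (auto simp: compact_imp_closed)
  ultimately have "closure (interior E) \<subseteq> {x \<in> E. ?h x = 0}" by (rule closure_minimal)
  then show ?thesis using x closure_interior_E by auto
qed

lemma polys_ae_zero:
  assumes "p \<in> polys k" "ae_eq E p (\<lambda>_. 0)"
  shows "p x = 0"
proof -
  obtain x0 where "x0 \<in> interior E" using interior_nonempty by blast
  moreover have "p y = 0" if "y \<in> interior E" for y
    using ae_eq_continuous_imp_eq[OF continuous_on_polys[OF assms(1)] continuous_on_const assms(2)] that interior_subset by blast
  ultimately show ?thesis using polys_zero_of_zero_on_open[OF assms(1) open_interior] by blast
qed

text \<open>The divergence of \<open>w\<close> has degree at most \<open>r - 1\<close>, so the homogeneous term \<open>(r + 2) h\<close> of degree \<open>r\<close> must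
  vanish by itself.\<close>

lemma poly_field_div_zero:
  assumes r: "r \<ge> 1" and w: "w \<in> vec_polys r" and h: "h \<in> hom_polys r"
    and d: "has_weak_div (interior E) (\<lambda>x. w x + h x *\<^sub>R x) (\<lambda>_. 0)"
  shows "\<exists>p\<in>polys (r + 1). has_weak_curl (interior E) p (\<lambda>x. w x + h x *\<^sub>R x)"
proof -
  let ?q = "\<lambda>x. partial 1 (\<lambda>x. w x $ 1) x + partial 2 (\<lambda>x. w x $ 2) x"
  have q: "?q \<in> polys (r - 1)" by (intro polys_add partial_polys vec_polysD w)
  have qh: "(\<lambda>x. ?q x + (real r + 2) * h x) \<in> polys r"
    by (rule polys_add[OF polys_mono[OF _ q] hom_polys_subset[OF hom_polys_cmult[OF h]]]) simp
  have "ae_eq (interior E) (\<lambda>x. ?q x + (real r + 2) * h x) (\<lambda>_. 0)"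
    by (rule has_weak_div_unique[OF open_interior has_weak_div_poly_field[OF w h open_interior] d])
  then have z: "?q x + (real r + 2) * h x = 0" for x
    using polys_ae_zero[OF qh] by (simp add: ae_eq_interior)
  have "(real r + 2) * h x = 0" for x
    by (rule homogeneous_zero_of_lower_degree[OF q _ _ z, of r]) (use hom_polys_scale[OF h] r in auto)
  then have h0: "h x = 0" for x by (simp add: add_nonneg_eq_0_iff)
  then obtain p where p: "p \<in> polys (Suc r)" "partial 2 p = (\<lambda>x. w x $ 1)" "\<And>x. - partial 1 p x = w x $ 2"
    using polys_potential[OF vec_polysD[OF w, of 1] vec_polysD[OF w, of 2]] z by auto
  have "(\<lambda>x. vector [partial 2 p x, - partial 1 p x]) = (\<lambda>x. w x + h x *\<^sub>R x)"
    by (auto simp: fun_eq_iff vec_eq_iff forall_2 p h0)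
  then show ?thesis using has_weak_curl_polys[OF p(1) open_interior] p(1) by auto
qed

context
  fixes r :: nat and S :: "(real^2 \<Rightarrow> real) set"
  assumes r: "r \<ge> 1" and S: "DS_supplement E F r S"
begin

lemma direct_polys_supplement: "direct_on E (polys (r + 1)) S"
  unfolding direct_on_def
proof (intro ballI impI)
  fix p s assume p: "p \<in> polys (r + 1)" and s: "s \<in> S" and e: "ae_eq E p s"
  obtain f g where fg: "S = span2 f g" "supplement_fun 1 (r - 1) f" "supplement_fun 2 (r - 1) g"
    using supplement_basis[OF S] by blast
  obtain A B where AB: "s = (\<lambda>x. A * f x + B * g x)" using s unfolding fg span2_def by blast
  have "continuous_on E s"
    unfolding AB using fg(2,3) unfolding supplement_fun_def by (intro continuous_intros) auto
  then have eq: "p x = A * f x + B * g x" if "x \<in> E" for x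
    using ae_eq_continuous_imp_eq[OF continuous_on_polys[OF p] _ e that] by (simp add: AB)
  \<comment> \<open>\<open>r - 1\<close> is a truncated difference, so this needs \<open>r \<ge> 1\<close>\<close>
  have p': "p \<in> polys (r - 1 + 2)" using p r by simp
  have "A = 0" "B = 0" using supplement_not_polynomial[OF fg(2,3) p' eq] by blast+
  then show "ae_eq E p (\<lambda>_. 0)" using e by (simp add: AB)
qed

lemma supplement_has_curl: "s \<in> S \<Longrightarrow> \<exists>v. has_weak_curl (interior E) s v"
proof -
  assume s: "s \<in> S"
  obtain f g where fg: "S = span2 f g" "supplement_fun 1 (r - 1) f" "supplement_fun 2 (r - 1) g"
    using supplement_basis[OF S] by blast
  obtain A B where AB: "s = (\<lambda>x. A * f x + B * g x)" using s unfolding fg span2_def by blast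
  have "\<exists>v. has_weak_curl (interior E) f' v" if "supplement_fun i n f'" for i n f'
    using that has_weak_curl_exists unfolding supplement_fun_def by blast
  then obtain v w where "has_weak_curl (interior E) f v" "has_weak_curl (interior E) g w" using fg by blast
  then have "has_weak_curl (interior E) s (\<lambda>x. A *\<^sub>R v x + B *\<^sub>R w x)"
    unfolding AB by (intro has_weak_curl_add has_weak_curl_cmult)
  then show ?thesis by blast
qed

lemma zero_in_supplement: "(\<lambda>_. 0) \<in> S"
  using supplement_basis[OF S] span2_zero by metis

lemma curl_const: "has_weak_curl (interior E) (\<lambda>_. c) (\<lambda>_. 0)"
proof -
  have "(\<lambda>x. vector [partial 2 (\<lambda>_. c) x, - partial 1 (\<lambda>_. c) x]) = (\<lambda>_. 0 :: real^2)"
    by (auto simp: partial_const vec_eq_iff forall_2)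
  then show ?thesis using has_weak_curl_polys[OF polys_const[of c 0] open_interior] by simp
qed

text \<open>If a polynomial field is the curl of a supplement function \<open>s\<close>, it is divergence free, hence
  the curl of a polynomial \<open>p\<close>; then \<open>s - p\<close> is constant and \<open>s\<close> is itself a polynomial.\<close>

lemma direct_fields_curl_space: "direct_on E (fun_sum (vec_polys r) (x_hom_polys r)) (curl_space E S)"
  unfolding direct_on_def
proof (intro ballI impI)
  fix u c assume u: "u \<in> fun_sum (vec_polys r) (x_hom_polys r)" and c: "c \<in> curl_space E S" and e: "ae_eq E u c"
  obtain w h where wh: "u = (\<lambda>x. w x + h x *\<^sub>R x)" "w \<in> vec_polys r" "h \<in> hom_polys r"
    using u unfolding fun_sum_def x_hom_polys_def by blast
  obtain s where s: "s \<in> S" "has_weak_curl (interior E) s c" using c unfolding curl_space_def by blast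
  have e': "ae_eq (interior E) c u" using e ae_eq_sym unfolding ae_eq_interior by blast
  have "has_weak_div (interior E) u (\<lambda>_. 0)"
    by (rule has_weak_div_cong_ae[OF has_weak_div_curl[OF s(2)] e' ae_eq_refl open_interior])
  then obtain p where p: "p \<in> polys (r + 1)" "has_weak_curl (interior E) p u"
    using poly_field_div_zero[OF r wh(2,3)] unfolding wh(1) by blast
  have su: "has_weak_curl (interior E) s u" by (rule has_weak_curl_cong_ae[OF s(2) ae_eq_refl e' open_interior])
  have "has_weak_curl (interior E) (\<lambda>x. s x + (- 1) * p x) (\<lambda>x. u x + (- 1) *\<^sub>R u x)"
    by (intro has_weak_curl_add has_weak_curl_cmult su p)
  then have "has_weak_curl (interior E) (\<lambda>x. s x + (- 1) * p x) (\<lambda>_. 0)" by simp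
  then obtain C where "ae_eq (interior E) (\<lambda>x. s x + (- 1) * p x) (\<lambda>_. C)"
    using has_weak_curl_zero_imp_constant[OF open_interior convex_connected[OF convex_interior[OF convex_E]]] by blast
  then have "ae_eq E (\<lambda>x. s x + (- 1) * p x + p x) (\<lambda>x. C + p x)"
    unfolding ae_eq_interior by (rule ae_eq_add[OF _ ae_eq_refl])
  then have sp: "ae_eq E s (\<lambda>x. C + p x)" by simp
  have "(\<lambda>x. C + p x) \<in> polys (r + 1)" by (intro polys_add polys_const p)
  then have "ae_eq E (\<lambda>x. C + p x) (\<lambda>_. 0)"
    using direct_polys_supplement s(1) ae_eq_sym[OF sp] unfolding direct_on_def by blast
  with sp have "ae_eq (interior E) s (\<lambda>_. 0)" using ae_eq_trans unfolding ae_eq_interior by blast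
  then have "has_weak_curl (interior E) (\<lambda>_. 0) u"
    by (rule has_weak_curl_cong_ae[OF su _ ae_eq_refl open_interior])
  from has_weak_curl_unique[OF open_interior this curl_const] show "ae_eq E u (\<lambda>_. 0)"
    by (simp add: ae_eq_interior)
qed

lemma vec_polys_subset_sum: "vec_polys r \<subseteq> fun_sum (vec_polys r) (x_hom_polys r)"
proof
  fix w assume w: "w \<in> vec_polys r"
  from fun_sumI[OF w x_hom_polysI[OF hom_polys_zero[of r]]]
  show "w \<in> fun_sum (vec_polys r) (x_hom_polys r)" by simp
qed

lemma direct_vec_polys_curl_space: "direct_on E (vec_polys r) (curl_space E S)"
  using direct_fields_curl_space vec_polys_subset_sum unfolding direct_on_def by blast

text \<open>Both sides are polynomial, so equality almost everywhere on \<open>E\<close> is equality on the plane, and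
  the degrees \<open>r\<close> and \<open>r + 1\<close> exclude each other.\<close>

lemma direct_vec_polys_x_hom_polys: "direct_on E (vec_polys r) (x_hom_polys r)"
  unfolding direct_on_def
proof (intro ballI impI)
  fix w u assume w: "w \<in> vec_polys r" and u: "u \<in> x_hom_polys r" and e: "ae_eq E w u"
  obtain h where h: "h \<in> hom_polys r" "u = (\<lambda>x. h x *\<^sub>R x)" using u unfolding x_hom_polys_def by blast
  have "w x $ i = 0" for x i
  proof -
    have hp: "(\<lambda>x. (- 1) * (h x * x $ i)) \<in> polys (Suc r)"
      by (rule polys_cmult[OF hom_times_component_polys[OF h(1)]])
    have p: "(\<lambda>x. w x $ i + (- 1) * (h x * x $ i)) \<in> polys (Suc r)"
      using polys_mono[OF _ vec_polysD[OF w, of i], of "Suc r"] hp by (intro polys_add) auto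
    have "ae_eq E (\<lambda>x. w x $ i) (\<lambda>x. u x $ i)" using ae_eq_apply[OF e, of "\<lambda>z. z $ i"] .
    from ae_eq_add[OF this ae_eq_refl, of "\<lambda>x. (- 1) * (h x * x $ i)"]
    have "ae_eq E (\<lambda>x. w x $ i + (- 1) * (h x * x $ i)) (\<lambda>_. 0)" by (simp add: h(2))
    then have z: "w x $ i + (- 1) * (h x * x $ i) = 0" for x by (rule polys_ae_zero[OF p])
    have "(- 1) * (h x * x $ i) = 0"
      by (rule homogeneous_zero_of_lower_degree[OF vec_polysD[OF w, of i] _ _ z, of "Suc r"])
         (auto simp: hom_polys_scale[OF h(1)])
    then show ?thesis using z[of x] by simp
  qed
  then have "w = (\<lambda>_. 0)" by (auto simp: fun_eq_iff vec_eq_iff)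
  then show "ae_eq E w (\<lambda>_. 0)" by (simp add: ae_eq_refl)
qed

text \<open>Both sequences are instances of one statement about a space \<open>W\<close> of polynomial fields whose
  divergence maps onto \<open>Q\<close>; the curls of supplement functions have divergence zero.\<close>

lemma curl_div_exact_of_fields:
  assumes W: "vec_polys r \<subseteq> W" "W \<subseteq> fun_sum (vec_polys r) (x_hom_polys r)"
    and div: "\<And>w. w \<in> W \<Longrightarrow> \<exists>q\<in>Q. has_weak_div (interior E) w q"
    and onto: "\<And>q. q \<in> Q \<Longrightarrow> \<exists>w\<in>W. has_weak_div (interior E) w q"
  shows "curl_div_exact E (DS_space E r S) (restr E (fun_sum W (curl_space E S))) (restr E Q)"
proof -
  let ?\<Omega> = "interior E" and ?D = "DS_space E r S" and ?V = "restr E (fun_sum W (curl_space E S))"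
  note o = open_interior[of E]
  have D: "\<exists>p\<in>polys (r + 1). \<exists>s\<in>S. ae_eq E f (\<lambda>x. p x + s x)" if "f \<in> ?D" for f
    using that unfolding DS_space_def restr_def fun_sum_def by blast
  have D': "f \<in> ?D" if "p \<in> polys (r + 1)" "s \<in> S" "ae_eq E f (\<lambda>x. p x + s x)" for f p s
    using that unfolding DS_space_def restr_def fun_sum_def by blast
  have V: "\<exists>w\<in>W. \<exists>s\<in>S. \<exists>c. has_weak_curl ?\<Omega> s c \<and> ae_eq E v (\<lambda>x. w x + c x)" if "v \<in> ?V" for v
    using that unfolding restr_def fun_sum_def curl_space_def by blast
  have V': "v \<in> ?V" if "w \<in> W" "s \<in> S" "has_weak_curl ?\<Omega> s c" "ae_eq E v (\<lambda>x. w x + c x)" for v w s c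
    using that unfolding restr_def fun_sum_def curl_space_def by blast
  have const: "(\<lambda>_. c) \<in> ?D" for c
    by (rule D'[OF polys_const[of c] zero_in_supplement]) (simp add: ae_eq_refl)
  have curl_map: "\<exists>g\<in>?V. \<forall>f' h. ae_eq E f' f \<longrightarrow> (has_weak_curl ?\<Omega> f' h \<longleftrightarrow> ae_eq E h g)" if f: "f \<in> ?D" for f
  proof -
    obtain p s where ps: "p \<in> polys (r + 1)" "s \<in> S" "ae_eq E f (\<lambda>x. p x + s x)" using D[OF f] by blast
    obtain c where c: "has_weak_curl ?\<Omega> s c" using supplement_has_curl[OF ps(2)] by blast
    let ?w = "\<lambda>x. vector [partial 2 p x, - partial 1 p x] :: real^2"
    have w: "?w \<in> W" using curl_polys_in_vec_polys[of p r] ps(1) W(1) by auto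
    have g: "has_weak_curl ?\<Omega> (\<lambda>x. p x + s x) (\<lambda>x. ?w x + c x)"
      by (intro has_weak_curl_add has_weak_curl_polys[OF ps(1) o] c)
    show ?thesis
    proof (intro bexI[of _ "\<lambda>x. ?w x + c x"] allI impI)
      show "(\<lambda>x. ?w x + c x) \<in> ?V" by (rule V'[OF w ps(2) c ae_eq_refl])
      fix f' h assume "ae_eq E f' f"
      then have e: "ae_eq ?\<Omega> f' (\<lambda>x. p x + s x)" using ae_eq_trans[OF _ ps(3)] by (simp add: ae_eq_interior)
      show "has_weak_curl ?\<Omega> f' h \<longleftrightarrow> ae_eq E h (\<lambda>x. ?w x + c x)"
      proof
        assume "has_weak_curl ?\<Omega> f' h"
        from has_weak_curl_cong_ae[OF this e ae_eq_refl o] g show "ae_eq E h (\<lambda>x. ?w x + c x)"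
          unfolding ae_eq_interior by (rule has_weak_curl_unique[OF o])
      next
        assume "ae_eq E h (\<lambda>x. ?w x + c x)"
        then show "has_weak_curl ?\<Omega> f' h"
          unfolding ae_eq_interior by (rule has_weak_curl_cong_ae[OF g ae_eq_sym[OF e] ae_eq_sym o])
      qed
    qed
  qed
  have div_V: "\<exists>q\<in>Q. \<exists>w\<in>W. \<exists>s\<in>S. \<exists>c. has_weak_curl ?\<Omega> s c \<and> ae_eq E v (\<lambda>x. w x + c x) \<and>
     has_weak_div ?\<Omega> w q \<and> has_weak_div ?\<Omega> v q" if v: "v \<in> ?V" for v
  proof -
    obtain w s c where wsc: "w \<in> W" "s \<in> S" "has_weak_curl ?\<Omega> s c" "ae_eq E v (\<lambda>x. w x + c x)" using V[OF v] by blast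
    obtain q where q: "q \<in> Q" "has_weak_div ?\<Omega> w q" using div[OF wsc(1)] by blast
    have "has_weak_div ?\<Omega> (\<lambda>x. w x + c x) (\<lambda>x. q x + 0)"
      by (rule has_weak_div_add[OF q(2) has_weak_div_curl[OF wsc(3)]])
    then have "has_weak_div ?\<Omega> (\<lambda>x. w x + c x) q" by simp
    moreover have "ae_eq ?\<Omega> (\<lambda>x. w x + c x) v" using ae_eq_sym[OF wsc(4)] by (simp add: ae_eq_interior)
    ultimately have "has_weak_div ?\<Omega> v q" by (rule has_weak_div_cong_ae[OF _ _ ae_eq_refl o])
    with wsc q show ?thesis by blast
  qed
  have div_map: "\<exists>g\<in>restr E Q. \<forall>f' h. ae_eq E f' v \<longrightarrow> (has_weak_div ?\<Omega> f' h \<longleftrightarrow> ae_eq E h g)" if v: "v \<in> ?V" for v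
  proof -
    obtain q where q: "q \<in> Q" "has_weak_div ?\<Omega> v q" using div_V[OF v] by blast
    show ?thesis
    proof (intro bexI[of _ q] allI impI)
      show "q \<in> restr E Q" by (rule restr_superset[OF q(1)])
      fix f' h assume "ae_eq E f' v"
      then have e: "ae_eq ?\<Omega> f' v" by (simp add: ae_eq_interior)
      show "has_weak_div ?\<Omega> f' h \<longleftrightarrow> ae_eq E h q"
      proof
        assume "has_weak_div ?\<Omega> f' h"
        from has_weak_div_cong_ae[OF this e ae_eq_refl o] q(2) show "ae_eq E h q"
          unfolding ae_eq_interior by (rule has_weak_div_unique[OF o])
      next
        assume "ae_eq E h q"
        then show "has_weak_div ?\<Omega> f' h"
          unfolding ae_eq_interior by (rule has_weak_div_cong_ae[OF q(2) ae_eq_sym[OF e] ae_eq_sym o])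
      qed
    qed
  qed
  have ker_curl: "restr E {\<lambda>_. c | c. True} = {\<phi> \<in> ?D. has_weak_curl ?\<Omega> \<phi> (\<lambda>_. 0)}"
  proof (intro equalityI subsetI)
    fix \<phi> :: "real^2 \<Rightarrow> real" assume "\<phi> \<in> restr E {\<lambda>_. c | c. True}"
    then obtain c where c: "ae_eq E \<phi> (\<lambda>_. c)" unfolding restr_def by blast
    have "\<phi> \<in> ?D" using restr_cong[OF _ c] const unfolding DS_space_def by blast
    moreover have "has_weak_curl ?\<Omega> \<phi> (\<lambda>_. 0)"
      using has_weak_curl_cong_ae[OF curl_const _ ae_eq_refl o] ae_eq_sym[OF c] unfolding ae_eq_interior by blast
    ultimately show "\<phi> \<in> {\<phi> \<in> ?D. has_weak_curl ?\<Omega> \<phi> (\<lambda>_. 0)}" by blast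
  next
    fix \<phi> assume "\<phi> \<in> {\<phi> \<in> ?D. has_weak_curl ?\<Omega> \<phi> (\<lambda>_. 0)}"
    then obtain c where "ae_eq ?\<Omega> \<phi> (\<lambda>_. c)"
      using has_weak_curl_zero_imp_constant[OF o convex_connected[OF convex_interior[OF convex_E]]] by blast
    then show "\<phi> \<in> restr E {\<lambda>_. c | c. True}" unfolding restr_def ae_eq_interior by blast
  qed
  have ker_div: "{v. \<exists>\<phi>\<in>?D. has_weak_curl ?\<Omega> \<phi> v} = {v \<in> ?V. has_weak_div ?\<Omega> v (\<lambda>_. 0)}"
  proof (intro equalityI subsetI)
    fix v assume "v \<in> {v. \<exists>\<phi>\<in>?D. has_weak_curl ?\<Omega> \<phi> v}"
    then obtain \<phi> where \<phi>: "\<phi> \<in> ?D" "has_weak_curl ?\<Omega> \<phi> v" by blast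
    obtain g where "g \<in> ?V" "ae_eq E v g" using curl_map[OF \<phi>(1)] \<phi>(2) ae_eq_refl by blast
    then have "v \<in> ?V" by (rule restr_cong)
    with has_weak_div_curl[OF \<phi>(2)] show "v \<in> {v \<in> ?V. has_weak_div ?\<Omega> v (\<lambda>_. 0)}" by blast
  next
    fix v assume "v \<in> {v \<in> ?V. has_weak_div ?\<Omega> v (\<lambda>_. 0)}"
    then have v: "v \<in> ?V" "has_weak_div ?\<Omega> v (\<lambda>_. 0)" by auto
    obtain q w s c where wsc: "w \<in> W" "s \<in> S" "has_weak_curl ?\<Omega> s c" "ae_eq E v (\<lambda>x. w x + c x)"
      and q: "has_weak_div ?\<Omega> w q" "has_weak_div ?\<Omega> v q" using div_V[OF v(1)] by blast
    have "has_weak_div ?\<Omega> w (\<lambda>_. 0)"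
      by (rule has_weak_div_cong_ae[OF q(1) ae_eq_refl has_weak_div_unique[OF o q(2) v(2)] o])
    moreover obtain w' h where "w' \<in> vec_polys r" "h \<in> hom_polys r" "w = (\<lambda>x. w' x + h x *\<^sub>R x)"
      using wsc(1) W(2) unfolding fun_sum_def x_hom_polys_def by blast
    ultimately obtain p where p: "p \<in> polys (r + 1)" "has_weak_curl ?\<Omega> p w"
      using poly_field_div_zero[OF r] by blast
    have "has_weak_curl ?\<Omega> (\<lambda>x. p x + s x) v"
      using has_weak_curl_cong_ae[OF has_weak_curl_add[OF p(2) wsc(3)] ae_eq_refl _ o] ae_eq_sym[OF wsc(4)]
      unfolding ae_eq_interior by blast
    moreover have "(\<lambda>x. p x + s x) \<in> ?D" by (rule D'[OF p(1) wsc(2) ae_eq_refl])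
    ultimately show "v \<in> {v. \<exists>\<phi>\<in>?D. has_weak_curl ?\<Omega> \<phi> v}" by blast
  qed
  have range_div: "{q. \<exists>v\<in>?V. has_weak_div ?\<Omega> v q} = restr E Q"
  proof (intro equalityI subsetI)
    fix q assume "q \<in> {q. \<exists>v\<in>?V. has_weak_div ?\<Omega> v q}"
    then obtain v where v: "v \<in> ?V" "has_weak_div ?\<Omega> v q" by blast
    obtain g where "g \<in> restr E Q" "ae_eq E q g" using div_map[OF v(1)] v(2) ae_eq_refl by blast
    then show "q \<in> restr E Q" by (rule restr_cong)
  next
    fix q assume "q \<in> restr E Q"
    then obtain q0 where q0: "q0 \<in> Q" "ae_eq E q q0" unfolding restr_def by blast
    obtain w where w: "w \<in> W" "has_weak_div ?\<Omega> w q0" using onto[OF q0(1)] by blast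
    have "w \<in> ?V" by (rule V'[OF w(1) zero_in_supplement curl_const]) (simp add: ae_eq_refl)
    moreover have "has_weak_div ?\<Omega> w q"
      using has_weak_div_cong_ae[OF w(2) ae_eq_refl _ o] ae_eq_sym[OF q0(2)] unfolding ae_eq_interior by blast
    ultimately show "q \<in> {q. \<exists>v\<in>?V. has_weak_div ?\<Omega> v q}" by blast
  qed
  have "c = 0" if "ae_eq E (\<lambda>_. c) (\<lambda>_. 0)" for c :: real
    using polys_ae_zero[OF polys_const[of c 0] that] by simp
  then show ?thesis
    unfolding curl_div_exact_def ae_map_def
    using const curl_map div_map ker_curl ker_div range_div by blast
qed

lemma curl_div_exact_full: "curl_div_exact E (DS_space E r S) (V_full E r S) (restr E (polys r))"
  unfolding V_full_def
proof (rule curl_div_exact_of_fields[OF vec_polys_subset_sum subset_refl])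
  fix w assume "w \<in> fun_sum (vec_polys r) (x_hom_polys r)"
  then obtain w' h where wh: "w' \<in> vec_polys r" "h \<in> hom_polys r" "w = (\<lambda>x. w' x + h x *\<^sub>R x)"
    unfolding fun_sum_def x_hom_polys_def by blast
  have "(\<lambda>x. partial 1 (\<lambda>x. w' x $ 1) x + partial 2 (\<lambda>x. w' x $ 2) x) \<in> polys (r - 1)"
    by (intro polys_add partial_polys vec_polysD wh)
  then have "(\<lambda>x. partial 1 (\<lambda>x. w' x $ 1) x + partial 2 (\<lambda>x. w' x $ 2) x + (real r + 2) * h x) \<in> polys r"
    by (intro polys_add[OF polys_mono hom_polys_subset[OF hom_polys_cmult[OF wh(2)]]]) auto
  with has_weak_div_poly_field[OF wh(1,2) open_interior]
  show "\<exists>q\<in>polys r. has_weak_div (interior E) w q" unfolding wh(3) by blast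
next
  fix q assume q: "q \<in> polys r"
  obtain k where k: "r = Suc k" using r by (cases r) auto
  \<comment> \<open>the top degree part of \<open>q\<close> is reached by \<open>x h / (r + 2)\<close>, the rest by an antiderivative\<close>
  obtain q1 h where qh: "q1 \<in> polys k" "h \<in> hom_polys r" "q = (\<lambda>x. q1 x + h x)"
    using polys_split_top q unfolding k by blast
  obtain a where a: "a \<in> polys r" "partial 1 a = q1" using polys_antiderivative[OF qh(1), of 1] unfolding k by blast
  let ?w = "\<lambda>x. vector [a x, 0] :: real^2" and ?h = "\<lambda>x. (1 / (real r + 2)) * h x"
  have w: "?w \<in> vec_polys r" using a(1) by (simp add: vec_polys_def forall_2 polys_zero)
  have h: "?h \<in> hom_polys r" by (rule hom_polys_cmult[OF qh(2)])
  have "(\<lambda>x. partial 1 (\<lambda>x. ?w x $ 1) x + partial 2 (\<lambda>x. ?w x $ 2) x + (real r + 2) * ?h x) = q"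
    by (simp add: a(2) partial_const qh(3))
  with has_weak_div_poly_field[OF w h open_interior] have "has_weak_div (interior E) (\<lambda>x. ?w x + ?h x *\<^sub>R x) q" by simp
  moreover have "(\<lambda>x. ?w x + ?h x *\<^sub>R x) \<in> fun_sum (vec_polys r) (x_hom_polys r)"
    by (rule fun_sumI[OF w x_hom_polysI[OF h]])
  ultimately show "\<exists>w\<in>fun_sum (vec_polys r) (x_hom_polys r). has_weak_div (interior E) w q" by blast
qed

lemma curl_div_exact_red: "curl_div_exact E (DS_space E r S) (V_red E r S) (restr E (polys (r - 1)))"
  unfolding V_red_def
proof (rule curl_div_exact_of_fields[OF subset_refl vec_polys_subset_sum])
  have div: "has_weak_div (interior E) w (\<lambda>x. partial 1 (\<lambda>x. w x $ 1) x + partial 2 (\<lambda>x. w x $ 2) x)"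
    if "w \<in> vec_polys r" for w
    using has_weak_div_poly_field[OF that hom_polys_zero open_interior] by simp
  show "\<exists>q\<in>polys (r - 1). has_weak_div (interior E) w q" if w: "w \<in> vec_polys r" for w
  proof -
    have "(\<lambda>x. partial 1 (\<lambda>x. w x $ 1) x + partial 2 (\<lambda>x. w x $ 2) x) \<in> polys (r - 1)"
      by (intro polys_add partial_polys vec_polysD w)
    with div[OF w] show ?thesis by blast
  qed
  fix q assume q: "q \<in> polys (r - 1)"
  obtain a where a: "a \<in> polys r" "partial 1 a = q" using polys_antiderivative[OF q, of 1] r by auto
  let ?w = "\<lambda>x. vector [a x, 0] :: real^2"
  have w: "?w \<in> vec_polys r" using a(1) by (simp add: vec_polys_def forall_2 polys_zero)
  have "(\<lambda>x. partial 1 (\<lambda>x. ?w x $ 1) x + partial 2 (\<lambda>x. ?w x $ 2) x) = q"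
    by (simp add: a(2) partial_const)
  with div[OF w] w show "\<exists>w\<in>vec_polys r. has_weak_div (interior E) w q" by metis
qed

end

end

theorem mainTheorem4:
  fixes E :: "(real^2) set" and F :: "real^2 \<Rightarrow> real^2" and r :: nat
    and S :: "(real^2 \<Rightarrow> real) set"
  assumes "convex_quadrilateral E"
    and "bilinear_map E F"
    and "r \<ge> 1"
    and "DS_supplement E F r S"
  shows "direct_on E (polys (r + 1)) S \<and>
         direct_on E (vec_polys r) (curl_space E S) \<and>
         direct_on E (vec_polys r) (x_hom_polys r) \<and>
         direct_on E (fun_sum (vec_polys r) (x_hom_polys r)) (curl_space E S) \<and>
         curl_div_exact E (DS_space E r S) (V_full E r S) (restr E (polys r)) \<and>
         curl_div_exact E (DS_space E r S) (V_red E r S) (restr E (polys (r - 1)))"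
proof -
  interpret quadrilateral E F by unfold_locales (fact assms(1), fact assms(2))
  note r = assms(3) and S = assms(4)
  show ?thesis
    by (intro conjI direct_polys_supplement[OF r S] direct_vec_polys_curl_space[OF r S] direct_vec_polys_x_hom_polys[OF r S]
        direct_fields_curl_space[OF r S] curl_div_exact_full[OF r S] curl_div_exact_red[OF r S])
qed

end
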